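(* The following hold (with $s\in\mathbb{R}\setminus\{0\}$): (a) $\|R(is,A)\|=O(|s|^{1/2})$ as $|s|\to\infty$; (b) $\|R(is,A)\|=O(|s|^{-1})$ as $|s|\to0$.
   Context: All spaces are complex. Let $X=\{(u,v,w)\in H^1(-1,0)\times L^2(-1,0)\times L^2(0,\infty): u(-1)=0\}$, a Hilbert space with norm $\|(u,v,w)\|_X^2=\|u'\|_{L^2(-1,0)}^2+\|v\|_{L^2(-1,0)}^2+\|w\|_{L^2(0,\infty)}^2$. Define the operator $A$ on $X$ by $A(u,v,w)=(v,u'',w'')$ with domain $D(A)$ consisting of all $(u,v,w)\in H^2(-1,0)\times H^1(-1,0)\times H^2(0,\infty)$ such that $u(-1)=0$, $v(-1)=0$, $u'(0)=w'(0)$ and $v(0)=w(0)$. For $\lambda$ in the resolvent set $\rho(A)$, $R(\lambda,A)=(\lambda-A)^{-1}$, and $\|R(\lambda,A)\|$ is its operator norm on $X$. One has $\sigma(A)\cap i\mathbb{R}=\{0\}$, so $R(is,A)$ is defined for every $s\in\mathbb{R}\setminus\{0\}$. Notation: $f(s)=O(g(s))$ as $|s|\to\infty$ (respectively $|s|\to0$) means there is a constant $C>0$ with $f(s)\le Cg(s)$ for all $s\in\mathbb{R}\setminus\{0\}$ with $|s|$ sufficiently large (respectively sufficiently small). *)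

theory Defs
  imports "HOL-Analysis.Analysis" "HOL-Library.Landau_Symbols"
begin

section \<open>The spaces \<open>L\<^sup>2(I)\<close> as types\<close>

text \<open>The open set \<open>I\<close> is attached to an index type \<open>'i\<close>, so that \<open>'i L2\<close> is the Hilbert space
  of (classes modulo null sets of) complex-valued functions on \<open>I\<close>. Only the values on \<open>I\<close> of a
  representative \<open>real \<Rightarrow> complex\<close> matter.\<close>

class interval_index =
  fixes interval_of :: "'a itself \<Rightarrow> real set"
  assumes open_interval_of: "open (interval_of TYPE('a))"

datatype wave = Wave
datatype heat = Heat

instantiation wave :: interval_index
begin
definition interval_of_wave_def: "interval_of (_ :: wave itself) = {-1<..<0 :: real}"
instance by standard (simp add: interval_of_wave_def)
end

instantiation heat :: interval_index
begin
definition interval_of_heat_def: "interval_of (_ :: heat itself) = {0 :: real<..}"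
instance by standard (simp add: interval_of_heat_def)
end

definition square_integrable :: "real set \<Rightarrow> (real \<Rightarrow> complex) \<Rightarrow> bool" where
  "square_integrable I f \<longleftrightarrow>
     f \<in> borel_measurable (lebesgue_on I) \<and> integrable (lebesgue_on I) (\<lambda>x. (cmod (f x))\<^sup>2)"

definition L2_rel :: "real set \<Rightarrow> (real \<Rightarrow> complex) \<Rightarrow> (real \<Rightarrow> complex) \<Rightarrow> bool" where
  "L2_rel I f g \<longleftrightarrow>
     square_integrable I f \<and> square_integrable I g \<and> (AE x in lebesgue_on I. f x = g x)"

lemma square_integrable_zero: "square_integrable I (\<lambda>x. 0)"
  by (simp add: square_integrable_def)

lemma square_integrable_scale:
  assumes "square_integrable I f" shows "square_integrable I (\<lambda>x. c * f x)"
  using assms by (auto simp: square_integrable_def norm_mult power_mult_distrib)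

lemma square_integrable_add:
  assumes "square_integrable I f" "square_integrable I g"
  shows "square_integrable I (\<lambda>x. f x + g x)"
proof -
  have "integrable (lebesgue_on I) (\<lambda>x. (cmod (f x + g x))\<^sup>2)"
  proof (rule Bochner_Integration.integrable_bound)
    show "integrable (lebesgue_on I) (\<lambda>x. 2 * (cmod (f x))\<^sup>2 + 2 * (cmod (g x))\<^sup>2)"
      using assms by (auto simp: square_integrable_def)
    show "(\<lambda>x. (cmod (f x + g x))\<^sup>2) \<in> borel_measurable (lebesgue_on I)"
      using assms by (auto simp: square_integrable_def)
    have "(cmod (a + b))\<^sup>2 \<le> 2 * (cmod a)\<^sup>2 + 2 * (cmod b)\<^sup>2" for a b
    proof -
      have "(cmod (a + b))\<^sup>2 \<le> (cmod a + cmod b)\<^sup>2"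
        by (simp add: norm_triangle_ineq power_mono)
      also have "\<dots> \<le> 2 * (cmod a)\<^sup>2 + 2 * (cmod b)\<^sup>2"
        using sum_squares_bound[of "cmod a" "cmod b"] by (simp add: power2_sum)
      finally show ?thesis .
    qed
    then show "AE x in lebesgue_on I. norm ((cmod (f x + g x))\<^sup>2)
        \<le> norm (2 * (cmod (f x))\<^sup>2 + 2 * (cmod (g x))\<^sup>2)"
      by (intro AE_I2) (simp add: abs_of_nonneg)
  qed
  then show ?thesis
    using assms by (auto simp: square_integrable_def)
qed

lemma integrable_inner_square_integrable:
  assumes "square_integrable I f" "square_integrable I g"
  shows "integrable (lebesgue_on I) (\<lambda>x. f x \<bullet> g x)"
proof (rule Bochner_Integration.integrable_bound)
  show "integrable (lebesgue_on I) (\<lambda>x. (cmod (f x))\<^sup>2 + (cmod (g x))\<^sup>2)"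
    using assms by (auto simp: square_integrable_def)
  show "(\<lambda>x. f x \<bullet> g x) \<in> borel_measurable (lebesgue_on I)"
    using assms by (auto simp: square_integrable_def)
  have "\<bar>a \<bullet> b\<bar> \<le> (cmod a)\<^sup>2 + (cmod b)\<^sup>2" for a b
  proof -
    have "\<bar>a \<bullet> b\<bar> \<le> cmod a * cmod b" by (rule Cauchy_Schwarz_ineq2)
    moreover have "2 * (cmod a * cmod b) \<le> (cmod a)\<^sup>2 + (cmod b)\<^sup>2"
      using sum_squares_bound[of "cmod a" "cmod b"] by simp
    moreover have "0 \<le> cmod a * cmod b" by simp
    ultimately show ?thesis by linarith
  qed
  then show "AE x in lebesgue_on I. norm (f x \<bullet> g x) \<le> norm ((cmod (f x))\<^sup>2 + (cmod (g x))\<^sup>2)"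
    by (intro AE_I2) simp
qed

lemma L2_rel_part_equivp: "part_equivp (L2_rel I)"
proof (rule part_equivpI)
  show "\<exists>f. L2_rel I f f"
    by (rule exI[of _ "\<lambda>x. 0"]) (simp add: L2_rel_def square_integrable_zero)
  show "symp (L2_rel I)"
    by (auto intro!: sympI simp: L2_rel_def eq_commute)
  show "transp (L2_rel I)"
  proof (rule transpI)
    fix f g h assume a: "L2_rel I f g" "L2_rel I g h"
    then have "AE x in lebesgue_on I. f x = g x" "AE x in lebesgue_on I. g x = h x"
      by (auto simp: L2_rel_def)
    then have "AE x in lebesgue_on I. f x = h x" by eventually_elim simp
    with a show "L2_rel I f h" by (simp add: L2_rel_def)
  qed
qed

lemma L2_rel_refl: "L2_rel I f f \<longleftrightarrow> square_integrable I f"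
  by (simp add: L2_rel_def)

lemma L2_rel_add:
  assumes "L2_rel I f f'" "L2_rel I g g'"
  shows "L2_rel I (\<lambda>x. f x + g x) (\<lambda>x. f' x + g' x)"
proof -
  have "AE x in lebesgue_on I. f x = f' x" "AE x in lebesgue_on I. g x = g' x"
    using assms by (auto simp: L2_rel_def)
  then have "AE x in lebesgue_on I. f x + g x = f' x + g' x" by eventually_elim simp
  with assms show ?thesis by (simp add: L2_rel_def square_integrable_add)
qed

lemma L2_rel_scale:
  assumes "L2_rel I f f'" shows "L2_rel I (\<lambda>x. c * f x) (\<lambda>x. c * f' x)"
proof -
  have "AE x in lebesgue_on I. f x = f' x"
    using assms by (auto simp: L2_rel_def)
  then have "AE x in lebesgue_on I. c * f x = c * f' x" by eventually_elim simp
  with assms show ?thesis by (simp add: L2_rel_def square_integrable_scale)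
qed

text \<open>Spelled out because \<^verbatim>\<open>quotient_type\<close> does not accept a type parameter that is absent
  from the raw type. \<open>rep_L2\<close> chooses a representative.\<close>

typedef (overloaded) 'a L2 =
    "{C. \<exists>f. L2_rel (interval_of TYPE('a::interval_index)) f f \<and>
       C = Collect (L2_rel (interval_of TYPE('a)) f)}"
  morphisms class_of_L2 L2_of_class
proof -
  have "L2_rel (interval_of TYPE('a)) (\<lambda>x. 0) (\<lambda>x. 0)"
    by (simp add: L2_rel_def square_integrable_zero)
  then show ?thesis by blast
qed

definition abs_L2 :: "(real \<Rightarrow> complex) \<Rightarrow> 'a::interval_index L2" where
  "abs_L2 f = L2_of_class (Collect (L2_rel (interval_of TYPE('a)) f))"

definition rep_L2 :: "'a::interval_index L2 \<Rightarrow> real \<Rightarrow> complex" where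
  "rep_L2 a = (SOME f. f \<in> class_of_L2 a)"

definition cr_L2 :: "(real \<Rightarrow> complex) \<Rightarrow> 'a::interval_index L2 \<Rightarrow> bool" where
  "cr_L2 f a \<longleftrightarrow> L2_rel (interval_of TYPE('a)) f f \<and> abs_L2 f = a"

lemma Quotient_L2:
  "Quotient (L2_rel (interval_of TYPE('a))) abs_L2 rep_L2
     (cr_L2 :: _ \<Rightarrow> 'a::interval_index L2 \<Rightarrow> bool)"
proof -
  let ?R = "L2_rel (interval_of TYPE('a))"
  interpret q: quot_type ?R "L2_of_class :: _ \<Rightarrow> 'a L2" class_of_L2
  proof
    show "part_equivp ?R" by (rule L2_rel_part_equivp)
    show "\<exists>f. ?R f f \<and> class_of_L2 y = Collect (?R f)" for y :: "'a L2"
      using class_of_L2[of y] by blast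
    show "L2_of_class (class_of_L2 y) = y" for y :: "'a L2"
      by (rule class_of_L2_inverse)
    show "class_of_L2 (L2_of_class C :: 'a L2) = C" if "\<exists>f. ?R f f \<and> C = Collect (?R f)" for C
      using that by (intro L2_of_class_inverse) blast
    show "class_of_L2 y = class_of_L2 z \<longleftrightarrow> y = z" for y z :: "'a L2"
      by (rule class_of_L2_inject)
  qed
  have "q.abs = abs_L2" "q.rep = rep_L2"
    by (simp_all add: q.abs_def q.rep_def abs_L2_def rep_L2_def fun_eq_iff)
  then have "Quotient3 ?R (abs_L2 :: _ \<Rightarrow> 'a L2) rep_L2"
    using q.Quotient by simp
  then show ?thesis
    by (rule Quotient3_to_Quotient) (simp add: cr_L2_def[abs_def])
qed

setup_lifting Quotient_L2

instantiation L2 :: (interval_index) real_vector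
begin

lift_definition zero_L2 :: "'a L2" is "\<lambda>x. 0"
  by (simp add: L2_rel_def square_integrable_zero)

lift_definition plus_L2 :: "'a L2 \<Rightarrow> 'a L2 \<Rightarrow> 'a L2" is "\<lambda>f g x. f x + g x"
  by (rule L2_rel_add)

lift_definition uminus_L2 :: "'a L2 \<Rightarrow> 'a L2" is "\<lambda>f x. - f x"
  using L2_rel_scale[where c = "-1"] by simp

definition minus_L2 :: "'a L2 \<Rightarrow> 'a L2 \<Rightarrow> 'a L2" where
  "minus_L2 f g = f + (- g)"

lift_definition scaleR_L2 :: "real \<Rightarrow> 'a L2 \<Rightarrow> 'a L2" is "\<lambda>r f x. r *\<^sub>R f x"
  unfolding scaleR_conv_of_real by (rule L2_rel_scale)

instance
proof
  fix a b c :: "'a L2" and r s :: real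
  show "a + b + c = a + (b + c)"
    by transfer (simp add: L2_rel_refl add.assoc square_integrable_add)
  show "a + b = b + a"
    by transfer (subst add.commute, rule L2_rel_add)
  show "0 + a = a"
    by transfer simp
  show "- a + a = 0"
    by transfer (simp add: L2_rel_refl square_integrable_zero)
  show "a - b = a + - b" by (rule minus_L2_def)
  show "r *\<^sub>R (a + b) = r *\<^sub>R a + r *\<^sub>R b"
    by transfer (simp add: L2_rel_refl scaleR_conv_of_real distrib_left square_integrable_add
        square_integrable_scale)
  show "(r + s) *\<^sub>R a = r *\<^sub>R a + s *\<^sub>R a"
    by transfer (simp add: L2_rel_refl scaleR_conv_of_real distrib_right square_integrable_add
        square_integrable_scale)
  show "r *\<^sub>R s *\<^sub>R a = (r * s) *\<^sub>R a"
    by transfer (simp add: L2_rel_refl scaleR_conv_of_real mult.assoc square_integrable_scale)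
  show "1 *\<^sub>R a = a"
    by transfer simp
qed

end

instantiation L2 :: (interval_index) real_inner
begin

text \<open>The real part of the complex inner product.\<close>

lift_definition inner_L2 :: "'a L2 \<Rightarrow> 'a L2 \<Rightarrow> real" is
  "\<lambda>f g. integral\<^sup>L (lebesgue_on (interval_of TYPE('a))) (\<lambda>x. f x \<bullet> g x)"
proof -
  fix f f' g g' :: "real \<Rightarrow> complex"
  let ?I = "interval_of TYPE('a)"
  assume a: "L2_rel ?I f f'" "L2_rel ?I g g'"
  then have "AE x in lebesgue_on ?I. f x = f' x" "AE x in lebesgue_on ?I. g x = g' x"
    by (auto simp: L2_rel_def)
  then have "AE x in lebesgue_on ?I. f x \<bullet> g x = f' x \<bullet> g' x" by eventually_elim simp
  with a show "integral\<^sup>L (lebesgue_on ?I) (\<lambda>x. f x \<bullet> g x)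
      = integral\<^sup>L (lebesgue_on ?I) (\<lambda>x. f' x \<bullet> g' x)"
    by (intro integral_cong_AE) (auto simp: L2_rel_def square_integrable_def)
qed

lift_definition norm_L2 :: "'a L2 \<Rightarrow> real" is
  "\<lambda>f. sqrt (integral\<^sup>L (lebesgue_on (interval_of TYPE('a))) (\<lambda>x. (cmod (f x))\<^sup>2))"
proof -
  fix f g :: "real \<Rightarrow> complex"
  let ?I = "interval_of TYPE('a)"
  assume a: "L2_rel ?I f g"
  then have "AE x in lebesgue_on ?I. f x = g x"
    by (auto simp: L2_rel_def)
  then have "AE x in lebesgue_on ?I. (cmod (f x))\<^sup>2 = (cmod (g x))\<^sup>2" by eventually_elim simp
  with a show "sqrt (integral\<^sup>L (lebesgue_on ?I) (\<lambda>x. (cmod (f x))\<^sup>2))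
      = sqrt (integral\<^sup>L (lebesgue_on ?I) (\<lambda>x. (cmod (g x))\<^sup>2))"
    by (intro arg_cong[where f = sqrt] integral_cong_AE)
       (auto simp: L2_rel_def square_integrable_def)
qed

definition sgn_L2 :: "'a L2 \<Rightarrow> 'a L2" where
  "sgn_L2 f = f /\<^sub>R norm f"

definition dist_L2 :: "'a L2 \<Rightarrow> 'a L2 \<Rightarrow> real" where
  "dist_L2 f g = norm (f - g)"

definition uniformity_L2 :: "('a L2 \<times> 'a L2) filter" where
  "uniformity_L2 = (INF e\<in>{0<..}. principal {(x, y). dist x y < e})"

definition open_L2 :: "'a L2 set \<Rightarrow> bool" where
  "open_L2 U \<longleftrightarrow> (\<forall>x\<in>U. eventually (\<lambda>(x', y). x' = x \<longrightarrow> y \<in> U) uniformity)"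

instance
proof
  fix a b c :: "'a L2" and r :: real
  let ?M = "lebesgue_on (interval_of TYPE('a))"
  show "dist a b = norm (a - b)" by (simp add: dist_L2_def)
  show "sgn a = a /\<^sub>R norm a" by (simp add: sgn_L2_def)
  show "a \<bullet> b = b \<bullet> a"
    by transfer (simp add: inner_commute)
  show "(a + b) \<bullet> c = a \<bullet> c + b \<bullet> c"
    by transfer (auto simp: inner_add_left L2_rel_def
      intro!: Bochner_Integration.integral_add integrable_inner_square_integrable)
  show "(r *\<^sub>R a) \<bullet> b = r * (a \<bullet> b)"
    by transfer simp
  show "0 \<le> a \<bullet> a"
    by transfer simp
  show "a \<bullet> a = 0 \<longleftrightarrow> a = 0"
  proof transfer
    fix f assume f: "L2_rel (interval_of TYPE('a)) f f"
    then have "integrable ?M (\<lambda>x. f x \<bullet> f x)"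
      by (auto simp: L2_rel_def intro: integrable_inner_square_integrable)
    then have "integral\<^sup>L ?M (\<lambda>x. f x \<bullet> f x) = 0 \<longleftrightarrow> (AE x in ?M. f x \<bullet> f x = 0)"
      by (intro integral_nonneg_eq_0_iff_AE) auto
    then show "integral\<^sup>L ?M (\<lambda>x. f x \<bullet> f x) = 0 \<longleftrightarrow> L2_rel (interval_of TYPE('a)) f (\<lambda>x. 0)"
      using f by (simp add: L2_rel_def square_integrable_zero)
  qed
  show "norm a = sqrt (a \<bullet> a)"
    by transfer (simp add: dot_square_norm)
qed (simp_all add: uniformity_L2_def open_L2_def)

end

lift_definition scaleC :: "complex \<Rightarrow> 'i::interval_index L2 \<Rightarrow> 'i L2" (infixr \<open>*\<^sub>C\<close> 75)
  is "\<lambda>c f x. c * f x"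
  by (rule L2_rel_scale)


section \<open>Sobolev spaces and boundary values\<close>

text \<open>Real-valued test functions suffice: those with complex values give the same weak
  derivatives, by linearity.\<close>

definition test_function :: "real set \<Rightarrow> (real \<Rightarrow> real) \<Rightarrow> bool" where
  "test_function I \<phi> \<longleftrightarrow>
     (\<forall>n x. (deriv ^^ n) \<phi> differentiable (at x)) \<and>
     (\<exists>K. compact K \<and> K \<subseteq> I \<and> (\<forall>x. x \<notin> K \<longrightarrow> \<phi> x = 0))"

definition has_weak_derivative :: "'i::interval_index L2 \<Rightarrow> 'i L2 \<Rightarrow> bool" where
  "has_weak_derivative f g \<longleftrightarrow>
     (\<forall>\<phi>. test_function (interval_of TYPE('i)) \<phi> \<longrightarrow>
        (LINT x|lebesgue_on (interval_of TYPE('i)). deriv \<phi> x *\<^sub>R rep_L2 f x) =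
        - (LINT x|lebesgue_on (interval_of TYPE('i)). \<phi> x *\<^sub>R rep_L2 g x))"

definition weak_derivative :: "'i::interval_index L2 \<Rightarrow> 'i L2" where
  "weak_derivative f = (THE g. has_weak_derivative f g)"

definition H1 :: "'i::interval_index L2 set" where
  "H1 = {f. \<exists>g. has_weak_derivative f g}"

definition H2 :: "'i::interval_index L2 set" where
  "H2 = {f \<in> H1. weak_derivative f \<in> H1}"

text \<open>Value at a point of the closed interval of the continuous representative.\<close>

definition value_at :: "'i::interval_index L2 \<Rightarrow> real \<Rightarrow> complex" where
  "value_at f x = (THE c. \<exists>F. continuous_on (closure (interval_of TYPE('i))) F \<and>
     (AE y in lebesgue_on (interval_of TYPE('i)). rep_L2 f y = F y) \<and> F x = c)"


section \<open>The wave-heat operator\<close>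

type_synonym state = "wave L2 \<times> wave L2 \<times> heat L2"

definition state_space :: "state set" where
  "state_space = {(u, v, w). u \<in> H1 \<and> value_at u (-1) = 0}"

definition state_norm :: "state \<Rightarrow> real" where
  "state_norm = (\<lambda>(u, v, w). sqrt ((norm (weak_derivative u))\<^sup>2 + (norm v)\<^sup>2 + (norm w)\<^sup>2))"

definition scale_state :: "complex \<Rightarrow> state \<Rightarrow> state" where
  "scale_state c = (\<lambda>(u, v, w). (c *\<^sub>C u, c *\<^sub>C v, c *\<^sub>C w))"

definition wave_heat_dom :: "state set" where
  "wave_heat_dom = {(u, v, w). u \<in> H2 \<and> v \<in> H1 \<and> w \<in> H2 \<and>
     value_at u (-1) = 0 \<and> value_at v (-1) = 0 \<and>
     value_at (weak_derivative u) 0 = value_at (weak_derivative w) 0 \<and>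
     value_at v 0 = value_at w 0}"

definition wave_heat_op :: "state \<Rightarrow> state" where
  "wave_heat_op = (\<lambda>(u, v, w).
     (v, weak_derivative (weak_derivative u), weak_derivative (weak_derivative w)))"

definition shifted_op :: "complex \<Rightarrow> state \<Rightarrow> state" where
  "shifted_op \<mu> z = scale_state \<mu> z - wave_heat_op z"

text \<open>The resolvent and its norm are meaningful only for points of the resolvent set.\<close>

definition resolvent :: "complex \<Rightarrow> state \<Rightarrow> state" where
  "resolvent \<mu> = inv_into wave_heat_dom (shifted_op \<mu>)"

definition resolvent_set :: "complex set" where
  "resolvent_set = {\<mu>. bij_betw (shifted_op \<mu>) wave_heat_dom state_space \<and>
     (\<exists>C. \<forall>y\<in>state_space. state_norm (resolvent \<mu> y) \<le> C * state_norm y)}"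

text \<open>Same shape as \<^const>\<open>onorm\<close>, with the supremum restricted to \<open>state_space\<close>; the zero vector
  contributes \<open>0 / 0 = 0\<close>.\<close>

definition state_onorm :: "(state \<Rightarrow> state) \<Rightarrow> real" where
  "state_onorm T = (SUP y\<in>state_space. state_norm (T y) / state_norm y)"

end

theory Submission
  imports Defs
begin

text \<open>
  Write \<open>p = u'\<close> and \<open>k\<close> for the square root of \<open>\<i> s\<close> with positive real part. The resolvent equation
  for the data \<open>(f, g, h)\<close> then reads
  \<open>v' = \<i> s p - f'\<close>, \<open>p' = \<i> s v - g\<close> on \<open>(-1, 0)\<close> and \<open>w'' = k\<^sup>2 w - h\<close> on \<open>(0, \<infinity>)\<close>.
  On the wave side \<open>v + p\<close> and \<open>v - p\<close> are transported with phase factors of modulus one, so \<open>v\<close> and \<open>p\<close> are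
  bounded by the data plus the modulus of the only free parameter \<open>c = p (-1)\<close>
  (\<open>wave_first_order_system_solution\<close>). On the heat side the square integrable solutions are
  \<open>b exp (- k x) + W x\<close>, where \<open>W\<close> is a particular solution obtained by factoring the equation into
  two first-order equations, each controlled by an energy estimate (\<open>heat_particular_solution\<close>).

  The two interface conditions eliminate \<open>b\<close> and determine \<open>c\<close> through a scalar equation with
  coefficient \<open>cos s + \<i> k sin s\<close>. Since the argument of \<open>k\<close> is \<open>\<pi> / 4\<close> or \<open>- \<pi> / 4\<close>, this coefficient has modulus
  at least \<open>min 1 (Re k) / 2\<close> (\<open>interface_determinant_bound\<close>), whereas the right-hand side is at most of
  the order of \<open>1 + cmod k\<close> for large \<open>s\<close>. This gives the growth \<open>\<bar>s\<bar> powr (1/2)\<close>. For small \<open>s\<close> the particular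
  solution of the heat equation has size \<open>1 / (Re k)\<^sup>2\<close>, which is of the order of \<open>1 / \<bar>s\<bar>\<close>, and the
  other contributions are of the same order or smaller. The estimate
  \<open>69 (sqrt (\<bar>s\<bar> / 2) + 2 / \<bar>s\<bar>)\<close> for the resolvent covers both regimes at once
  (\<open>resolvent_equation_solvable\<close>, \<open>imaginary_resolvent\<close>), and injectivity follows from the same matching
  argument with zero data (\<open>shifted_op_kernel_trivial\<close>).

  To work with explicit solutions, elements of \<open>H\<^sup>1\<close> are identified with primitives of square
  integrable functions (\<open>has_weak_derivative_iff\<close>). This rests on integration by parts for absolutely
  continuous functions (\<open>integral_by_parts_primitive\<close>) and on the lemma of du Bois-Reymond
  (\<open>AE_const_if_orthogonal_to_derivatives\<close>), for which smooth bump functions are constructed.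
\<close>

section \<open>Primitives of locally integrable functions\<close>

lemma Icc_subset_interval: "is_interval S \<Longrightarrow> x \<in> S \<Longrightarrow> y \<in> S \<Longrightarrow> {x..y} \<subseteq> (S :: real set)"
  by (meson atLeastAtMost_iff mem_is_interval_1_I subsetI)

lemma integrable_lebesgue_borel_representative:
  fixes f :: "real \<Rightarrow> complex"
  assumes "integrable lebesgue f"
  obtains g where "integrable lborel g" "AE x in lebesgue. f x = g x"
proof -
  have m: "(\<lambda>x. Re (f x)) \<in> borel_measurable lebesgue" "(\<lambda>x. Im (f x)) \<in> borel_measurable lebesgue"
    using assms by auto
  obtain p where p: "p \<in> borel_measurable lborel" "AE x in lborel. Re (f x) = p x"
    using completion_ex_borel_measurable_real[OF m(1)] by auto
  obtain q where q: "q \<in> borel_measurable lborel" "AE x in lborel. Im (f x) = q x"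
    using completion_ex_borel_measurable_real[OF m(2)] by auto
  let ?g = "\<lambda>x. complex_of_real (p x) + \<i> * complex_of_real (q x)"
  have gm: "?g \<in> borel_measurable lborel"
    using p(1) q(1) by measurable
  have "AE x in lborel. f x = ?g x"
    using p(2) q(2) by eventually_elim (simp add: complex_eq_iff)
  then have ae: "AE x in lebesgue. f x = ?g x"
    by (rule AE_completion)
  have "integrable lebesgue ?g"
    using assms ae gm by (subst integrable_cong_AE[where g = f]) (auto intro: measurable_completion)
  then have "integrable lborel ?g"
    using gm integrable_completion by blast
  then show thesis using ae that by blast
qed

text \<open>Both sides integrate \<open>g y * k x\<close> over the half plane \<open>y \<le> x\<close>.\<close>

lemma Fubini_triangle:
  fixes g k :: "real \<Rightarrow> complex"
  assumes g: "integrable lborel g" and k: "integrable lborel k"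
  shows "(\<integral>x. k x * (\<integral>y. indicator {..x} y *\<^sub>R g y \<partial>lborel) \<partial>lborel) =
         (\<integral>y. g y * (\<integral>x. indicator {y..} x *\<^sub>R k x \<partial>lborel) \<partial>lborel)"
proof -
  have [measurable]: "g \<in> borel_measurable borel" "k \<in> borel_measurable borel"
    using g k by auto
  let ?f = "\<lambda>(x, y). if y \<le> x then k x * g y else (0::complex)"
  have meas: "?f \<in> borel_measurable (lborel \<Otimes>\<^sub>M lborel)"
    by measurable
  have prod: "integrable (lborel \<Otimes>\<^sub>M lborel) (\<lambda>(x, y). k x * g y)"
  proof (rule lborel_pair.Fubini_integrable)
    show "(\<lambda>(x, y). k x * g y) \<in> borel_measurable (lborel \<Otimes>\<^sub>M lborel)"
      by measurable
    show "integrable lborel (\<lambda>x. \<integral>y. norm (case (x, y) of (x, y) \<Rightarrow> k x * g y) \<partial>lborel)"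
      using k by (simp add: norm_mult)
    show "AE x in lborel. integrable lborel (\<lambda>y. case (x, y) of (x, y) \<Rightarrow> k x * g y)"
      using g by simp
  qed
  have "integrable (lborel \<Otimes>\<^sub>M lborel) ?f"
    by (rule Bochner_Integration.integrable_bound[OF prod meas]) (auto intro!: AE_I2)
  then have "(\<integral>y. (\<integral>x. (if y \<le> x then k x * g y else 0) \<partial>lborel) \<partial>lborel) =
      (\<integral>x. (\<integral>y. (if y \<le> x then k x * g y else 0) \<partial>lborel) \<partial>lborel)"
    by (rule lborel_pair.Fubini_integral)
  moreover have "(\<integral>x. (if y \<le> x then k x * g y else 0) \<partial>lborel)
      = g y * (\<integral>x. indicator {y..} x *\<^sub>R k x \<partial>lborel)" for y
    by (subst integral_mult_right_zero[symmetric], rule Bochner_Integration.integral_cong)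
       (auto simp: indicator_def)
  moreover have "(\<integral>y. (if y \<le> x then k x * g y else 0) \<partial>lborel)
      = k x * (\<integral>y. indicator {..x} y *\<^sub>R g y \<partial>lborel)" for x
    by (subst integral_mult_right_zero[symmetric], rule Bochner_Integration.integral_cong)
       (auto simp: indicator_def)
  ultimately show ?thesis by simp
qed

text \<open>This says that \<open>F\<close> is locally absolutely continuous on the interval \<open>S\<close> with
  density \<open>G\<close>. Using increments, rather than one indefinite integral with a base point, treats bounded
  and unbounded intervals alike and leaves the constant of integration free.\<close>

definition primitive_on :: "real set \<Rightarrow> (real \<Rightarrow> complex) \<Rightarrow> (real \<Rightarrow> complex) \<Rightarrow> bool" where
  "primitive_on S F G \<longleftrightarrow> (\<forall>x\<in>S. \<forall>y\<in>S. x \<le> y \<longrightarrow>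
     G absolutely_integrable_on {x..y} \<and> F y - F x = integral {x..y} G)"

lemma primitive_onD:
  assumes "primitive_on S F G" "x \<in> S" "y \<in> S" "x \<le> y"
  shows "G absolutely_integrable_on {x..y}" "F y = F x + integral {x..y} G"
proof -
  have "G absolutely_integrable_on {x..y} \<and> F y - F x = integral {x..y} G"
    using assms unfolding primitive_on_def by blast
  then show "G absolutely_integrable_on {x..y}" "F y = F x + integral {x..y} G"
    by (simp_all add: diff_eq_eq add.commute)
qed

lemma primitive_on_subset: "primitive_on S F G \<Longrightarrow> T \<subseteq> S \<Longrightarrow> primitive_on T F G"
  unfolding primitive_on_def by blast

lemma continuous_on_closed_interval_locally:
  fixes F :: "real \<Rightarrow> 'b::topological_space"
  assumes S: "is_interval S" "closed S"
    and F: "\<And>x y. x \<in> S \<Longrightarrow> y \<in> S \<Longrightarrow> x \<le> y \<Longrightarrow> continuous_on {x..y} F"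
  shows "continuous_on S F"
proof (unfold continuous_on_eq_continuous_within, intro ballI)
  fix x assume x: "x \<in> S"
  \<comment> \<open>A compact interval that contains a neighbourhood of \<open>x\<close> in \<open>S\<close>.\<close>
  let ?J = "S \<inter> {x - 1..x + 1}"
  have "compact ?J" "connected ?J"
    using S by (simp_all add: closed_Int_compact is_interval_connected is_interval_Int is_interval_cc)
  then obtain a b where J: "?J = {a..b}"
    using connected_compact_interval_1[of ?J] by blast
  have xJ: "x \<in> {a..b}" unfolding J[symmetric] using x by simp
  then have "a \<in> {a..b}" "b \<in> {a..b}" by auto
  then have ab: "a \<in> S" "b \<in> S" unfolding J[symmetric] by auto
  have "a \<le> b" using xJ by simp
  have "continuous (at x within ?J) F"
    unfolding J using F[OF ab \<open>a \<le> b\<close>] xJ by (simp add: continuous_on_eq_continuous_within)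
  moreover have "at x within S = at x within ?J"
    by (rule at_within_nhd[of _ "{x - 1<..<x + 1}"]) auto
  ultimately show "continuous (at x within S) F" by (simp add: continuous_within)
qed

lemma primitive_on_continuous:
  assumes S: "is_interval S" "closed S" and F: "primitive_on S F G"
  shows "continuous_on S F"
proof (rule continuous_on_closed_interval_locally[OF S])
  fix x y assume xy: "x \<in> S" "y \<in> S" "x \<le> y"
  have G: "G integrable_on {x..y}"
    using primitive_onD(1)[OF F xy] by (simp add: absolutely_integrable_on_def)
  have "continuous_on {x..y} (\<lambda>t. F x + integral {x..t} G)"
    by (intro continuous_intros indefinite_integral_continuous_1 G)
  moreover have "F t = F x + integral {x..t} G" if "t \<in> {x..y}" for t
  proof (rule primitive_onD(2)[OF F])
    show "x \<in> S" "x \<le> t" "t \<in> S"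
      using that xy S(1) mem_is_interval_1_I[of S x y t] by auto
  qed
  ultimately show "continuous_on {x..y} F"
    by (subst continuous_on_cong[OF refl, of _ F "\<lambda>t. F x + integral {x..t} G"])
qed

lemma absolutely_integrable_mult_continuous:
  fixes G F :: "real \<Rightarrow> complex"
  assumes G: "G absolutely_integrable_on {a..b}" and F: "continuous_on {a..b} F"
  shows "(\<lambda>x. F x * G x) absolutely_integrable_on {a..b}"
proof (rule absolutely_integrable_bounded_measurable_product[of "(*)"])
  show "bilinear ((*) :: complex \<Rightarrow> complex \<Rightarrow> complex)"
    by (simp add: bilinear_conv_bounded_bilinear bounded_bilinear_mult)
  show "G absolutely_integrable_on {a..b}" by fact
  show "F \<in> borel_measurable (lebesgue_on {a..b})"
    using F by (intro continuous_imp_measurable_on_sets_lebesgue) auto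
  show "bounded (F ` {a..b})"
    by (intro compact_imp_bounded compact_continuous_image F) auto
qed auto

text \<open>Integration by parts for absolutely continuous functions. The densities are merely integrable, so the
  product rule can hold almost everywhere at best, which does not imply the integral identity; the reason is Fubini's
  theorem on the triangle \<open>a \<le> y \<le> x \<le> b\<close>, applied to Borel representatives of
  \<open>G\<close> and \<open>K\<close>.\<close>

lemma integral_by_parts_primitive:
  assumes ab: "a \<le> b" and F: "primitive_on {a..b} F G" and H: "primitive_on {a..b} H K"
  shows "F b * H b - F a * H a = integral {a..b} (\<lambda>x. G x * H x + F x * K x)"
proof -
  have G: "G absolutely_integrable_on {a..b}" and K: "K absolutely_integrable_on {a..b}"
    using F H ab by (auto simp: primitive_on_def)
  have cF: "continuous_on {a..b} F" and cH: "continuous_on {a..b} H"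
    using F H by (auto intro: primitive_on_continuous simp: is_interval_cc)
  obtain g where g: "integrable lborel g" "AE x in lebesgue. indicator {a..b} x *\<^sub>R G x = g x"
    using integrable_lebesgue_borel_representative G unfolding set_integrable_def by blast
  obtain k where k: "integrable lborel k" "AE x in lebesgue. indicator {a..b} x *\<^sub>R K x = k x"
    using integrable_lebesgue_borel_representative K unfolding set_integrable_def by blast
  have [measurable]: "g \<in> borel_measurable borel" "k \<in> borel_measurable borel"
    using g k by auto
  have gl: "g \<in> borel_measurable lebesgue" and kl: "k \<in> borel_measurable lebesgue"
    using g k by (auto intro: measurable_completion)
  \<comment> \<open>An integral of \<open>P\<close> over a piece of \<open>{a..b}\<close> is an integral over the line of its Borel representative \<open>p\<close>.\<close>
  have transfer_integral: "integral S P = (\<integral>x. indicator T x *\<^sub>R p x \<partial>lborel)"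
    if P: "P absolutely_integrable_on {a..b}" and p: "integrable lborel p"
      "AE x in lebesgue. indicator {a..b} x *\<^sub>R P x = p x"
      and S: "S = T \<inter> {a..b}" and T: "T \<in> sets borel" for S T P and p :: "real \<Rightarrow> complex"
  proof -
    have [measurable]: "p \<in> borel_measurable borel" using p by auto
    have "set_integrable lebesgue S P"
      using S T by (intro set_integrable_subset[OF P]) auto
    then have "integral S P = (\<integral>x. indicator S x *\<^sub>R P x \<partial>lebesgue)"
      using set_lebesgue_integral_eq_integral(2) set_lebesgue_integral_def by metis
    also have "\<dots> = (\<integral>x. indicator T x *\<^sub>R p x \<partial>lebesgue)"
    proof (rule integral_cong_AE)
      show "(\<lambda>x. indicator S x *\<^sub>R P x) \<in> borel_measurable lebesgue"
        using \<open>set_integrable lebesgue S P\<close> by (auto simp: set_integrable_def)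
      show "(\<lambda>x. indicator T x *\<^sub>R p x) \<in> borel_measurable lebesgue"
        using T by (intro measurable_completion) auto
      show "AE x in lebesgue. indicator S x *\<^sub>R P x = indicator T x *\<^sub>R p x"
        using p(2) by eventually_elim (auto simp: S indicator_def split: if_splits)
    qed
    also have "\<dots> = (\<integral>x. indicator T x *\<^sub>R p x \<partial>lborel)"
      using T by (intro integral_completion) auto
    finally show ?thesis .
  qed
  have cFk: "(\<lambda>x. F x * K x) absolutely_integrable_on {a..b}"
      "(\<lambda>x. H x * G x) absolutely_integrable_on {a..b}"
    by (intro absolutely_integrable_mult_continuous G K cF cH)+
  have pFk: "(\<lambda>x. (F x - F a) * K x) absolutely_integrable_on {a..b}"
      "(\<lambda>x. (H b - H x) * G x) absolutely_integrable_on {a..b}"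
    by (intro absolutely_integrable_mult_continuous continuous_intros G K cF cH)+
  have eqF: "F x - F a = (\<integral>y. indicator {..x} y *\<^sub>R g y \<partial>lborel)" if "x \<in> {a..b}" for x
    using primitive_onD(2)[OF F, of a x] that ab
      transfer_integral[OF G g, of "{a..x}" "{..x}"] by auto
  have eqH: "H b - H y = (\<integral>x. indicator {y..} x *\<^sub>R k x \<partial>lborel)" if "y \<in> {a..b}" for y
    using primitive_onD(2)[OF H, of y b] that ab
      transfer_integral[OF K k, of "{y..b}" "{y..}"] by auto
  have int_prod: "(\<integral>x. p x * q x \<partial>lborel) = integral {a..b} (\<lambda>x. Q x * P x)"
    if P: "(\<lambda>x. Q x * P x) absolutely_integrable_on {a..b}"
      and p: "integrable lborel p" "AE x in lebesgue. indicator {a..b} x *\<^sub>R P x = p x"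
      and Q: "\<And>x. x \<in> {a..b} \<Longrightarrow> Q x = q x" and q: "q \<in> borel_measurable lborel"
    for P p Q and q :: "real \<Rightarrow> complex"
  proof -
    have [measurable]: "p \<in> borel_measurable borel" "q \<in> borel_measurable borel"
      using p q by auto
    have pq: "AE x in lebesgue. indicator {a..b} x *\<^sub>R (Q x * P x) = p x * q x"
      using p(2)
    proof eventually_elim
      case (elim x)
      then show ?case using Q[of x] by (cases "x \<in> {a..b}") auto
    qed
    have "integrable lebesgue (\<lambda>x. p x * q x)"
    proof (subst integrable_cong_AE)
      show "integrable lebesgue (\<lambda>x. indicator {a..b} x *\<^sub>R (Q x * P x))"
        using P by (simp add: set_integrable_def)
      then show "(\<lambda>x. indicator {a..b} x *\<^sub>R (Q x * P x)) \<in> borel_measurable lebesgue" by auto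
      show "(\<lambda>x. p x * q x) \<in> borel_measurable lebesgue"
        by (intro measurable_completion) auto
      show "AE x in lebesgue. p x * q x = indicator {a..b} x *\<^sub>R (Q x * P x)"
        using pq by eventually_elim simp
    qed
    then have i: "integrable lborel (\<lambda>x. p x * q x)"
      by (subst (asm) integrable_completion) auto
    show ?thesis
      using transfer_integral[OF P i pq, of "{a..b}" UNIV] by simp
  qed
  \<comment> \<open>Subtracting \<open>F a\<close> and \<open>H b\<close> turns both iterated integrals into integrals over the triangle \<open>a \<le> y \<le> x \<le> b\<close>.\<close>
  have "integral {a..b} (\<lambda>x. (F x - F a) * K x)
      = (\<integral>x. k x * (\<integral>y. indicator {..x} y *\<^sub>R g y \<partial>lborel) \<partial>lborel)"
  proof (rule int_prod[symmetric, OF pFk(1) k eqF])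
    show "(\<lambda>x. \<integral>y. indicator {..x} y *\<^sub>R g y \<partial>lborel) \<in> borel_measurable lborel"
      unfolding indicator_def atMost_iff by measurable
  qed
  also have "\<dots> = (\<integral>y. g y * (\<integral>x. indicator {y..} x *\<^sub>R k x \<partial>lborel) \<partial>lborel)"
    by (rule Fubini_triangle[OF g(1) k(1)])
  also have "\<dots> = integral {a..b} (\<lambda>x. (H b - H x) * G x)"
  proof (rule int_prod[OF pFk(2) g eqH])
    show "(\<lambda>y. \<integral>x. indicator {y..} x *\<^sub>R k x \<partial>lborel) \<in> borel_measurable lborel"
      unfolding indicator_def atLeast_iff by measurable
  qed
  finally have eq: "integral {a..b} (\<lambda>x. (F x - F a) * K x) = integral {a..b} (\<lambda>x. (H b - H x) * G x)" .
  have i: "G integrable_on {a..b}" "K integrable_on {a..b}"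
    "(\<lambda>x. F x * K x) integrable_on {a..b}" "(\<lambda>x. H x * G x) integrable_on {a..b}"
    using G K cFk by (auto simp: absolutely_integrable_on_def)
  have "integral {a..b} (\<lambda>x. (F x - F a) * K x) = integral {a..b} (\<lambda>x. F x * K x) - F a * (H b - H a)"
    using primitive_onD(2)[OF H, of a b] ab i
    by (simp add: left_diff_distrib Henstock_Kurzweil_Integration.integral_diff integrable_on_mult_right)
  moreover have "integral {a..b} (\<lambda>x. (H b - H x) * G x) = H b * (F b - F a) - integral {a..b} (\<lambda>x. H x * G x)"
    using primitive_onD(2)[OF F, of a b] ab i
    by (simp add: left_diff_distrib Henstock_Kurzweil_Integration.integral_diff integrable_on_mult_right)
  ultimately have "integral {a..b} (\<lambda>x. F x * K x) - F a * (H b - H a)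
      = H b * (F b - F a) - integral {a..b} (\<lambda>x. H x * G x)"
    using eq by simp
  then have "F b * H b - F a * H a = integral {a..b} (\<lambda>x. H x * G x) + integral {a..b} (\<lambda>x. F x * K x)"
    by (simp only: diff_eq_eq) (simp add: algebra_simps)
  also have "\<dots> = integral {a..b} (\<lambda>x. G x * H x + F x * K x)"
    using i by (simp add: Henstock_Kurzweil_Integration.integral_add mult.commute)
  finally show ?thesis .
qed

lemma primitive_on_mult:
  assumes S: "is_interval S" "closed S" and F: "primitive_on S F G" and H: "primitive_on S H K"
  shows "primitive_on S (\<lambda>x. F x * H x) (\<lambda>x. G x * H x + F x * K x)"
  unfolding primitive_on_def
proof (intro ballI impI conjI)
  fix x y assume xy: "x \<in> S" "y \<in> S" "x \<le> y"
  have sub: "{x..y} \<subseteq> S"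
    using xy S(1) by (simp add: Icc_subset_interval)
  have "continuous_on {x..y} F" "continuous_on {x..y} H"
    using primitive_on_continuous[OF S] F H sub continuous_on_subset by blast+
  then have "(\<lambda>x. H x * G x) absolutely_integrable_on {x..y}"
     "(\<lambda>x. F x * K x) absolutely_integrable_on {x..y}"
    using primitive_onD(1)[OF F xy] primitive_onD(1)[OF H xy]
    by (auto intro: absolutely_integrable_mult_continuous)
  then show "(\<lambda>x. G x * H x + F x * K x) absolutely_integrable_on {x..y}"
    using set_integral_add(1) by (fastforce simp: mult.commute)
  show "F y * H y - F x * H x = integral {x..y} (\<lambda>x. G x * H x + F x * K x)"
    using xy F H sub by (intro integral_by_parts_primitive) (auto intro: primitive_on_subset)
qed

lemma primitive_onI_DERIV:
  assumes S: "is_interval S" and G: "continuous_on S G"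
    and D: "\<And>x. x \<in> S \<Longrightarrow> (F has_vector_derivative G x) (at x within S)"
  shows "primitive_on S F G"
  unfolding primitive_on_def
proof (intro ballI impI conjI)
  fix x y assume xy: "x \<in> S" "y \<in> S" "x \<le> y"
  have sub: "{x..y} \<subseteq> S"
    using xy S by (simp add: Icc_subset_interval)
  show "G absolutely_integrable_on {x..y}"
    using G sub by (intro absolutely_integrable_continuous_real) (rule continuous_on_subset)
  have "(G has_integral F y - F x) {x..y}"
    using xy sub by (intro fundamental_theorem_of_calculus has_vector_derivative_within_subset[OF D sub]) auto
  then show "F y - F x = integral {x..y} G" by (simp add: integral_unique)
qed

lemma primitive_on_add:
  assumes "primitive_on S F G" "primitive_on S H K"
  shows "primitive_on S (\<lambda>x. F x + H x) (\<lambda>x. G x + K x)"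
  unfolding primitive_on_def
proof (intro ballI impI)
  fix x y assume xy: "x \<in> S" "y \<in> S" "x \<le> y"
  note F = primitive_onD[OF assms(1) xy] and H = primitive_onD[OF assms(2) xy]
  have i: "G integrable_on {x..y}" "K integrable_on {x..y}"
    using F(1) H(1) by (simp_all add: absolutely_integrable_on_def)
  show "(\<lambda>x. G x + K x) absolutely_integrable_on {x..y} \<and>
      F y + H y - (F x + H x) = integral {x..y} (\<lambda>x. G x + K x)"
    using F(2) H(2) set_integral_add(1)[OF F(1) H(1)] i
    by (simp add: Henstock_Kurzweil_Integration.integral_add)
qed

lemma primitive_on_linear:
  assumes "primitive_on S F G" and h: "bounded_linear h"
  shows "primitive_on S (\<lambda>x. h (F x)) (\<lambda>x. h (G x))"
  unfolding primitive_on_def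
proof (intro ballI impI)
  fix x y assume xy: "x \<in> S" "y \<in> S" "x \<le> y"
  note F = primitive_onD[OF assms(1) xy]
  have i: "G integrable_on {x..y}"
    using F(1) by (simp add: absolutely_integrable_on_def)
  have "(\<lambda>x. h (G x)) absolutely_integrable_on {x..y}"
    using absolutely_integrable_linear[OF F(1) h] by (simp add: o_def)
  moreover have "integral {x..y} (\<lambda>x. h (G x)) = h (integral {x..y} G)"
    using integral_linear[OF i h] by (simp add: o_def)
  ultimately show "(\<lambda>x. h (G x)) absolutely_integrable_on {x..y} \<and>
      h (F y) - h (F x) = integral {x..y} (\<lambda>x. h (G x))"
    using F(2) by (simp add: linear_add[OF bounded_linear.linear[OF h]])
qed

lemma primitive_on_cmult: "primitive_on S F G \<Longrightarrow> primitive_on S (\<lambda>x. c * F x) (\<lambda>x. c * G x)"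
  by (rule primitive_on_linear[OF _ bounded_linear_mult_right])

lemma primitive_on_cnj: "primitive_on S F G \<Longrightarrow> primitive_on S (\<lambda>x. cnj (F x)) (\<lambda>x. cnj (G x))"
  by (rule primitive_on_linear[OF _ bounded_linear_cnj])

lemma primitive_on_diff:
  "primitive_on S F G \<Longrightarrow> primitive_on S H K \<Longrightarrow> primitive_on S (\<lambda>x. F x - H x) (\<lambda>x. G x - K x)"
  using primitive_on_add[of S F G "\<lambda>x. -1 * H x" "\<lambda>x. -1 * K x"] primitive_on_cmult[of S H K "-1"] by simp

lemma primitive_on_const: "primitive_on S (\<lambda>x. c) (\<lambda>x. 0)"
  by (simp add: primitive_on_def)

lemma primitive_on_add_const: "primitive_on S F G \<Longrightarrow> primitive_on S (\<lambda>x. F x + c) G"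
  by (simp add: primitive_on_def)

lemma primitive_on_cong:
  assumes "primitive_on S F G" "is_interval S" "\<And>x. x \<in> S \<Longrightarrow> F x = F' x" "\<And>x. x \<in> S \<Longrightarrow> G x = G' x"
  shows "primitive_on S F' G'"
  unfolding primitive_on_def
proof (intro ballI impI)
  fix x y assume xy: "x \<in> S" "y \<in> S" "x \<le> y"
  note F = primitive_onD[OF assms(1) xy]
  have eq: "G t = G' t" if "t \<in> {x..y}" for t
    using that xy assms(2,4) by (meson atLeastAtMost_iff mem_is_interval_1_I)
  have "G' absolutely_integrable_on {x..y}"
    using absolutely_integrable_spike[OF F(1) negligible_empty, of G'] eq by simp
  moreover have "integral {x..y} G' = integral {x..y} G"
    using eq by (intro integral_cong) simp
  ultimately show "G' absolutely_integrable_on {x..y} \<and> F' y - F' x = integral {x..y} G'"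
    using F(2) assms(3) xy by simp
qed

lemma primitive_on_exists:
  assumes S: "is_interval S"
    and G: "\<And>x y. x \<in> S \<Longrightarrow> y \<in> S \<Longrightarrow> x \<le> y \<Longrightarrow> G absolutely_integrable_on {x..y}"
  shows "\<exists>F. primitive_on S F G"
proof (cases "S = {}")
  case True then show ?thesis by (simp add: primitive_on_def)
next
  case False
  then obtain o' where o: "o' \<in> S" by auto
  have Gi: "G integrable_on {x..y}" if "x \<in> S" "y \<in> S" for x y
    using G[OF that] that by (cases "x \<le> y") (auto simp: absolutely_integrable_on_def)
  define F where "F x = (if o' \<le> x then integral {o'..x} G else - integral {x..o'} G)" for x
  have "F y - F x = integral {x..y} G" if xy: "x \<in> S" "y \<in> S" "x \<le> y" for x y
  proof -
    consider "o' \<le> x" | "x < o'" "o' \<le> y" | "y < o'" using xy by linarith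
    then show ?thesis
    proof cases
      case 1
      then show ?thesis
        using Henstock_Kurzweil_Integration.integral_combine[of o' x y G] Gi o xy by (simp add: F_def algebra_simps)
    next
      case 2
      then show ?thesis
        using Henstock_Kurzweil_Integration.integral_combine[of x o' y G] Gi o xy by (simp add: F_def algebra_simps)
    next
      case 3
      then show ?thesis
        using Henstock_Kurzweil_Integration.integral_combine[of x y o' G] Gi o xy by (simp add: F_def algebra_simps)
    qed
  qed
  then show ?thesis using G unfolding primitive_on_def by blast
qed

lemma primitive_on_integral_from:
  assumes S: "is_interval S" and z: "z \<in> S" "\<And>x. x \<in> S \<Longrightarrow> z \<le> x"
    and G: "\<And>x. x \<in> S \<Longrightarrow> G absolutely_integrable_on {z..x}"
  shows "primitive_on S (\<lambda>x. integral {z..x} G) G"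
  unfolding primitive_on_def
proof (intro ballI impI)
  fix x y assume xy: "x \<in> S" "y \<in> S" "x \<le> y"
  have "G integrable_on {z..y}" using G[OF xy(2)] by (simp add: absolutely_integrable_on_def)
  from Henstock_Kurzweil_Integration.integral_combine[OF z(2)[OF xy(1)] xy(3) this]
  have "integral {z..y} G - integral {z..x} G = integral {x..y} G" by (simp add: algebra_simps)
  moreover have "G absolutely_integrable_on {x..y}"
    using z(2)[OF xy(1)] by (intro absolutely_integrable_on_subinterval[OF G[OF xy(2)]]) auto
  ultimately show "G absolutely_integrable_on {x..y} \<and> integral {z..y} G - integral {z..x} G = integral {x..y} G"
    by simp
qed

lemma is_interval_closure: "is_interval (I :: real set) \<Longrightarrow> is_interval (closure I)"
  by (simp add: is_interval_convex_1 convex_closure)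

text \<open>A convex open set is the interior of its closure.\<close>

lemma greaterThanLessThan_subset_if_closure:
  assumes I: "open I" "is_interval (I :: real set)" and xy: "x \<in> closure I" "y \<in> closure I"
  shows "{x<..<y} \<subseteq> I"
proof -
  have "{x<..<y} \<subseteq> closure I"
    using xy is_interval_closure[OF I(2)] by (auto intro: mem_is_interval_1_I[of "closure I" x y])
  then show ?thesis
    using interior_maximal[of "{x<..<y}" "closure I"] convex_interior_closure[of I] I
    by (simp add: is_interval_convex_1 interior_open)
qed

text \<open>Only the values of \<open>G\<close> on the open interval matter: a compact interval with end points in the
  closure meets the complement of \<open>I\<close> at most in these end points.\<close>

lemma primitive_on_AE_cong:
  assumes F: "primitive_on (closure I) F G" and I: "open I" "is_interval I"
    and ae: "AE x in lebesgue_on I. G x = G' x"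
  shows "primitive_on (closure I) F G'"
  unfolding primitive_on_def
proof (intro ballI impI)
  fix x y assume xy: "x \<in> closure I" "y \<in> closure I" "x \<le> y"
  note F = primitive_onD[OF F xy]
  have "AE t in lebesgue. t \<in> I \<longrightarrow> G t = G' t"
    using ae I(1) by (subst (asm) AE_restrict_space_iff) auto
  then obtain N where N: "negligible N" "\<And>t. t \<notin> N \<Longrightarrow> t \<in> I \<Longrightarrow> G t = G' t"
    unfolding eventually_ae_filter_negligible by blast
  have sub: "{x<..<y} \<subseteq> I" using I xy(1,2) by (rule greaterThanLessThan_subset_if_closure)
  have N': "negligible (N \<union> {x, y})" using N(1) by simp
  have eq: "G' t = G t" if "t \<in> {x..y} - (N \<union> {x, y})" for t
    using that sub N(2)[of t] by force
  have "G' absolutely_integrable_on {x..y}"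
    using absolutely_integrable_spike[OF F(1) N'] eq by blast
  moreover have "integral {x..y} G' = integral {x..y} G"
    using integral_spike[OF N'] eq by metis
  ultimately show "G' absolutely_integrable_on {x..y} \<and> F y - F x = integral {x..y} G'"
    using F(2) by simp
qed

section \<open>Smooth bump functions\<close>

text \<open>Peeling off the first derivative, instead of iterating \<open>deriv\<close> from outside, makes the
  closure of smooth functions under products a plain induction.\<close>

primrec differentiable_upto :: "nat \<Rightarrow> (real \<Rightarrow> real) \<Rightarrow> bool" where
  "differentiable_upto 0 f \<longleftrightarrow> (\<forall>x. f differentiable (at x))"
| "differentiable_upto (Suc n) f \<longleftrightarrow> (\<forall>x. f differentiable (at x)) \<and> differentiable_upto n (deriv f)"

definition smooth :: "(real \<Rightarrow> real) \<Rightarrow> bool" where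
  "smooth f \<longleftrightarrow> (\<forall>n. differentiable_upto n f)"

lemma differentiable_upto_iff:
  "differentiable_upto n f \<longleftrightarrow> (\<forall>k\<le>n. \<forall>x. (deriv ^^ k) f differentiable (at x))"
proof (induction n arbitrary: f)
  case (Suc n)
  have "(\<forall>k\<le>n. \<forall>x. (deriv ^^ k) (deriv f) differentiable (at x)) \<longleftrightarrow>
      (\<forall>k\<in>{1..Suc n}. \<forall>x. (deriv ^^ k) f differentiable (at x))"
    unfolding atLeast1_atMost_eq_remove0 image_Suc_atMost[symmetric]
    by (auto simp: funpow_Suc_right simp del: funpow.simps(2))
  moreover have "{..Suc n} = insert 0 {1..Suc n}" by auto
  ultimately show ?case using Suc[of "deriv f"] unfolding atMost_iff[symmetric] Ball_def[symmetric]
    by simp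
qed simp

lemma smooth_iff_deriv_funpow: "smooth f \<longleftrightarrow> (\<forall>n x. (deriv ^^ n) f differentiable (at x))"
  unfolding smooth_def differentiable_upto_iff by blast

lemma smooth_DERIV: "smooth f \<Longrightarrow> (f has_real_derivative deriv f x) (at x)"
  unfolding smooth_def using DERIV_deriv_iff_real_differentiable differentiable_upto.simps(1) by blast

lemma smooth_deriv: "smooth f \<Longrightarrow> smooth (deriv f)"
  unfolding smooth_def using differentiable_upto.simps(2) by blast

lemma smooth_continuous: "smooth f \<Longrightarrow> continuous_on S f"
  by (meson smooth_DERIV DERIV_isCont continuous_at_imp_continuous_on)

lemma smooth_if_deriv:
  assumes "\<And>x. (f has_real_derivative g x) (at x)" "smooth g"
  shows "smooth f"
proof -
  have "deriv f = g" using assms(1) by (auto intro: DERIV_imp_deriv)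
  moreover have "f differentiable (at x)" for x
    using assms(1) real_differentiable_def by blast
  ultimately have "differentiable_upto n f" for n
    using assms(2) by (cases n) (auto simp: smooth_def)
  then show ?thesis by (simp add: smooth_def)
qed

lemma differentiable_upto_Suc_imp: "differentiable_upto (Suc n) f \<Longrightarrow> differentiable_upto n f"
  by (induction n arbitrary: f) auto

lemma differentiable_upto_add:
  "differentiable_upto n f \<Longrightarrow> differentiable_upto n g \<Longrightarrow> differentiable_upto n (\<lambda>x. f x + g x)"
proof (induction n arbitrary: f g)
  case (Suc n)
  have "deriv (\<lambda>x. f x + g x) = (\<lambda>x. deriv f x + deriv g x)"
    using Suc.prems by (intro ext DERIV_imp_deriv DERIV_add) (auto simp: DERIV_deriv_iff_real_differentiable)
  with Suc show ?case by auto
qed auto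

lemma differentiable_upto_mult:
  "differentiable_upto n f \<Longrightarrow> differentiable_upto n g \<Longrightarrow> differentiable_upto n (\<lambda>x. f x * g x)"
proof (induction n arbitrary: f g)
  case (Suc n)
  have "deriv (\<lambda>x. f x * g x) = (\<lambda>x. deriv f x * g x + deriv g x * f x)"
    using Suc.prems by (intro ext DERIV_imp_deriv DERIV_mult) (auto simp: DERIV_deriv_iff_real_differentiable)
  moreover have "differentiable_upto n f" "differentiable_upto n g"
    using Suc.prems by (blast intro: differentiable_upto_Suc_imp)+
  ultimately show ?case using Suc by (auto intro!: differentiable_upto_add)
qed auto

lemma differentiable_upto_affine:
  "differentiable_upto n f \<Longrightarrow> differentiable_upto n (\<lambda>x. C * f (c * x + d))"
proof (induction n arbitrary: f C)
  case 0
  then have "((\<lambda>x. C * f (c * x + d)) has_real_derivative C * (deriv f (c * x + d) * c)) (at x)" for x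
    by (intro DERIV_cmult DERIV_chain2[where g = "\<lambda>x. c * x + d"])
       (auto simp: DERIV_deriv_iff_real_differentiable intro!: derivative_eq_intros)
  then show ?case by (auto simp: real_differentiable_def)
next
  case (Suc n)
  then have D: "((\<lambda>x. C * f (c * x + d)) has_real_derivative C * c * deriv f (c * x + d)) (at x)" for x
    by (intro DERIV_cong[OF DERIV_cmult[OF DERIV_chain2[where g = "\<lambda>x. c * x + d"]]])
       (auto simp: DERIV_deriv_iff_real_differentiable intro!: derivative_eq_intros)
  then have "deriv (\<lambda>x. C * f (c * x + d)) = (\<lambda>x. C * c * deriv f (c * x + d))"
    by (auto intro: DERIV_imp_deriv)
  with Suc D show ?case by (auto simp: real_differentiable_def)
qed

lemma smooth_add: "smooth f \<Longrightarrow> smooth g \<Longrightarrow> smooth (\<lambda>x. f x + g x)"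
  and smooth_mult: "smooth f \<Longrightarrow> smooth g \<Longrightarrow> smooth (\<lambda>x. f x * g x)"
  and smooth_affine: "smooth f \<Longrightarrow> smooth (\<lambda>x. C * f (c * x + d))"
  by (simp_all add: smooth_def differentiable_upto_add differentiable_upto_mult differentiable_upto_affine)

text \<open>For \<open>p = 1\<close> this is the classical smooth function that vanishes on the left half line. The
  polynomial factor makes the family closed under differentiation.\<close>

definition flat :: "real poly \<Rightarrow> real \<Rightarrow> real" where
  "flat p x = (if 0 < x then poly p (1 / x) * exp (- 1 / x) else 0)"

lemma tendsto_poly_div_exp_0: "((\<lambda>x. poly p x / exp x) \<longlongrightarrow> (0::real)) at_top"
proof -
  have "((\<lambda>x. \<Sum>i\<le>degree p. coeff p i * (x ^ i / exp x)) \<longlongrightarrow> (\<Sum>i\<le>degree p. coeff p i * 0)) at_top"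
    by (intro tendsto_intros tendsto_power_div_exp_0)
  then show ?thesis
    by (simp add: poly_altdef sum_divide_distrib)
qed

text \<open>For \<open>x > 0\<close> this is the chain rule; at \<open>0\<close> the exponential decay beats the
  polynomial.\<close>

lemma flat_DERIV:
  "(flat p has_real_derivative flat ([:0, 0, 1:] * (p - pderiv p)) x) (at x)"
proof -
  consider "x < 0" | "x = 0" | "x > 0" by linarith
  then show ?thesis
  proof cases
    case 1
    have "((\<lambda>x. 0) has_real_derivative 0) (at x)" by simp
    moreover have "\<forall>\<^sub>F y in nhds x. flat p y = 0"
      using eventually_nhds_in_open[of "{..<0}" x] 1 by (auto elim!: eventually_mono simp: flat_def)
    ultimately show ?thesis
      using 1 by (subst DERIV_cong_ev[OF refl _ refl]) (auto simp: flat_def)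
  next
    case 3
    have "((\<lambda>x. 1 / x) has_real_derivative - (1 / x\<^sup>2)) (at x)"
      "((\<lambda>x. - 1 / x) has_real_derivative 1 / x\<^sup>2) (at x)"
      using 3 by (auto intro!: derivative_eq_intros simp: power2_eq_square)
    from DERIV_mult[OF DERIV_chain2[OF poly_DERIV this(1)] DERIV_chain2[OF DERIV_exp this(2)]]
    have "((\<lambda>x. poly p (1 / x) * exp (- 1 / x)) has_real_derivative
        poly (pderiv p) (1 / x) * - (1 / x\<^sup>2) * exp (- 1 / x) +
        exp (- 1 / x) * (1 / x\<^sup>2) * poly p (1 / x)) (at x)" .
    moreover have "poly (pderiv p) y * - (y * y) * e + e * (y * y) * poly p y
        = poly ([:0, 0, 1:] * (p - pderiv p)) y * e" for y e :: real
      by (simp add: algebra_simps)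
    from this[of "1 / x" "exp (- 1 / x)"]
    have "poly (pderiv p) (1 / x) * - (1 / x\<^sup>2) * exp (- 1 / x) +
        exp (- 1 / x) * (1 / x\<^sup>2) * poly p (1 / x) = flat ([:0, 0, 1:] * (p - pderiv p)) x"
      using 3 by (simp only: flat_def if_True power2_eq_square times_divide_times_eq mult_1_left)
    ultimately have "((\<lambda>x. poly p (1 / x) * exp (- 1 / x)) has_real_derivative
        flat ([:0, 0, 1:] * (p - pderiv p)) x) (at x)"
      by (simp only:)
    moreover have "\<forall>\<^sub>F y in nhds x. flat p y = poly p (1 / y) * exp (- 1 / y)"
      using eventually_nhds_in_open[of "{0<..}" x] 3 by (auto elim!: eventually_mono simp: flat_def)
    ultimately show ?thesis
      by (subst DERIV_cong_ev[OF refl _ refl])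
  next
    case 2
    \<comment> \<open>With \<open>y = 1 / x\<close> the difference quotient at \<open>0\<close> is \<open>y p(y) exp (- y)\<close>.\<close>
    have "((\<lambda>y. poly ([:0,1:] * p) (inverse y) / exp (inverse y)) \<longlongrightarrow> 0) (at_right (0::real))"
      by (rule filterlim_compose[OF tendsto_poly_div_exp_0 filterlim_inverse_at_top_right])
    moreover have "\<forall>\<^sub>F y in at_right (0::real). poly ([:0,1:] * p) (inverse y) / exp (inverse y) = (flat p y - flat p 0) / (y - 0)"
      by (rule eventually_at_rightI[of 0 1]) (auto simp: flat_def exp_minus inverse_eq_divide divide_simps)
    ultimately have r: "((\<lambda>y. (flat p y - flat p 0) / (y - 0)) \<longlongrightarrow> 0) (at_right 0)"
      by (rule Lim_transform_eventually)
    have "\<forall>\<^sub>F y in at_left (0::real). (flat p y - flat p 0) / (y - 0) = 0"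
      by (rule eventually_at_leftI[of "-1" 0]) (auto simp: flat_def)
    then have "((\<lambda>y. (flat p y - flat p 0) / (y - 0)) \<longlongrightarrow> 0) (at_left 0)"
      by (rule tendsto_eventually)
    with r have "((\<lambda>y. (flat p y - flat p 0) / (y - 0)) \<longlongrightarrow> 0) (at 0)"
      by (simp add: filterlim_split_at)
    then show ?thesis
      using 2 by (simp add: has_field_derivative_iff flat_def)
  qed
qed

lemma smooth_flat: "smooth (flat p)"
proof -
  have "differentiable_upto n (flat p)" for n
  proof (induction n arbitrary: p)
    case 0 show ?case using flat_DERIV by (auto simp: real_differentiable_def)
  next
    case (Suc n)
    have "deriv (flat p) = flat ([:0, 0, 1:] * (p - pderiv p))"
      using flat_DERIV by (auto intro: DERIV_imp_deriv)
    then show ?case using Suc flat_DERIV by (auto simp: real_differentiable_def)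
  qed
  then show ?thesis by (simp add: smooth_def)
qed

text \<open>Increasing \<open>c\<close> does not change the support \<open>{a..b}\<close> and drives the function to
  the indicator of the open interval.\<close>

definition bump :: "real \<Rightarrow> real \<Rightarrow> real \<Rightarrow> real \<Rightarrow> real" where
  "bump c a b x = flat 1 (c * (x - a)) * flat 1 (c * (b - x))"

lemma smooth_bump: "smooth (bump c a b)"
proof -
  have "smooth (\<lambda>x. (1 * flat 1 (c * x + - (c * a))) * (1 * flat 1 (- c * x + c * b)))"
    by (intro smooth_mult smooth_affine smooth_flat)
  moreover have "bump c a b = (\<lambda>x. (1 * flat 1 (c * x + - (c * a))) * (1 * flat 1 (- c * x + c * b)))"
    by (simp add: bump_def fun_eq_iff right_diff_distrib)
  ultimately show ?thesis by simp
qed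

lemma bump_nonneg: "0 \<le> bump c a b x" and bump_le_1: "bump c a b x \<le> 1"
  by (auto simp: bump_def flat_def intro!: mult_le_one)

lemma bump_pos: "0 < c \<Longrightarrow> a < x \<Longrightarrow> x < b \<Longrightarrow> 0 < bump c a b x"
  by (simp add: bump_def flat_def)

lemma bump_outside: "0 < c \<Longrightarrow> x \<notin> {a<..<b} \<Longrightarrow> bump c a b x = 0"
  by (auto simp: bump_def flat_def zero_less_mult_iff)

lemma bump_tendsto_1:
  assumes "a < x" "x < b"
  shows "(\<lambda>n. bump (real (Suc n)) a b x) \<longlonglongrightarrow> 1"
proof -
  have flat: "(\<lambda>n. flat 1 (real (Suc n) * y)) \<longlonglongrightarrow> 1" if "y > 0" for y
  proof -
    have "(\<lambda>n. exp (- (1 / y) * inverse (real (Suc n)))) \<longlonglongrightarrow> exp (- (1 / y) * 0)"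
      by (intro tendsto_intros LIMSEQ_inverse_real_of_nat)
    then show ?thesis
      using that by (simp add: flat_def field_simps del: of_nat_Suc)
  qed
  show ?thesis
    unfolding bump_def using tendsto_mult[OF flat[of "x - a"] flat[of "b - x"]] assms by simp
qed

text \<open>The vanishing mean value is what makes the primitive of \<open>g\<close> vanish to the right of the
  support.\<close>

lemma test_function_antiderivative:
  assumes g: "smooth g" and supp: "\<And>x. x \<notin> {m..M} \<Longrightarrow> g x = 0"
    and zero: "integral {m..M} g = 0" and sub: "{m..M} \<subseteq> I" and mM: "m \<le> M"
  obtains \<Phi> where "test_function I \<Phi>" "deriv \<Phi> = g"
proof
  \<comment> \<open>The base point lies to the left of the support of \<open>g\<close>; further left the interval of integration is empty, so the formula also gives \<open>0\<close> there.\<close>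
  define \<Phi> where "\<Phi> x = integral {m - 1..x} g" for x
  have int: "g integrable_on {u..v}" for u v
    by (intro integrable_continuous_interval smooth_continuous g)
  have zero_left: "\<Phi> x = 0" if "x < m" for x
    unfolding \<Phi>_def using that supp
    by (intro integral_unique[OF has_integral_is_0]) auto
  have zero_right: "\<Phi> x = 0" if "x > M" for x
  proof -
    have "\<Phi> x = integral {m..M} g"
      unfolding \<Phi>_def using that mM supp
      by (intro integral_unique has_integral_on_superset[OF integrable_integral[OF int]]) auto
    then show ?thesis using zero by simp
  qed
  have D: "(\<Phi> has_real_derivative g x) (at x)" for x
  proof (cases "x < m")
    case True
    have "((\<lambda>x. 0) has_real_derivative 0) (at x)" by simp
    moreover have "\<forall>\<^sub>F y in nhds x. \<Phi> y = 0"
      using eventually_nhds_in_open[of "{..<m}" x] True by (auto elim!: eventually_mono simp: zero_left)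
    ultimately show ?thesis
      using True supp[of x] by (subst DERIV_cong_ev[OF refl _ refl]) auto
  next
    case False
    have "(\<Phi> has_real_derivative g x) (at x within {m - 1..x + 1})"
      unfolding \<Phi>_def using False
      by (intro integral_has_real_derivative smooth_continuous g) auto
    moreover have "x \<in> interior {m - 1..x + 1}"
      using False by simp
    ultimately show ?thesis
      using at_within_interior[of x "{m - 1..x + 1}"] by simp
  qed
  show "deriv \<Phi> = g" using D by (auto intro: DERIV_imp_deriv)
  have "smooth \<Phi>" using D g by (rule smooth_if_deriv)
  moreover have "\<Phi> x = 0" if "x \<notin> {m..M}" for x
    using that zero_left zero_right by (cases "x < m") auto
  ultimately show "test_function I \<Phi>"
    unfolding test_function_def smooth_iff_deriv_funpow
    using sub compact_Icc by blast
qed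

section \<open>The fundamental lemma of the calculus of variations\<close>

text \<open>The integral of a Borel representative vanishes over all rays, hence over all Borel sets.\<close>

lemma integral_subintervals_zero_AE:
  fixes f :: "real \<Rightarrow> complex"
  assumes f: "f absolutely_integrable_on {a..b}"
    and zero: "\<And>x. x \<in> {a..b} \<Longrightarrow> integral {a..x} f = 0"
  shows "AE x in lebesgue. x \<in> {a..b} \<longrightarrow> f x = 0"
proof -
  obtain g where g: "integrable lborel g" "AE x in lebesgue. indicator {a..b} x *\<^sub>R f x = g x"
    using integrable_lebesgue_borel_representative f unfolding set_integrable_def by blast
  have [measurable]: "g \<in> borel_measurable borel" using g by auto
  have int: "set_integrable lborel A g" if "A \<in> sets borel" for A
    using that g(1) unfolding set_integrable_def by (intro integrable_mult_indicator) auto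
  have base: "(LINT t:{..x}|lborel. g t) = 0" for x
  proof -
    have sub: "set_integrable lebesgue ({a..b} \<inter> {..x}) f"
      by (intro set_integrable_subset[OF f]) auto
    have "(LINT t:{..x}|lborel. g t) = (\<integral>t. indicator {..x} t *\<^sub>R g t \<partial>lebesgue)"
      unfolding set_lebesgue_integral_def by (subst integral_completion) auto
    also have "\<dots> = (\<integral>t. indicator ({a..b} \<inter> {..x}) t *\<^sub>R f t \<partial>lebesgue)"
    proof (rule integral_cong_AE)
      show "(\<lambda>t. indicator {..x} t *\<^sub>R g t) \<in> borel_measurable lebesgue"
        by (intro measurable_completion) auto
      show "(\<lambda>t. indicator ({a..b} \<inter> {..x}) t *\<^sub>R f t) \<in> borel_measurable lebesgue"
        using sub by (auto simp: set_integrable_def)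
      show "AE t in lebesgue. indicator {..x} t *\<^sub>R g t = indicator ({a..b} \<inter> {..x}) t *\<^sub>R f t"
        using g(2) by eventually_elim (auto simp: indicator_def)
    qed
    also have "\<dots> = integral ({a..b} \<inter> {..x}) f"
      using set_lebesgue_integral_eq_integral(2)[OF sub] by (simp add: set_lebesgue_integral_def)
    also have "\<dots> = 0"
    proof -
      have "{a..b} \<inter> {..x} = {a..min b x}" by auto
      moreover have "integral {a..min b x} f = 0"
        using zero[of "min b x"] by (cases "a \<le> min b x") auto
      ultimately show ?thesis by simp
    qed
    finally show ?thesis .
  qed
  have total: "(LINT t:UNIV|lborel. g t) = 0"
  proof -
    have "(LINT t:UNIV|lborel. g t) = (LINT t:{..b}|lborel. g t)"
      unfolding set_lebesgue_integral_def
    proof (rule integral_cong_AE)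
      have "AE x in lborel. indicator {a..b} x *\<^sub>R f x = g x"
        using g(2) by (simp add: AE_completion_iff)
      then show "AE t in lborel. indicator UNIV t *\<^sub>R g t = indicator {..b} t *\<^sub>R g t"
        by eventually_elim (auto simp: indicator_def split: if_splits)
    qed auto
    then show ?thesis using base by simp
  qed
  \<comment> \<open>The rays \<open>{..x}\<close> are stable under intersection and generate the Borel sets.\<close>
  have "(LINT t:A|lborel. g t) = 0" if "A \<in> sets lborel" for A
  proof -
    have "Int_stable (range (\<lambda>a::real. {..a}))" "range (\<lambda>a::real. {..a}) \<subseteq> Pow UNIV"
      "A \<in> sigma_sets UNIV (range (\<lambda>a::real. {..a}))"
      using that by (auto simp: borel_eq_atMost Int_stable_def)
    then show ?thesis
    proof (induction rule: sigma_sets_induct_disjoint)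
      case (basic A) then show ?case using base by auto
    next
      case empty show ?case by (simp add: set_lebesgue_integral_def)
    next
      case (compl A)
      then have A: "A \<in> sets borel" by (simp add: borel_eq_atMost)
      have "(LINT t:A \<union> (UNIV - A)|lborel. g t) = (LINT t:A|lborel. g t) + (LINT t:UNIV - A|lborel. g t)"
        using A by (intro set_integral_Un int) auto
      then show ?case using total compl by simp
    next
      case (union B)
      then have B: "B i \<in> sets borel" for i by (auto simp: borel_eq_atMost)
      have "(LINT t:(\<Union>i. B i)|lborel. g t) = (\<Sum>i. LINT t:B i|lborel. g t)"
        using B union(1) by (intro lebesgue_integral_countable_add int) (auto simp: disjoint_family_on_def)
      then show ?case using union by simp
    qed
  qed
  then have "AE x in lborel. g x = 0"
    by (intro sigma_finite_measure.density_zero[OF sigma_finite_lborel g(1)])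
  then have "AE x in lebesgue. g x = 0" by (rule AE_completion)
  then show ?thesis
    using g(2) by eventually_elim (auto simp: indicator_def)
qed

text \<open>An open set is the union of the countably many compact intervals with rational end points that it
  contains.\<close>

lemma AE_on_open_set_if_AE_on_intervals:
  assumes I: "open (I :: real set)"
    and P: "\<And>a b. a < b \<Longrightarrow> {a..b} \<subseteq> I \<Longrightarrow> AE x in lebesgue. x \<in> {a..b} \<longrightarrow> P x"
  shows "AE x in lebesgue_on I. P x"
proof -
  define D where "D = {p :: rat \<times> rat. fst p < snd p \<and> {real_of_rat (fst p)..real_of_rat (snd p)} \<subseteq> I}"
  have "AE x in lebesgue. \<forall>p\<in>D. x \<in> {real_of_rat (fst p)..real_of_rat (snd p)} \<longrightarrow> P x"
  proof (subst AE_ball_countable)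
    show "countable D" by (rule countableI_type)
    show "\<forall>p\<in>D. AE x in lebesgue. x \<in> {real_of_rat (fst p)..real_of_rat (snd p)} \<longrightarrow> P x"
      by (intro ballI P) (simp_all add: D_def of_rat_less)
  qed
  moreover have "\<exists>p\<in>D. x \<in> {real_of_rat (fst p)..real_of_rat (snd p)}" if "x \<in> I" for x
  proof -
    obtain e where e: "e > 0" "cball x e \<subseteq> I"
      using I \<open>x \<in> I\<close> unfolding open_contains_cball by meson
    obtain q where q: "x - e < real_of_rat q" "real_of_rat q < x"
      using of_rat_dense[of "x - e" x] e by auto
    obtain r where r: "x < real_of_rat r" "real_of_rat r < x + e"
      using of_rat_dense[of x "x + e"] e by auto
    have "{real_of_rat q..real_of_rat r} \<subseteq> cball x e"
      using q r by (auto simp: dist_real_def)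
    then have "{real_of_rat q..real_of_rat r} \<subseteq> I" using e by (rule_tac order_trans)
    moreover have "real_of_rat q < real_of_rat r" using q r by linarith
    ultimately have "(q, r) \<in> D" by (simp add: D_def of_rat_less)
    then show ?thesis
      using q r by (intro bexI[of _ "(q, r)"]) simp_all
  qed
  ultimately have "AE x in lebesgue. x \<in> I \<longrightarrow> P x"
    by (elim eventually_mono) blast
  moreover have "I \<inter> space lebesgue \<in> sets lebesgue" using I by simp
  ultimately show ?thesis
    by (simp only: AE_restrict_space_iff)
qed

definition locally_integrable_on :: "real set \<Rightarrow> (real \<Rightarrow> complex) \<Rightarrow> bool" where
  "locally_integrable_on I f \<longleftrightarrow> (\<forall>a b. {a..b} \<subseteq> I \<longrightarrow> f absolutely_integrable_on {a..b})"

lemma lebesgue_on_integral_supported: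
  fixes f :: "real \<Rightarrow> complex"
  assumes f: "f absolutely_integrable_on {a..b}" and sub: "{a..b} \<subseteq> I" and I: "I \<in> sets lebesgue"
    and \<phi>: "continuous_on {a..b} \<phi>" and supp: "\<And>x. x \<notin> {a..b} \<Longrightarrow> \<phi> x = 0"
  shows "integrable (lebesgue_on I) (\<lambda>x. \<phi> x *\<^sub>R f x)"
    and "(LINT x|lebesgue_on I. \<phi> x *\<^sub>R f x) = integral {a..b} (\<lambda>x. \<phi> x *\<^sub>R f x)"
proof -
  have "(\<lambda>x. complex_of_real (\<phi> x) * f x) absolutely_integrable_on {a..b}"
    by (intro absolutely_integrable_mult_continuous f continuous_intros \<phi>)
  then have si: "set_integrable lebesgue {a..b} (\<lambda>x. \<phi> x *\<^sub>R f x)"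
    by (simp add: scaleR_conv_of_real)
  have eq: "(\<lambda>x. indicator I x *\<^sub>R (\<phi> x *\<^sub>R f x)) = (\<lambda>x. indicator {a..b} x *\<^sub>R (\<phi> x *\<^sub>R f x))"
    using sub supp by (fastforce simp: indicator_def fun_eq_iff)
  show "integrable (lebesgue_on I) (\<lambda>x. \<phi> x *\<^sub>R f x)"
    using si I by (subst integrable_restrict_space) (simp_all only: eq set_integrable_def Int_UNIV_right space_completion space_lborel space_borel)
  show "(LINT x|lebesgue_on I. \<phi> x *\<^sub>R f x) = integral {a..b} (\<lambda>x. \<phi> x *\<^sub>R f x)"
    using set_lebesgue_integral_eq_integral(2)[OF si] I
    by (subst integral_restrict_space) (simp_all only: eq set_lebesgue_integral_def Int_UNIV_right space_completion space_lborel space_borel)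
qed

text \<open>Dominated convergence replaces the bump functions on \<open>{a..b}\<close> by the indicator, so all
  integrals of \<open>f\<close> over compact subintervals vanish.\<close>

lemma AE_zero_if_orthogonal_to_bumps:
  assumes I: "open I" and f: "locally_integrable_on I f"
    and zero: "\<And>n a b. a < b \<Longrightarrow> {a..b} \<subseteq> I \<Longrightarrow>
      integral {a..b} (\<lambda>x. bump (real (Suc n)) a b x *\<^sub>R f x) = 0"
  shows "AE x in lebesgue_on I. f x = 0"
proof (rule AE_on_open_set_if_AE_on_intervals[OF I])
  have int0: "integral {a..b} f = 0" if ab: "a < b" "{a..b} \<subseteq> I" for a b
  proof -
    have fi: "f absolutely_integrable_on {a..b}" using f ab by (auto simp: locally_integrable_on_def)
    have b_int: "(\<lambda>x. bump (real (Suc n)) a b x *\<^sub>R f x) integrable_on {a..b}" for n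
    proof -
      have "(\<lambda>x. complex_of_real (bump (real (Suc n)) a b x) * f x) absolutely_integrable_on {a..b}"
        by (intro absolutely_integrable_mult_continuous fi continuous_intros smooth_continuous smooth_bump)
      then show ?thesis
        by (simp add: scaleR_conv_of_real absolutely_integrable_on_def)
    qed
    let ?g = "\<lambda>x. if x \<in> {a<..<b} then f x else 0"
    have lim: "(\<lambda>n. integral {a..b} (\<lambda>x. bump (real (Suc n)) a b x *\<^sub>R f x)) \<longlonglongrightarrow> integral {a..b} ?g"
    proof (rule dominated_convergence(2)[OF b_int])
      show "(\<lambda>x. norm (f x)) integrable_on {a..b}"
        using fi by (simp add: absolutely_integrable_on_def)
      show "norm (bump (real (Suc n)) a b x *\<^sub>R f x) \<le> norm (f x)" for n x
        using bump_nonneg[of "real (Suc n)" a b x] bump_le_1[of "real (Suc n)" a b x]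
        by (simp add: mult_left_le_one_le del: of_nat_Suc)
      show "(\<lambda>n. bump (real (Suc n)) a b x *\<^sub>R f x) \<longlonglongrightarrow> ?g x" if "x \<in> {a..b}" for x
      proof (cases "x \<in> {a<..<b}")
        case True
        then show ?thesis using tendsto_scaleR[OF bump_tendsto_1[of a x b] tendsto_const[of "f x"]] by simp
      next
        case False
        then have "bump (real (Suc n)) a b x = 0" for n by (intro bump_outside) auto
        then show ?thesis
          by (simp only: if_not_P[OF False] scaleR_zero_left tendsto_const)
      qed
    qed
    have "(\<lambda>n. integral {a..b} (\<lambda>x. bump (real (Suc n)) a b x *\<^sub>R f x)) = (\<lambda>n. 0)"
      using zero[OF ab] by (intro ext)
    with lim have "integral {a..b} ?g = 0" by (simp only: LIMSEQ_const_iff)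
    moreover have "integral {a..b} f = integral {a..b} ?g"
      by (rule integral_spike[of "{a, b}"]) auto
    ultimately show ?thesis by simp
  qed
  fix a b :: real assume ab: "a < b" "{a..b} \<subseteq> I"
  show "AE x in lebesgue. x \<in> {a..b} \<longrightarrow> f x = 0"
  proof (rule integral_subintervals_zero_AE)
    show "f absolutely_integrable_on {a..b}" using f ab by (auto simp: locally_integrable_on_def)
    show "integral {a..x} f = 0" if "x \<in> {a..b}" for x
      using that int0[of a x] ab order_trans[of "{a..x}" "{a..b}" I] by (cases "a = x") auto
  qed
qed

text \<open>The lemma of du Bois-Reymond. Fix a bump function \<open>\<theta>\<close> with integral \<open>J\<close>.
  A bump function \<open>\<phi>\<close> with integral \<open>L\<close> differs from \<open>(L / J) \<theta>\<close> by
  the derivative of a test function; therefore \<open>f\<close> integrates against \<open>\<phi>\<close> like a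
  constant that is determined by \<open>\<theta>\<close>.\<close>

lemma AE_const_if_orthogonal_to_derivatives:
  assumes I: "open I" "is_interval I" and f: "locally_integrable_on I f"
    and zero: "\<And>\<phi>. test_function I \<phi> \<Longrightarrow> (LINT x|lebesgue_on I. deriv \<phi> x *\<^sub>R f x) = 0"
  shows "\<exists>C. AE x in lebesgue_on I. f x = C"
proof (cases "I = {}")
  case True
  then show ?thesis by (intro exI[of _ 0]) (simp add: AE_restrict_space_iff)
next
  case False
  then obtain x0 where "x0 \<in> I" by auto
  then obtain e where e: "e > 0" "cball x0 e \<subseteq> I"
    using I open_contains_cball by blast
  define c d where "c = x0 - e" and "d = x0 + e"
  have cd: "c < d" "{c..d} \<subseteq> I"
    using e by (auto simp: c_def d_def cball_eq_atLeastAtMost)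
  let ?\<theta> = "bump 1 c d"
  define J where "J = integral {c..d} ?\<theta>"
  have bint: "bump k a b integrable_on {u..v}" for k a b u v
    by (intro integrable_continuous_interval smooth_continuous smooth_bump)
  have J: "J > 0"
  proof -
    have "J \<noteq> 0"
    proof
      assume "J = 0"
      then have "\<forall>x\<in>{c..d}. ?\<theta> x = 0"
        using integral_eq_0_iff[of c d ?\<theta>] cd bump_nonneg
        by (auto simp: J_def smooth_continuous smooth_bump)
      moreover have "?\<theta> x0 > 0" "x0 \<in> {c..d}"
        using e by (auto intro!: bump_pos simp: c_def d_def)
      ultimately show False by auto
    qed
    moreover have "J \<ge> 0"
      unfolding J_def by (intro Henstock_Kurzweil_Integration.integral_nonneg bint bump_nonneg)
    ultimately show ?thesis by linarith
  qed
  have If: "f absolutely_integrable_on {a..b}" if "{a..b} \<subseteq> I" for a b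
    using f that by (auto simp: locally_integrable_on_def)
  define C where "C = integral {c..d} (\<lambda>x. ?\<theta> x *\<^sub>R f x) / of_real J"
  have "AE x in lebesgue_on I. f x - C = 0"
  proof (rule AE_zero_if_orthogonal_to_bumps[OF I(1)])
    show "locally_integrable_on I (\<lambda>x. f x - C)"
      using f by (auto simp: locally_integrable_on_def intro!: set_integral_diff(1)
          absolutely_integrable_continuous_real)
    fix n and a b :: real
    assume ab: "a < b" "{a..b} \<subseteq> I"
    let ?\<phi> = "bump (real (Suc n)) a b"
    define m M where "m = min a c" and "M = max b d"
    have mM: "m \<le> M" "{a..b} \<subseteq> {m..M}" "{c..d} \<subseteq> {m..M}"
      using ab cd by (auto simp: m_def M_def)
    have "a \<in> I" "b \<in> I" "c \<in> I" "d \<in> I" using ab cd by auto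
    then have "m \<in> I" "M \<in> I" by (auto simp: m_def M_def min_def max_def)
    then have sub: "{m..M} \<subseteq> I"
      using I(2) \<open>m \<in> I\<close> \<open>M \<in> I\<close> by (simp add: Icc_subset_interval)
    define L where "L = integral {a..b} ?\<phi>"
    \<comment> \<open>The multiple of \<open>\<theta>\<close> makes the integral vanish, so that \<open>g\<close> is the derivative of a test function.\<close>
    define g where "g x = ?\<phi> x + (- L / J) * ?\<theta> (1 * x + 0)" for x
    have smooth_g: "smooth g"
      unfolding g_def by (intro smooth_add smooth_affine smooth_bump)
    have out: "?\<phi> x = 0" if "x \<notin> {a..b}" for x
      using that by (intro bump_outside) auto
    have out': "?\<theta> x = 0" if "x \<notin> {c..d}" for x
      using that by (intro bump_outside) auto
    have supp: "g x = 0" if "x \<notin> {m..M}" for x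
      unfolding g_def using that mM out[of x] out'[of x] by auto
    have L': "integral {m..M} ?\<phi> = L"
      unfolding L_def using mM out
      by (intro integral_unique has_integral_on_superset[OF integrable_integral[OF bint]]) auto
    have J': "integral {m..M} ?\<theta> = J"
      unfolding J_def using mM out'
      by (intro integral_unique has_integral_on_superset[OF integrable_integral[OF bint]]) auto
    have "integral {m..M} g = integral {m..M} ?\<phi> + integral {m..M} (\<lambda>x. (- L / J) * ?\<theta> x)"
      unfolding g_def
      by (subst Henstock_Kurzweil_Integration.integral_add[symmetric])
         (auto intro!: bint integrable_on_mult_right[of "bump 1 c d", where c = "- L / J", simplified] simp del: of_nat_Suc)
    also have "\<dots> = 0" using J by (simp add: L' J' del: of_nat_Suc)
    finally have "integral {m..M} g = 0" .
    from test_function_antiderivative[OF smooth_g supp this sub mM(1)]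
    obtain \<Phi> where \<Phi>: "test_function I \<Phi>" "deriv \<Phi> = g" by blast
    have Is: "I \<in> sets lebesgue" using I(1) by auto
    note supported = lebesgue_on_integral_supported[OF If _ Is smooth_continuous]
    have p: "integrable (lebesgue_on I) (\<lambda>x. ?\<phi> x *\<^sub>R f x)"
       "(LINT x|lebesgue_on I. ?\<phi> x *\<^sub>R f x) = integral {a..b} (\<lambda>x. ?\<phi> x *\<^sub>R f x)"
      using supported[OF ab(2) ab(2) smooth_bump out] by blast+
    have t: "integrable (lebesgue_on I) (\<lambda>x. ?\<theta> x *\<^sub>R f x)"
       "(LINT x|lebesgue_on I. ?\<theta> x *\<^sub>R f x) = integral {c..d} (\<lambda>x. ?\<theta> x *\<^sub>R f x)"
      using supported[OF cd(2) cd(2) smooth_bump out'] by blast+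
    have "0 = (LINT x|lebesgue_on I. g x *\<^sub>R f x)"
      using zero[OF \<Phi>(1)] \<Phi>(2) by simp
    also have "\<dots> = (LINT x|lebesgue_on I. ?\<phi> x *\<^sub>R f x + (- L / J) *\<^sub>R (?\<theta> x *\<^sub>R f x))"
      by (simp add: g_def scaleR_add_left scaleR_diff_left del: of_nat_Suc)
    also have "\<dots> = integral {a..b} (\<lambda>x. ?\<phi> x *\<^sub>R f x) + (- L / J) *\<^sub>R integral {c..d} (\<lambda>x. ?\<theta> x *\<^sub>R f x)"
      using p t by (subst Bochner_Integration.integral_add)
        (auto intro!: integrable_scaleR_right simp del: of_nat_Suc scaleR_scaleR)
    also have "\<dots> = integral {a..b} (\<lambda>x. ?\<phi> x *\<^sub>R f x) - L *\<^sub>R C"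
      using J by (simp add: C_def scaleR_conv_of_real)
    finally have main: "integral {a..b} (\<lambda>x. ?\<phi> x *\<^sub>R f x) = L *\<^sub>R C" by simp
    have i: "(\<lambda>x. ?\<phi> x *\<^sub>R f x) integrable_on {a..b}"
    proof -
      have "(\<lambda>x. complex_of_real (?\<phi> x) * f x) absolutely_integrable_on {a..b}"
        by (intro absolutely_integrable_mult_continuous If ab continuous_intros smooth_continuous smooth_bump)
      then show ?thesis
        by (simp add: scaleR_conv_of_real absolutely_integrable_on_def)
    qed
    have "((\<lambda>x. ?\<phi> x *\<^sub>R C) has_integral L *\<^sub>R C) {a..b}"
      unfolding L_def by (intro has_integral_scaleR_left integrable_integral bint)
    from has_integral_diff[OF integrable_integral[OF i] this] main
    show "integral {a..b} (\<lambda>x. ?\<phi> x *\<^sub>R (f x - C)) = 0"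
      by (simp add: scaleR_diff_right integral_unique del: of_nat_Suc)
  qed
  then show ?thesis by (intro exI[of _ C]) simp
qed

lemma AE_eq_imp_eq_on_closure:
  fixes F H :: "real \<Rightarrow> complex"
  assumes I: "open I" and F: "continuous_on (closure I) F" and H: "continuous_on (closure I) H"
    and ae: "AE x in lebesgue_on I. F x = H x" and x: "x \<in> closure I"
  shows "F x = H x"
proof -
  have "AE t in lebesgue. t \<in> I \<longrightarrow> F t = H t"
    using ae I(1) by (subst (asm) AE_restrict_space_iff) auto
  then obtain N where N: "negligible N" "\<And>t. t \<notin> N \<Longrightarrow> t \<in> I \<Longrightarrow> F t = H t"
    unfolding eventually_ae_filter_negligible by blast
  let ?U = "{t \<in> I. F t - H t \<in> - {0}}"
  have "continuous_on I (\<lambda>t. F t - H t)"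
    using F H by (intro continuous_intros) (auto intro: continuous_on_subset[OF _ closure_subset])
  then have "open ?U"
    using continuous_open_preimage[OF _ I open_Compl[OF closed_singleton], of "\<lambda>t. F t - H t" 0]
    by (simp add: vimage_def Int_def del: right_minus_eq)
  moreover have "negligible ?U"
  proof (rule negligible_subset[OF N(1)], rule subsetI)
    fix t assume "t \<in> ?U"
    then show "t \<in> N" using N(2)[of t] by (cases "t \<in> N") simp_all
  qed
  ultimately have "?U = {}" using open_not_negligible by blast
  then have z: "F t - H t = 0" if "t \<in> I" for t using that by blast
  have "F x - H x = 0"
    by (rule continuous_constant_on_closure[of I "\<lambda>t. F t - H t", OF continuous_on_diff[OF F H] z x])
  then show ?thesis by simp
qed

section \<open>Weak derivatives are densities of primitives\<close>

lemma test_function_supported_in_interval: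
  assumes I: "open I" "is_interval I" and \<phi>: "test_function I \<phi>" and ne: "I \<noteq> {}"
  obtains a b where "a < b" "{a..b} \<subseteq> I" "\<And>x. x \<notin> {a<..<b} \<Longrightarrow> \<phi> x = 0" "\<And>x. x \<notin> {a<..<b} \<Longrightarrow> deriv \<phi> x = 0"
proof -
  obtain K where K: "compact K" "K \<subseteq> I" "\<And>x. x \<notin> K \<Longrightarrow> \<phi> x = 0"
    using \<phi> unfolding test_function_def by blast
  obtain z where z: "z \<in> I" using ne by auto
  \<comment> \<open>The point \<open>z\<close> makes the compact set nonempty; its extreme points are then moved apart within \<open>I\<close>.\<close>
  let ?K = "insert z K"
  have cK: "compact ?K" and sK: "?K \<subseteq> I" using K z by auto
  obtain l where l: "l \<in> ?K" "\<And>x. x \<in> ?K \<Longrightarrow> l \<le> x"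
    using compact_attains_inf[OF cK] by blast
  obtain u where u: "u \<in> ?K" "\<And>x. x \<in> ?K \<Longrightarrow> x \<le> u"
    using compact_attains_sup[OF cK] by blast
  have lI: "l \<in> I" and uI: "u \<in> I" using l(1) u(1) sK by blast+
  obtain e where e: "e > 0" "cball l e \<subseteq> I" using I(1) lI unfolding open_contains_cball by meson
  obtain d where d: "d > 0" "cball u d \<subseteq> I" using I(1) uI unfolding open_contains_cball by meson
  have "l - e \<in> cball l e" "u + d \<in> cball u d" using e d by (simp_all add: dist_real_def)
  then have ends: "l - e \<in> I" "u + d \<in> I" using e d by blast+
  have out: "\<phi> x = 0" if "x \<notin> {l..u}" for x
    using that l u K(3)[of x] by auto
  show thesis
  proof
    have "l \<le> u" using l(2) u(1) by blast
    then show "l - e < u + d" using e d by linarith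
    show "{l - e..u + d} \<subseteq> I"
      using ends I(2) by (simp add: Icc_subset_interval)
    show "\<phi> x = 0" if "x \<notin> {l - e<..<u + d}" for x
      using that e d by (intro out) auto
    show "deriv \<phi> x = 0" if "x \<notin> {l - e<..<u + d}" for x
    proof (rule DERIV_imp_deriv)
      have "x \<in> - {l..u}" using that e d by auto
      moreover have "open (- {l..u})" by auto
      ultimately have "\<forall>\<^sub>F y in nhds x. y \<in> - {l..u}" by (rule eventually_nhds_in_open[rotated])
      then have "\<forall>\<^sub>F y in nhds x. \<phi> y = 0" by (rule eventually_mono) (simp add: out)
      then show "(\<phi> has_real_derivative 0) (at x)"
        by (subst DERIV_cong_ev[OF refl _ refl]) auto
    qed
  qed
qed

lemma test_function_smooth: "test_function I \<phi> \<Longrightarrow> smooth \<phi>"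
  by (simp add: test_function_def smooth_iff_deriv_funpow)

lemma continuous_on_locally_integrable: "continuous_on I F \<Longrightarrow> locally_integrable_on I F"
  unfolding locally_integrable_on_def
  using absolutely_integrable_continuous_real continuous_on_subset by blast

lemma lebesgue_on_integrable_test:
  assumes I: "open I" "is_interval I" and \<phi>: "test_function I \<phi>" and f: "locally_integrable_on I f"
  shows "integrable (lebesgue_on I) (\<lambda>x. \<phi> x *\<^sub>R f x)" "integrable (lebesgue_on I) (\<lambda>x. deriv \<phi> x *\<^sub>R f x)"
proof -
  have *: "integrable (lebesgue_on I) (\<lambda>x. \<phi> x *\<^sub>R f x) \<and> integrable (lebesgue_on I) (\<lambda>x. deriv \<phi> x *\<^sub>R f x)"
  proof (cases "I = {}")
    case True
    then show ?thesis by (simp add: integrable_restrict_space)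
  next
    case False
    obtain a b where ab: "a < b" "{a..b} \<subseteq> I" "\<And>x. x \<notin> {a<..<b} \<Longrightarrow> \<phi> x = 0" "\<And>x. x \<notin> {a<..<b} \<Longrightarrow> deriv \<phi> x = 0"
      using test_function_supported_in_interval[OF I \<phi> False] by blast
    have out: "\<phi> x = 0" "deriv \<phi> x = 0" if "x \<notin> {a..b}" for x
      using ab(3,4)[of x] that by auto
    have fi: "f absolutely_integrable_on {a..b}" using f ab by (auto simp: locally_integrable_on_def)
    have Is: "I \<in> sets lebesgue" using I by auto
    show ?thesis
      using lebesgue_on_integral_supported(1)[OF fi ab(2) Is smooth_continuous[OF test_function_smooth[OF \<phi>]] out(1)]
        lebesgue_on_integral_supported(1)[OF fi ab(2) Is smooth_continuous[OF smooth_deriv[OF test_function_smooth[OF \<phi>]]] out(2)]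
      by blast
  qed
  then show "integrable (lebesgue_on I) (\<lambda>x. \<phi> x *\<^sub>R f x)" "integrable (lebesgue_on I) (\<lambda>x. deriv \<phi> x *\<^sub>R f x)"
    by auto
qed

text \<open>Integration by parts on a compact interval at whose end points the test function vanishes.\<close>

lemma primitive_on_weak_derivative:
  assumes I: "open I" "is_interval I" and F: "primitive_on (closure I) F G" and \<phi>: "test_function I \<phi>"
  shows "(LINT x|lebesgue_on I. deriv \<phi> x *\<^sub>R F x) = - (LINT x|lebesgue_on I. \<phi> x *\<^sub>R G x)"
proof (cases "I = {}")
  case True
  then show ?thesis by (simp add: integral_restrict_space)
next
  case False
  obtain a b where ab: "a < b" "{a..b} \<subseteq> I" "\<And>x. x \<notin> {a<..<b} \<Longrightarrow> \<phi> x = 0" "\<And>x. x \<notin> {a<..<b} \<Longrightarrow> deriv \<phi> x = 0"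
    using test_function_supported_in_interval[OF I \<phi> False] by blast
  have out: "\<phi> x = 0" "deriv \<phi> x = 0" if "x \<notin> {a..b}" for x
    using ab(3,4)[of x] that by auto
  have s: "smooth \<phi>" "smooth (deriv \<phi>)" using \<phi> test_function_smooth smooth_deriv by blast+
  have F': "primitive_on {a..b} F G"
    using F ab(2) closure_subset by (blast intro: primitive_on_subset)
  have cF: "continuous_on {a..b} F"
    using F' by (intro primitive_on_continuous) (auto simp: is_interval_cc)
  have fi: "F absolutely_integrable_on {a..b}" "G absolutely_integrable_on {a..b}"
    using cF absolutely_integrable_continuous_real primitive_onD(1)[OF F', of a b] ab(1) by auto
  have P: "primitive_on {a..b} (\<lambda>x. complex_of_real (\<phi> x)) (\<lambda>x. complex_of_real (deriv \<phi> x))"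
  proof (rule primitive_onI_DERIV)
    show "continuous_on {a..b} (\<lambda>x. complex_of_real (deriv \<phi> x))"
      by (intro continuous_intros smooth_continuous s)
    show "((\<lambda>x. complex_of_real (\<phi> x)) has_vector_derivative complex_of_real (deriv \<phi> x)) (at x within {a..b})" for x
      using smooth_DERIV[OF s(1)] 
      by (intro has_vector_derivative_of_real has_vector_derivative_at_within) 
        (simp add: has_real_derivative_iff_has_vector_derivative)
  qed (simp add: is_interval_cc)
  have Is: "I \<in> sets lebesgue" using I by auto
  have i: "(\<lambda>x. deriv \<phi> x *\<^sub>R F x) integrable_on {a..b}" "(\<lambda>x. \<phi> x *\<^sub>R G x) integrable_on {a..b}"
    using absolutely_integrable_mult_continuous[OF fi(1), of "\<lambda>x. complex_of_real (deriv \<phi> x)"]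
      absolutely_integrable_mult_continuous[OF fi(2), of "\<lambda>x. complex_of_real (\<phi> x)"] s
    by (auto simp: scaleR_conv_of_real absolutely_integrable_on_def intro!: continuous_intros smooth_continuous)
  have "0 = integral {a..b} (\<lambda>x. deriv \<phi> x *\<^sub>R F x + \<phi> x *\<^sub>R G x)"
    using integral_by_parts_primitive[OF less_imp_le[OF ab(1)] P F'] ab(3)[of a] ab(3)[of b]
    by (simp add: scaleR_conv_of_real)
  also have "\<dots> = integral {a..b} (\<lambda>x. deriv \<phi> x *\<^sub>R F x) + integral {a..b} (\<lambda>x. \<phi> x *\<^sub>R G x)"
    using i by (rule Henstock_Kurzweil_Integration.integral_add)
  finally have "integral {a..b} (\<lambda>x. deriv \<phi> x *\<^sub>R F x) = - integral {a..b} (\<lambda>x. \<phi> x *\<^sub>R G x)"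
    by (simp add: eq_neg_iff_add_eq_0)
  then show ?thesis
    using lebesgue_on_integral_supported(2)[OF fi(2) ab(2) Is smooth_continuous[OF s(1)] out(1)]
      lebesgue_on_integral_supported(2)[OF fi(1) ab(2) Is smooth_continuous[OF s(2)] out(2)]
    by simp
qed

text \<open>Subtract from \<open>f\<close> any primitive of \<open>g\<close>: the difference is orthogonal to all
  derivatives of test functions and hence constant.\<close>

lemma primitive_if_weak_derivative:
  assumes I: "open I" "is_interval I" and f: "locally_integrable_on I f"
    and g: "\<And>x y. x \<in> closure I \<Longrightarrow> y \<in> closure I \<Longrightarrow> x \<le> y \<Longrightarrow> g absolutely_integrable_on {x..y}"
    and weak: "\<And>\<phi>. test_function I \<phi> \<Longrightarrow>
      (LINT x|lebesgue_on I. deriv \<phi> x *\<^sub>R f x) = - (LINT x|lebesgue_on I. \<phi> x *\<^sub>R g x)"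
  shows "\<exists>F. primitive_on (closure I) F g \<and> (AE x in lebesgue_on I. f x = F x)"
proof -
  have cI: "is_interval (closure I)"
    using I(2) by (rule is_interval_closure)
  obtain F where F: "primitive_on (closure I) F g"
    using primitive_on_exists[OF cI g] by blast
  have "continuous_on (closure I) F"
    using F by (intro primitive_on_continuous cI) auto
  then have F_loc: "locally_integrable_on I F"
    by (intro continuous_on_locally_integrable) (rule continuous_on_subset[OF _ closure_subset])
  have "\<exists>C. AE x in lebesgue_on I. f x - F x = C"
  proof (rule AE_const_if_orthogonal_to_derivatives[OF I])
    show "locally_integrable_on I (\<lambda>x. f x - F x)"
      using f F_loc by (auto simp: locally_integrable_on_def intro: set_integral_diff(1))
    fix \<phi> assume \<phi>: "test_function I \<phi>"
    show "(LINT x|lebesgue_on I. deriv \<phi> x *\<^sub>R (f x - F x)) = 0"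
      using weak[OF \<phi>] primitive_on_weak_derivative[OF I F \<phi>]
        lebesgue_on_integrable_test(2)[OF I \<phi> f] lebesgue_on_integrable_test(2)[OF I \<phi> F_loc]
      by (simp add: scaleR_diff_right)
  qed
  then obtain C where "AE x in lebesgue_on I. f x - F x = C" by blast
  then have "AE x in lebesgue_on I. f x = F x + C"
    by eventually_elim (simp add: algebra_simps)
  moreover have "primitive_on (closure I) (\<lambda>x. F x + C) g"
    using F by (rule primitive_on_add_const)
  ultimately show ?thesis by (intro exI[of _ "\<lambda>x. F x + C"]) simp
qed

section \<open>Elements of \<open>L\<^sup>2\<close> and of \<open>H\<^sup>1\<close>\<close>

text \<open>The index sets of the waves and of the heat are intervals. Connectedness is what identifies functions with
  vanishing weak derivative as constants.\<close>

class connected_interval_index = interval_index +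
  assumes is_interval_interval_of: "is_interval (interval_of TYPE('a))"

instance wave :: connected_interval_index
  by standard (simp add: interval_of_wave_def is_interval_oo)

instance heat :: connected_interval_index
  by standard (simp add: interval_of_heat_def is_interval_oi)

text \<open>Near the end points, too, \<open>f\<close> is integrable, since \<open>cmod (f t) \<le> 1 + (cmod (f
  t))\<^sup>2\<close>.\<close>

lemma square_integrable_locally_integrable:
  assumes f: "square_integrable I f" and I: "open I" "is_interval I"
    and xy: "x \<in> closure I" "y \<in> closure I"
  shows "f absolutely_integrable_on {x..y}"
proof -
  let ?J = "{x<..<y}"
  have sub: "?J \<subseteq> I" using I xy by (rule greaterThanLessThan_subset_if_closure)
  have Is: "I \<in> sets lebesgue" using I by auto
  have "f absolutely_integrable_on ?J"
  proof (rule measurable_bounded_by_integrable_imp_absolutely_integrable)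
    show "f \<in> borel_measurable (lebesgue_on ?J)"
      using f sub unfolding square_integrable_def by (auto intro: measurable_restrict_mono)
    have "(\<lambda>x. (cmod (f x))\<^sup>2) absolutely_integrable_on I"
      using f Is integrable_restrict_space[of I lebesgue "\<lambda>x. (cmod (f x))\<^sup>2"]
      by (simp add: square_integrable_def set_integrable_def)
    then have "(\<lambda>x. (cmod (f x))\<^sup>2) absolutely_integrable_on ?J"
      by (rule set_integrable_subset) (use sub in auto)
    then have "(\<lambda>x. (cmod (f x))\<^sup>2) integrable_on ?J"
      using set_lebesgue_integral_eq_integral(1) by blast
    then show "(\<lambda>x. 1 + (cmod (f x))\<^sup>2) integrable_on ?J"
      by (intro Henstock_Kurzweil_Integration.integrable_add)
         (auto simp: integrable_on_open_interval_real intro: integrable_on_const)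
    show "norm (f t) \<le> 1 + (cmod (f t))\<^sup>2" for t
    proof -
      have "2 * cmod (f t) \<le> 1 + (cmod (f t))\<^sup>2"
        using zero_le_power2[of "cmod (f t) - 1"] by (simp add: power2_diff)
      then show ?thesis using norm_ge_zero[of "f t"] by linarith
    qed
  qed simp
  then show ?thesis by (simp add: absolutely_integrable_on_Icc_iff_Ioo)
qed

lemma square_integrable_rep_L2: "square_integrable (interval_of TYPE('i)) (rep_L2 (f :: 'i::interval_index L2))"
  using Quotient_rep_reflp[OF Quotient_L2] L2_rel_refl by blast

lemma abs_rep_L2: "abs_L2 (rep_L2 f) = f"
  by (rule Quotient_abs_rep[OF Quotient_L2])

lemma rep_abs_L2:
  assumes "square_integrable (interval_of TYPE('i)) F"
  shows "AE x in lebesgue_on (interval_of TYPE('i)). rep_L2 (abs_L2 F :: 'i::interval_index L2) x = F x"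
  using Quotient_rep_abs[OF Quotient_L2[where 'a = 'i], of F] assms unfolding L2_rel_refl[symmetric]
  by (simp add: L2_rel_def)

lemma L2_eqI:
  assumes "AE x in lebesgue_on (interval_of TYPE('i)). rep_L2 f x = rep_L2 g x"
  shows "f = (g :: 'i::interval_index L2)"
  using Quotient_rel_rep[OF Quotient_L2, of f g] assms square_integrable_rep_L2[of f] square_integrable_rep_L2[of g]
  by (simp add: L2_rel_def)

lemma rep_L2_add:
  "AE x in lebesgue_on (interval_of TYPE('i)). rep_L2 (f + g :: 'i::interval_index L2) x = rep_L2 f x + rep_L2 g x"
  using plus_L2.abs_eq[where ?'a = 'i, of "rep_L2 f" "rep_L2 g"] square_integrable_rep_L2[of f] square_integrable_rep_L2[of g]
    rep_abs_L2[where 'i = 'i, OF square_integrable_add[OF square_integrable_rep_L2[of f] square_integrable_rep_L2[of g]]]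
  by (simp add: abs_rep_L2 L2_rel_refl)

lemma rep_L2_scaleC:
  "AE x in lebesgue_on (interval_of TYPE('i)). rep_L2 (c *\<^sub>C f :: 'i::interval_index L2) x = c * rep_L2 f x"
  using scaleC.abs_eq[where ?'i = 'i, of "rep_L2 f" c] square_integrable_rep_L2[of f]
    rep_abs_L2[where 'i = 'i, OF square_integrable_scale[OF square_integrable_rep_L2[of f]]]
  by (simp add: abs_rep_L2 L2_rel_refl)

lemma rep_L2_uminus:
  "AE x in lebesgue_on (interval_of TYPE('i)). rep_L2 (- f :: 'i::interval_index L2) x = - rep_L2 f x"
  using uminus_L2.abs_eq[where ?'a = 'i, of "rep_L2 f"] square_integrable_rep_L2[of f]
    rep_abs_L2[where 'i = 'i, OF square_integrable_scale[OF square_integrable_rep_L2[of f], of "-1"]]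
  by (simp add: abs_rep_L2 L2_rel_refl)

lemma rep_L2_diff:
  "AE x in lebesgue_on (interval_of TYPE('i)). rep_L2 (f - g :: 'i::interval_index L2) x = rep_L2 f x - rep_L2 g x"
  unfolding minus_L2_def using rep_L2_add[of f "- g"] rep_L2_uminus[of g] by eventually_elim simp

lemma rep_L2_scaleC_diff:
  fixes f g :: "'i::interval_index L2"
  assumes "AE x in lebesgue_on (interval_of TYPE('i)). rep_L2 f x = F x"
  shows "AE x in lebesgue_on (interval_of TYPE('i)). rep_L2 (c *\<^sub>C f - g) x = c * F x - rep_L2 g x"
  using rep_L2_diff[of "c *\<^sub>C f" g] rep_L2_scaleC[of c f] assms by eventually_elim simp

lemma rep_L2_zero: "AE x in lebesgue_on (interval_of TYPE('i)). rep_L2 (0 :: 'i::interval_index L2) x = 0"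
  using rep_abs_L2[where 'i = 'i, OF square_integrable_zero] by (simp add: zero_L2.abs_eq zero_L2_def)

lemma abs_L2_add:
  assumes "square_integrable (interval_of TYPE('i)) F" "square_integrable (interval_of TYPE('i)) G"
  shows "abs_L2 (\<lambda>x. F x + G x) = (abs_L2 F + abs_L2 G :: 'i::interval_index L2)"
  using plus_L2.abs_eq[where ?'a = 'i, of F G] assms by (simp add: L2_rel_refl)

lemma scaleC_diff: "c *\<^sub>C (f - g) = c *\<^sub>C f - c *\<^sub>C (g :: 'i::interval_index L2)"
proof (rule L2_eqI)
  show "AE x in lebesgue_on (interval_of TYPE('i)). rep_L2 (c *\<^sub>C (f - g)) x = rep_L2 (c *\<^sub>C f - c *\<^sub>C g) x"
    using rep_L2_scaleC[of c "f - g"] rep_L2_diff[of f g] rep_L2_diff[of "c *\<^sub>C f" "c *\<^sub>C g"]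
      rep_L2_scaleC[of c f] rep_L2_scaleC[of c g]
    by eventually_elim (simp add: right_diff_distrib)
qed

lemma scaleC_eq_zero_imp:
  assumes "c *\<^sub>C f = 0" "c \<noteq> 0" shows "f = (0 :: 'i::interval_index L2)"
proof (rule L2_eqI)
  show "AE x in lebesgue_on (interval_of TYPE('i)). rep_L2 f x = rep_L2 (0 :: 'i L2) x"
    using rep_L2_scaleC[of c f] rep_L2_zero[where 'i = 'i] unfolding assms(1)
    by eventually_elim (use assms(2) in simp)
qed

lemma norm_abs_L2:
  assumes "square_integrable (interval_of TYPE('i)) F"
  shows "(norm (abs_L2 F :: 'i::interval_index L2))\<^sup>2 = (LINT x|lebesgue_on (interval_of TYPE('i)). (cmod (F x))\<^sup>2)"
  using norm_L2.abs_eq[where ?'a = 'i, of F] assms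
  by (simp add: L2_rel_refl)

lemma norm_rep_L2:
  "(norm (f :: 'i::interval_index L2))\<^sup>2 = (LINT x|lebesgue_on (interval_of TYPE('i)). (cmod (rep_L2 f x))\<^sup>2)"
  using norm_abs_L2[OF square_integrable_rep_L2[of f]] by (simp add: abs_rep_L2)

lemma value_at_eqI:
  fixes f :: "'i::interval_index L2"
  assumes F: "continuous_on (closure (interval_of TYPE('i))) F"
    and ae: "AE x in lebesgue_on (interval_of TYPE('i)). rep_L2 f x = F x"
    and x: "x \<in> closure (interval_of TYPE('i))"
  shows "value_at f x = F x"
  unfolding value_at_def
proof (rule the_equality)
  show "\<exists>F'. continuous_on (closure (interval_of TYPE('i))) F' \<and>
     (AE y in lebesgue_on (interval_of TYPE('i)). rep_L2 f y = F' y) \<and> F' x = F x"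
    using F ae by blast
  fix c assume "\<exists>F'. continuous_on (closure (interval_of TYPE('i))) F' \<and>
     (AE y in lebesgue_on (interval_of TYPE('i)). rep_L2 f y = F' y) \<and> F' x = c"
  then obtain F' where F': "continuous_on (closure (interval_of TYPE('i))) F'"
    "AE y in lebesgue_on (interval_of TYPE('i)). rep_L2 f y = F' y" "F' x = c" by blast
  have "AE y in lebesgue_on (interval_of TYPE('i)). F' y = F y"
    using F'(2) ae by eventually_elim simp
  from AE_eq_imp_eq_on_closure[OF open_interval_of F'(1) F this x] F'(3) show "c = F x" by simp
qed

text \<open>This translates the weak formulation into primitives; all later arguments about Sobolev spaces take place
  on the right-hand side.\<close>

lemma has_weak_derivative_iff:
  fixes f g :: "'i::connected_interval_index L2"
  shows "has_weak_derivative f g \<longleftrightarrow> (\<exists>F. primitive_on (closure (interval_of TYPE('i))) F (rep_L2 g) \<and>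
     (AE x in lebesgue_on (interval_of TYPE('i)). rep_L2 f x = F x))"
    (is "_ \<longleftrightarrow> ?R")
proof -
  let ?I = "interval_of TYPE('i)"
  note I = open_interval_of[where 'a = 'i] is_interval_interval_of[where 'a = 'i]
  have int: "rep_L2 h absolutely_integrable_on {x..y}" if "x \<in> closure ?I" "y \<in> closure ?I" for h :: "'i L2" and x y
    using square_integrable_locally_integrable[OF square_integrable_rep_L2 I that] .
  have loc: "locally_integrable_on ?I (rep_L2 h)" for h :: "'i L2"
    unfolding locally_integrable_on_def
  proof (intro allI impI)
    fix a b assume "{a..b} \<subseteq> ?I"
    then show "rep_L2 h absolutely_integrable_on {a..b}"
      using int[of a b h] closure_subset[of ?I] by (cases "a \<le> b") (auto simp: subset_iff)
  qed
  show ?thesis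
  proof
    assume "has_weak_derivative f g"
    then show ?R
      unfolding has_weak_derivative_def
      by (intro primitive_if_weak_derivative[OF I loc int]) auto
  next
    assume ?R
    then obtain F where F: "primitive_on (closure ?I) F (rep_L2 g)" "AE x in lebesgue_on ?I. rep_L2 f x = F x"
      by blast
    have "continuous_on (closure ?I) F"
      by (intro primitive_on_continuous[OF is_interval_closure[OF I(2)] closed_closure F(1)])
    then have F_loc: "locally_integrable_on ?I F"
      by (intro continuous_on_locally_integrable) (rule continuous_on_subset[OF _ closure_subset])
    show "has_weak_derivative f g"
      unfolding has_weak_derivative_def
    proof (intro allI impI)
      fix \<phi> assume \<phi>: "test_function ?I \<phi>"
      have "(LINT x|lebesgue_on ?I. deriv \<phi> x *\<^sub>R rep_L2 f x) = (LINT x|lebesgue_on ?I. deriv \<phi> x *\<^sub>R F x)"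
      proof (rule integral_cong_AE)
        show "AE x in lebesgue_on ?I. deriv \<phi> x *\<^sub>R rep_L2 f x = deriv \<phi> x *\<^sub>R F x"
          using F(2) by eventually_elim simp
      qed (use lebesgue_on_integrable_test(2)[OF I \<phi>] loc F_loc in auto)
      also have "\<dots> = - (LINT x|lebesgue_on ?I. \<phi> x *\<^sub>R rep_L2 g x)"
        by (rule primitive_on_weak_derivative[OF I F(1) \<phi>])
      finally show "(LINT x|lebesgue_on ?I. deriv \<phi> x *\<^sub>R rep_L2 f x) = - (LINT x|lebesgue_on ?I. \<phi> x *\<^sub>R rep_L2 g x)" .
    qed
  qed
qed

text \<open>Two weak derivatives have primitives that agree with \<open>f\<close> almost everywhere, hence everywhere
  on the closed interval, so their integrals over all subintervals coincide.\<close>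

lemma has_weak_derivative_unique:
  fixes f g h :: "'i::connected_interval_index L2"
  assumes g: "has_weak_derivative f g" and h: "has_weak_derivative f h"
  shows "g = h"
proof (rule L2_eqI)
  let ?I = "interval_of TYPE('i)"
  note I = open_interval_of[where 'a = 'i] is_interval_interval_of[where 'a = 'i]
  have cI: "is_interval (closure ?I)" using I(2) by (rule is_interval_closure)
  obtain G where G: "primitive_on (closure ?I) G (rep_L2 g)" "AE x in lebesgue_on ?I. rep_L2 f x = G x"
    using g has_weak_derivative_iff by blast
  obtain H where H: "primitive_on (closure ?I) H (rep_L2 h)" "AE x in lebesgue_on ?I. rep_L2 f x = H x"
    using h has_weak_derivative_iff by blast
  have "AE x in lebesgue_on ?I. G x = H x" using G(2) H(2) by eventually_elim simp
  then have eq: "G x = H x" if "x \<in> closure ?I" for x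
    using AE_eq_imp_eq_on_closure[OF I(1)] primitive_on_continuous[OF cI closed_closure G(1)]
      primitive_on_continuous[OF cI closed_closure H(1)] that by blast
  have "AE x in lebesgue_on ?I. rep_L2 g x - rep_L2 h x = 0"
  proof (rule AE_on_open_set_if_AE_on_intervals[OF I(1)])
    fix a b assume ab: "a < b" "{a..b} \<subseteq> ?I"
    then have sub: "{a..b} \<subseteq> closure ?I" using closure_subset by blast
    show "AE x in lebesgue. x \<in> {a..b} \<longrightarrow> rep_L2 g x - rep_L2 h x = 0"
    proof (rule integral_subintervals_zero_AE)
      have i: "rep_L2 g absolutely_integrable_on {a..x}" "rep_L2 h absolutely_integrable_on {a..x}"
        "integral {a..x} (rep_L2 g) = integral {a..x} (rep_L2 h)" if "x \<in> {a..b}" for x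
      proof -
        have ax: "a \<in> closure ?I" "x \<in> closure ?I" "a \<le> x" using that sub ab by auto
        show "rep_L2 g absolutely_integrable_on {a..x}" "rep_L2 h absolutely_integrable_on {a..x}"
          "integral {a..x} (rep_L2 g) = integral {a..x} (rep_L2 h)"
          using primitive_onD[OF G(1) ax] primitive_onD[OF H(1) ax] eq ax by auto
      qed
      show "(\<lambda>x. rep_L2 g x - rep_L2 h x) absolutely_integrable_on {a..b}"
        using i[of b] ab by (intro set_integral_diff(1)) auto
      show "integral {a..x} (\<lambda>x. rep_L2 g x - rep_L2 h x) = 0" if "x \<in> {a..b}" for x
        using i[OF that] by (subst Henstock_Kurzweil_Integration.integral_diff) (auto simp: absolutely_integrable_on_def)
    qed
  qed
  then show "AE x in lebesgue_on ?I. rep_L2 g x = rep_L2 h x"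
    by eventually_elim simp
qed

lemma weak_derivative_eqI:
  fixes f g :: "'i::connected_interval_index L2"
  shows "has_weak_derivative f g \<Longrightarrow> weak_derivative f = g"
  unfolding weak_derivative_def using has_weak_derivative_unique by blast

lemma H1_iff: "f \<in> H1 \<longleftrightarrow> has_weak_derivative f (weak_derivative (f :: 'i::connected_interval_index L2))"
  unfolding H1_def using weak_derivative_eqI by blast

text \<open>The boundary value function \<^const>\<open>value_at\<close> is itself the continuous
  representative.\<close>

lemma H1_value_at:
  fixes f :: "'i::connected_interval_index L2"
  assumes "f \<in> H1"
  shows "primitive_on (closure (interval_of TYPE('i))) (value_at f) (rep_L2 (weak_derivative f))"
    and "AE x in lebesgue_on (interval_of TYPE('i)). rep_L2 f x = value_at f x"
proof -
  let ?I = "interval_of TYPE('i)"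
  note I = open_interval_of[where 'a = 'i] is_interval_interval_of[where 'a = 'i]
  obtain F where F: "primitive_on (closure ?I) F (rep_L2 (weak_derivative f))" "AE x in lebesgue_on ?I. rep_L2 f x = F x"
    using assms unfolding H1_iff has_weak_derivative_iff by blast
  have cI: "is_interval (closure ?I)" using I(2) by (rule is_interval_closure)
  have eq: "value_at f x = F x" if "x \<in> closure ?I" for x
    by (rule value_at_eqI[OF primitive_on_continuous[OF cI closed_closure F(1)] F(2) that])
  show "primitive_on (closure ?I) (value_at f) (rep_L2 (weak_derivative f))"
    by (rule primitive_on_cong[OF F(1) cI]) (simp_all add: eq)
  have "AE x in lebesgue_on ?I. x \<in> ?I"
    using I(1) by (subst AE_restrict_space_iff) auto
  then show "AE x in lebesgue_on ?I. rep_L2 f x = value_at f x"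
    using F(2)
  proof eventually_elim
    case (elim x)
    then show ?case using eq[of x] closure_subset[of ?I] by auto
  qed
qed

lemma value_at_continuous:
  "f \<in> H1 \<Longrightarrow> continuous_on (closure (interval_of TYPE('i))) (value_at (f :: 'i::connected_interval_index L2))"
  using primitive_on_continuous[OF is_interval_closure[OF is_interval_interval_of] closed_closure H1_value_at(1)] .

text \<open>The way back: explicit functions with explicit densities yield elements of \<^const>\<open>H1\<close> with
  the expected derivative and boundary values.\<close>

lemma H1_if_primitive:
  fixes f g :: "'i::connected_interval_index L2"
  assumes "primitive_on (closure (interval_of TYPE('i))) F G"
    and "AE x in lebesgue_on (interval_of TYPE('i)). rep_L2 f x = F x"
    and "AE x in lebesgue_on (interval_of TYPE('i)). rep_L2 g x = G x"
  shows "f \<in> H1" "weak_derivative f = g" "x \<in> closure (interval_of TYPE('i)) \<Longrightarrow> value_at f x = F x"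
proof -
  note I = open_interval_of[where 'a = 'i] is_interval_interval_of[where 'a = 'i]
  have cI: "is_interval (closure (interval_of TYPE('i)))" using I(2) by (rule is_interval_closure)
  have "AE x in lebesgue_on (interval_of TYPE('i)). G x = rep_L2 g x"
    using assms(3) by eventually_elim simp
  from primitive_on_AE_cong[OF assms(1) I this]
  have w: "has_weak_derivative f g" using assms(2) has_weak_derivative_iff by blast
  then show "f \<in> H1" "weak_derivative f = g"
    using weak_derivative_eqI by (auto simp: H1_def)
  show "value_at f x = F x" if "x \<in> closure (interval_of TYPE('i))"
    by (rule value_at_eqI[OF primitive_on_continuous[OF cI closed_closure assms(1)] assms(2) that])
qed

lemma
  fixes f g :: "'i::connected_interval_index L2"
  assumes f: "f \<in> H1" and g: "g \<in> H1"
  shows H1_diff: "f - g \<in> H1"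
    and weak_derivative_diff: "weak_derivative (f - g) = weak_derivative f - weak_derivative g"
    and value_at_diff: "x \<in> closure (interval_of TYPE('i)) \<Longrightarrow> value_at (f - g) x = value_at f x - value_at g x"
proof -
  have "AE x in lebesgue_on (interval_of TYPE('i)). rep_L2 (f - g) x = value_at f x - value_at g x"
    using rep_L2_diff[of f g] H1_value_at(2)[OF f] H1_value_at(2)[OF g] by eventually_elim simp
  note * = H1_if_primitive[OF primitive_on_diff[OF H1_value_at(1)[OF f] H1_value_at(1)[OF g]] this rep_L2_diff]
  show "f - g \<in> H1" "weak_derivative (f - g) = weak_derivative f - weak_derivative g"
    "x \<in> closure (interval_of TYPE('i)) \<Longrightarrow> value_at (f - g) x = value_at f x - value_at g x"
    using * by blast+
qed

lemma
  fixes f :: "'i::connected_interval_index L2"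
  assumes f: "f \<in> H1"
  shows H1_scaleC: "c *\<^sub>C f \<in> H1"
    and weak_derivative_scaleC: "weak_derivative (c *\<^sub>C f) = c *\<^sub>C weak_derivative f"
    and value_at_scaleC: "x \<in> closure (interval_of TYPE('i)) \<Longrightarrow> value_at (c *\<^sub>C f) x = c * value_at f x"
proof -
  have "AE x in lebesgue_on (interval_of TYPE('i)). rep_L2 (c *\<^sub>C f) x = c * value_at f x"
    using rep_L2_scaleC[of c f] H1_value_at(2)[OF f] by eventually_elim simp
  note * = H1_if_primitive[OF primitive_on_cmult[OF H1_value_at(1)[OF f]] this rep_L2_scaleC]
  show "c *\<^sub>C f \<in> H1" "weak_derivative (c *\<^sub>C f) = c *\<^sub>C weak_derivative f"
    "x \<in> closure (interval_of TYPE('i)) \<Longrightarrow> value_at (c *\<^sub>C f) x = c * value_at f x"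
    using * by blast+
qed

lemma H1_eq_zeroI:
  fixes f :: "'i::connected_interval_index L2"
  assumes f: "f \<in> H1" and z: "\<And>x. x \<in> closure (interval_of TYPE('i)) \<Longrightarrow> value_at f x = 0"
  shows "f = 0"
proof (rule L2_eqI)
  let ?I = "interval_of TYPE('i)"
  have "AE x in lebesgue_on ?I. x \<in> ?I"
    using open_interval_of[where 'a = 'i] by (subst AE_restrict_space_iff) auto
  then show "AE x in lebesgue_on ?I. rep_L2 f x = rep_L2 (0 :: 'i L2) x"
    using H1_value_at(2)[OF f] rep_L2_zero[where 'i = 'i]
  proof eventually_elim
    case (elim x)
    then show ?case using z[of x] closure_subset[of ?I] by auto
  qed
qed

lemma H1_primitive_AE:
  fixes f :: "'i::connected_interval_index L2"
  assumes f: "f \<in> H1"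
    and G: "AE x in lebesgue_on (interval_of TYPE('i)). rep_L2 (weak_derivative f) x = G x"
  shows "primitive_on (closure (interval_of TYPE('i))) (value_at f) G"
  by (rule primitive_on_AE_cong[OF H1_value_at(1)[OF f] open_interval_of is_interval_interval_of G])

lemma H1_eqI:
  fixes f g :: "'i::connected_interval_index L2"
  assumes f: "f \<in> H1" and g: "g \<in> H1" and d: "weak_derivative f = weak_derivative g"
    and x0: "x0 \<in> closure (interval_of TYPE('i))" "value_at f x0 = value_at g x0"
  shows "f = g"
proof -
  let ?J = "closure (interval_of TYPE('i))"
  have h: "f - g \<in> H1" using f g by (rule H1_diff)
  have "weak_derivative (f - g) = 0" using weak_derivative_diff[OF f g] d by simp
  then have P: "primitive_on ?J (value_at (f - g)) (\<lambda>x. 0)"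
    using rep_L2_zero[where 'i = 'i] by (intro H1_primitive_AE[OF h]) simp
  have "value_at (f - g) x = 0" if x: "x \<in> ?J" for x
  proof -
    have "value_at (f - g) x = value_at (f - g) x0"
      using primitive_onD(2)[OF P x x0(1)] primitive_onD(2)[OF P x0(1) x] by (cases "x \<le> x0") simp_all
    then show ?thesis using value_at_diff[OF f g x0(1)] x0(2) by simp
  qed
  then have "f - g = 0" by (rule H1_eq_zeroI[OF h])
  then show ?thesis by simp
qed

section \<open>Linear first-order equations and the energy estimate\<close>

lemma primitive_on_exp:
  assumes "is_interval S"
  shows "primitive_on S (\<lambda>x. exp (a * of_real x)) (\<lambda>x. a * exp (a * of_real x))"
proof (rule primitive_onI_DERIV[OF assms])
  show "continuous_on S (\<lambda>x. a * exp (a * of_real x))"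
    by (intro continuous_intros)
  show "((\<lambda>x. exp (a * of_real x)) has_vector_derivative a * exp (a * of_real x)) (at x within S)" for x
  proof -
    have "((\<lambda>z. exp (a * z)) has_field_derivative a * exp (a * of_real x)) (at (of_real x))"
      by (auto intro!: derivative_eq_intros)
    then have "((\<lambda>x. exp (a * of_real x)) has_vector_derivative a * exp (a * of_real x)) (at x)"
      by (rule has_vector_derivative_real_field)
    then show ?thesis by (rule has_vector_derivative_at_within)
  qed
qed

text \<open>The product rule for the exponential and \<open>c + R\<close>.\<close>

lemma primitive_on_variation_of_constants:
  assumes S: "is_interval S" "closed S" and R: "primitive_on S R (\<lambda>x. exp (- (a * of_real x)) * r x)"
  shows "primitive_on S (\<lambda>x. exp (a * of_real x) * (c + R x)) (\<lambda>x. a * (exp (a * of_real x) * (c + R x)) + r x)"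
proof -
  have R': "primitive_on S (\<lambda>x. c + R x) (\<lambda>x. exp (- (a * of_real x)) * r x)"
    using primitive_on_add_const[OF R, of c] by (simp add: add.commute)
  show ?thesis
    by (rule primitive_on_cong[OF primitive_on_mult[OF S primitive_on_exp[OF S(1), of a] R'] S(1)])
       (simp_all add: mult.assoc[symmetric] exp_add[symmetric])
qed

text \<open>The product of \<open>F\<close> with \<open>exp (- a x)\<close> has density \<open>0\<close>.\<close>

lemma primitive_on_homogeneous:
  assumes S: "is_interval S" "closed S" and F: "primitive_on S F (\<lambda>x. a * F x)"
  shows "\<exists>c. \<forall>x\<in>S. F x = c * exp (a * of_real x)"
proof -
  have P: "primitive_on S (\<lambda>x. exp (- a * of_real x) * F x) (\<lambda>x. 0)"
    by (rule primitive_on_cong[OF primitive_on_mult[OF S primitive_on_exp[OF S(1), of "- a"] F] S(1)])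
       (simp_all add: algebra_simps)
  have "\<exists>c. \<forall>x\<in>S. exp (- a * of_real x) * F x = c"
  proof (cases "S = {}")
    case False
    then obtain z where z: "z \<in> S" by blast
    have "exp (- a * of_real x) * F x = exp (- a * of_real z) * F z" if "x \<in> S" for x
      using primitive_onD(2)[OF P z that] primitive_onD(2)[OF P that z] by (cases "z \<le> x") simp_all
    then show ?thesis by blast
  qed simp
  then obtain c where c: "\<And>x. x \<in> S \<Longrightarrow> exp (- a * of_real x) * F x = c" by blast
  have "F x = c * exp (a * of_real x)" if "x \<in> S" for x
  proof -
    have "c * exp (a * of_real x) = (exp (- a * of_real x) * exp (a * of_real x)) * F x"
      unfolding c[OF that, symmetric] by (simp only: mult.assoc mult.commute mult.left_commute)
    then show ?thesis by (simp add: exp_add[symmetric])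
  qed
  then show ?thesis by blast
qed

lemma absolutely_integrable_exp_mult:
  fixes r :: "real \<Rightarrow> complex"
  assumes "r absolutely_integrable_on {x..y}"
  shows "(\<lambda>t. exp (- (a * of_real t)) * r t) absolutely_integrable_on {x..y}"
  by (intro absolutely_integrable_mult_continuous assms continuous_intros)

text \<open>The product rule for \<open>F\<close> and its complex conjugate.\<close>

lemma energy_identity:
  assumes T: "0 \<le> T" and F: "primitive_on {0..T} F G"
  shows "(\<lambda>x. 2 * Re (cnj (F x) * G x)) integrable_on {0..T}"
    and "(cmod (F T))\<^sup>2 - (cmod (F 0))\<^sup>2 = integral {0..T} (\<lambda>x. 2 * Re (cnj (F x) * G x))"
proof -
  have P: "primitive_on {0..T} (\<lambda>x. F x * cnj (F x)) (\<lambda>x. G x * cnj (F x) + F x * cnj (G x))"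
    using F by (intro primitive_on_mult primitive_on_cnj) (auto simp: is_interval_cc)
  have eq: "G x * cnj (F x) + F x * cnj (G x) = complex_of_real (2 * Re (cnj (F x) * G x))" for x
    by (simp add: complex_eq_iff algebra_simps)
  note D = primitive_onD[OF P, of 0 T, unfolded eq]
  have i: "(\<lambda>x. complex_of_real (2 * Re (cnj (F x) * G x))) integrable_on {0..T}"
    using D(1) T by (simp add: absolutely_integrable_on_def)
  then show ir: "(\<lambda>x. 2 * Re (cnj (F x) * G x)) integrable_on {0..T}"
    using integrable_linear[OF _ bounded_linear_Re] by (force simp: o_def)
  have "F T * cnj (F T) = F 0 * cnj (F 0) + complex_of_real (integral {0..T} (\<lambda>x. 2 * Re (cnj (F x) * G x)))"
    using D(2) T integral_linear[OF ir bounded_linear_of_real] by (simp add: o_def)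
  then have "complex_of_real ((cmod (F T))\<^sup>2) = complex_of_real ((cmod (F 0))\<^sup>2 + integral {0..T} (\<lambda>x. 2 * Re (cnj (F x) * G x)))"
    by (simp only: complex_norm_square of_real_add)
  then show "(cmod (F T))\<^sup>2 - (cmod (F 0))\<^sup>2 = integral {0..T} (\<lambda>x. 2 * Re (cnj (F x) * G x))"
    by (simp only: of_real_eq_iff)
qed

lemma Re_cnj_mult_bound:
  fixes z r a :: complex
  assumes "\<kappa> > 0"
  shows "\<bar>2 * Re (cnj z * (a * z + r)) - 2 * Re a * (cmod z)\<^sup>2\<bar> \<le> \<kappa> * (cmod z)\<^sup>2 + (cmod r)\<^sup>2 / \<kappa>"
proof -
  have "2 * Re (cnj z * (a * z + r)) - 2 * Re a * (cmod z)\<^sup>2 = 2 * Re (cnj z * r)"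
    unfolding cmod_power2 by (simp add: algebra_simps power2_eq_square)
  moreover have "\<bar>Re (cnj z * r)\<bar> \<le> cmod z * cmod r"
    using abs_Re_le_cmod[of "cnj z * r"] by (simp add: norm_mult)
  moreover have "2 * (cmod z * cmod r) \<le> \<kappa> * (cmod z)\<^sup>2 + (cmod r)\<^sup>2 / \<kappa>"
  proof -
    have "0 \<le> (\<kappa> * cmod z - cmod r)\<^sup>2 / \<kappa>" using assms by simp
    also have "\<dots> = \<kappa> * (cmod z)\<^sup>2 + (cmod r)\<^sup>2 / \<kappa> - 2 * (cmod z * cmod r)"
      using assms by (simp add: power2_eq_square field_simps)
    finally show ?thesis by simp
  qed
  ultimately show ?thesis by linarith
qed

text \<open>In the first case the term \<open>2 Re a (cmod F)\<^sup>2\<close> dissipates energy, in the second it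
  produces energy, which is then controlled from the right end point; in both cases half of it absorbs the mixed term
  with \<open>r\<close>.\<close>

lemma energy_estimate:
  assumes T: "0 \<le> T" and F: "primitive_on {0..T} F (\<lambda>x. a * F x + r x)" and \<kappa>: "\<kappa> > 0"
    and r: "(\<lambda>x. (cmod (r x))\<^sup>2) integrable_on {0..T}" "integral {0..T} (\<lambda>x. (cmod (r x))\<^sup>2) \<le> B"
  shows "Re a = - \<kappa> \<Longrightarrow> \<kappa> * integral {0..T} (\<lambda>x. (cmod (F x))\<^sup>2) \<le> (cmod (F 0))\<^sup>2 + B / \<kappa>"
    and "Re a = \<kappa> \<Longrightarrow> \<kappa> * integral {0..T} (\<lambda>x. (cmod (F x))\<^sup>2) \<le> (cmod (F T))\<^sup>2 + B / \<kappa>"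
proof -
  let ?E = "\<lambda>x. 2 * Re (cnj (F x) * (a * F x + r x))"
  note E = energy_identity[OF T F]
  have cF: "continuous_on {0..T} F"
    using F by (intro primitive_on_continuous) (auto simp: is_interval_cc)
  have iF: "(\<lambda>x. (cmod (F x))\<^sup>2) integrable_on {0..T}"
    by (intro integrable_continuous_interval continuous_intros cF)
  have B: "integral {0..T} (\<lambda>x. (cmod (r x))\<^sup>2) / \<kappa> \<le> B / \<kappa>"
    using r(2) \<kappa> by (simp add: divide_right_mono)
  have hi: "((\<lambda>x. \<kappa> * (cmod (F x))\<^sup>2) has_integral \<kappa> * integral {0..T} (\<lambda>x. (cmod (F x))\<^sup>2)) {0..T}"
    by (intro has_integral_mult_right integrable_integral iF)
  have hr: "((\<lambda>x. (cmod (r x))\<^sup>2 / \<kappa>) has_integral integral {0..T} (\<lambda>x. (cmod (r x))\<^sup>2) / \<kappa>) {0..T}"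
    by (intro has_integral_divide integrable_integral r)
  have hE: "(?E has_integral (cmod (F T))\<^sup>2 - (cmod (F 0))\<^sup>2) {0..T}"
    unfolding E(2) by (intro integrable_integral E(1))
  { assume a: "Re a = - \<kappa>"
    have "(cmod (F T))\<^sup>2 - (cmod (F 0))\<^sup>2 \<le> integral {0..T} (\<lambda>x. (cmod (r x))\<^sup>2) / \<kappa> - \<kappa> * integral {0..T} (\<lambda>x. (cmod (F x))\<^sup>2)"
    proof (rule has_integral_le[OF hE has_integral_diff[OF hr hi]])
      show "?E x \<le> (cmod (r x))\<^sup>2 / \<kappa> - \<kappa> * (cmod (F x))\<^sup>2" for x
        using Re_cnj_mult_bound[OF \<kappa>, of "F x" a "r x"] a by (simp add: abs_le_iff)
    qed
    then show "\<kappa> * integral {0..T} (\<lambda>x. (cmod (F x))\<^sup>2) \<le> (cmod (F 0))\<^sup>2 + B / \<kappa>"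
      using B zero_le_power2[of "cmod (F T)"] by linarith }
  { assume a: "Re a = \<kappa>"
    have "\<kappa> * integral {0..T} (\<lambda>x. (cmod (F x))\<^sup>2) - integral {0..T} (\<lambda>x. (cmod (r x))\<^sup>2) / \<kappa> \<le> (cmod (F T))\<^sup>2 - (cmod (F 0))\<^sup>2"
    proof (rule has_integral_le[OF has_integral_diff[OF hi hr] hE])
      show "\<kappa> * (cmod (F x))\<^sup>2 - (cmod (r x))\<^sup>2 / \<kappa> \<le> ?E x" for x
        using Re_cnj_mult_bound[OF \<kappa>, of "F x" a "r x"] a by (simp add: abs_le_iff)
    qed
    then show "\<kappa> * integral {0..T} (\<lambda>x. (cmod (F x))\<^sup>2) \<le> (cmod (F T))\<^sup>2 + B / \<kappa>"
      using B zero_le_power2[of "cmod (F 0)"] by linarith }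
qed

lemma Cauchy_Schwarz_integral:
  fixes f g :: "'a \<Rightarrow> real"
  assumes [measurable]: "f \<in> borel_measurable M" "g \<in> borel_measurable M"
    and f: "integrable M (\<lambda>x. (f x)\<^sup>2)" and g: "integrable M (\<lambda>x. (g x)\<^sup>2)"
  shows "integrable M (\<lambda>x. f x * g x)"
    and "(\<integral>x. f x * g x \<partial>M)\<^sup>2 \<le> (\<integral>x. (f x)\<^sup>2 \<partial>M) * (\<integral>x. (g x)\<^sup>2 \<partial>M)"
proof -
  show fg: "integrable M (\<lambda>x. f x * g x)"
  proof (rule Bochner_Integration.integrable_bound[OF Bochner_Integration.integrable_add[OF f g]])
    have "\<bar>f x * g x\<bar> \<le> (f x)\<^sup>2 + (g x)\<^sup>2" for x
      using sum_squares_bound[of "\<bar>f x\<bar>" "\<bar>g x\<bar>"] abs_ge_zero[of "f x * g x"]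
      unfolding power2_abs abs_mult by linarith
    then show "AE x in M. norm (f x * g x) \<le> norm ((f x)\<^sup>2 + (g x)\<^sup>2)"
      by (intro AE_I2) simp
  qed simp
  define A B C where "A = (\<integral>x. (f x)\<^sup>2 \<partial>M)" and "B = (\<integral>x. f x * g x \<partial>M)" and "C = (\<integral>x. (g x)\<^sup>2 \<partial>M)"
  \<comment> \<open>The integral of \<open>(f + t g)\<^sup>2\<close> is a nonnegative quadratic polynomial in \<open>t\<close>.\<close>
  have quad: "0 \<le> A + 2 * t * B + t\<^sup>2 * C" for t
  proof -
    have "0 \<le> (\<integral>x. (f x + t * g x)\<^sup>2 \<partial>M)"
      by (intro integral_nonneg_AE) simp
    also have "\<dots> = (\<integral>x. ((f x)\<^sup>2 + (2 * t) * (f x * g x)) + t\<^sup>2 * (g x)\<^sup>2 \<partial>M)"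
      by (intro Bochner_Integration.integral_cong) (simp_all add: power2_eq_square algebra_simps)
    also have "\<dots> = A + 2 * t * B + t\<^sup>2 * C"
      using f g fg by (simp add: A_def B_def C_def)
    finally show ?thesis .
  qed
  have C0: "0 \<le> C" unfolding C_def by (intro integral_nonneg_AE) simp
  show "B\<^sup>2 \<le> A * C"
  proof (cases "C = 0")
    case True
    have "B = 0"
    proof (rule ccontr)
      assume "B \<noteq> 0"
      \<comment> \<open>At this \<open>t\<close> the polynomial, now affine, has the value \<open>-1\<close>.\<close>
      then have "2 * (- (A + 1) / (2 * B)) * B = - (A + 1)" by simp
      then show False using quad[of "- (A + 1) / (2 * B)"] True by simp
    qed
    then show ?thesis using True by simp
  next
    case False
    then have C: "C > 0" using C0 by simp
    have "0 \<le> A + 2 * (- B / C) * B + (- B / C)\<^sup>2 * C" by (rule quad)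
    also have "\<dots> = A - B\<^sup>2 / C" using C by (simp add: power2_eq_square field_simps)
    finally have "B\<^sup>2 / C \<le> A" by simp
    then show ?thesis using C by (simp add: pos_divide_le_eq)
  qed
qed

lemma Cauchy_Schwarz_interval:
  fixes f g :: "real \<Rightarrow> real"
  assumes f: "continuous_on {x..y} f" and g: "continuous_on {x..y} g"
  shows "(integral {x..y} (\<lambda>t. f t * g t))\<^sup>2 \<le> integral {x..y} (\<lambda>t. (f t)\<^sup>2) * integral {x..y} (\<lambda>t. (g t)\<^sup>2)"
proof -
  have i: "integrable (lebesgue_on {x..y}) h" "integral\<^sup>L (lebesgue_on {x..y}) h = integral {x..y} h"
    if "continuous_on {x..y} h" for h :: "real \<Rightarrow> real"
    using continuous_imp_integrable_real[OF that] lebesgue_integral_eq_integral[of "{x..y}" h] by auto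
  have c: "continuous_on {x..y} (\<lambda>t. (f t)\<^sup>2)" "continuous_on {x..y} (\<lambda>t. (g t)\<^sup>2)" "continuous_on {x..y} (\<lambda>t. f t * g t)"
    by (intro continuous_intros f g)+
  show ?thesis
    using Cauchy_Schwarz_integral(2)[of f "lebesgue_on {x..y}" g] i[OF f] i[OF g] i[OF c(1)] i[OF c(2)] i[OF c(3)]
    by auto
qed

lemma has_integral_exp_decay:
  fixes \<kappa> :: real
  assumes "\<kappa> > 0" "x \<le> y"
  shows "((\<lambda>t. (exp (- (\<kappa> * t)))\<^sup>2) has_integral (exp (- (2 * \<kappa> * x)) - exp (- (2 * \<kappa> * y))) / (2 * \<kappa>)) {x..y}"
proof -
  have "((\<lambda>t. exp (- (2 * \<kappa> * t))) has_integral - exp (- (2 * \<kappa> * y)) / (2 * \<kappa>) - - exp (- (2 * \<kappa> * x)) / (2 * \<kappa>)) {x..y}"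
  proof (rule fundamental_theorem_of_calculus[OF assms(2)])
    fix t
    have "((\<lambda>t. - exp (- (2 * \<kappa> * t)) / (2 * \<kappa>)) has_real_derivative exp (- (2 * \<kappa> * t))) (at t within {x..y})"
      using assms by (auto intro!: derivative_eq_intros)
    then show "((\<lambda>t. - exp (- (2 * \<kappa> * t)) / (2 * \<kappa>)) has_vector_derivative exp (- (2 * \<kappa> * t))) (at t within {x..y})"
      by (simp add: has_real_derivative_iff_has_vector_derivative)
  qed
  moreover have "(exp (- (\<kappa> * t)))\<^sup>2 = exp (- (2 * \<kappa> * t))" for t
    unfolding power2_eq_square exp_add[symmetric] by simp
  ultimately show ?thesis
    by (simp add: diff_divide_distrib)
qed

section \<open>The wave part as a transport system\<close>

text \<open>With \<open>p = u'\<close> the wave equation becomes the first-order system of the conclusion. The Riemann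
  invariants \<open>v + p\<close> and \<open>v - p\<close> solve the scalar equations with coefficients
  \<open>\<plusminus> \<i> s\<close>, whose exponentials have modulus one; this is why the bound does not depend on
  \<open>s\<close>. The condition \<open>v (-1) = 0\<close> leaves the single parameter \<open>c = p (-1)\<close>,
  while \<open>A\<close> and \<open>B\<close> collect the contribution of the data at the interface.\<close>

lemma wave_first_order_system_solution:
  fixes \<phi> g :: "real \<Rightarrow> complex" and s :: real
  assumes \<phi>: "\<phi> absolutely_integrable_on {-1..0}" and g: "g absolutely_integrable_on {-1..0}"
  defines "M \<equiv> integral {-1..0} (\<lambda>x. cmod (\<phi> x)) + integral {-1..0} (\<lambda>x. cmod (g x))"
  obtains A B where "cmod A \<le> M" "cmod B \<le> M"
    "\<And>c. \<exists>v p. primitive_on {-1..0} v (\<lambda>x. \<i> * of_real s * p x - \<phi> x) \<and>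
       primitive_on {-1..0} p (\<lambda>x. \<i> * of_real s * v x - g x) \<and> v (-1) = 0 \<and>
       v 0 = \<i> * c * of_real (sin s) - (A + B) / 2 \<and> p 0 = c * of_real (cos s) - (A - B) / 2 \<and>
       (\<forall>x\<in>{-1..0}. cmod (v x) \<le> cmod c + M \<and> cmod (p x) \<le> cmod c + M)"
proof -
  let ?S = "{-1..0 :: real}"
  have S: "is_interval ?S" "closed ?S" by (simp_all add: is_interval_cc)
  define a where "a = \<i> * complex_of_real s"
  have norm_exp: "cmod (exp (a * of_real x)) = 1" "cmod (exp (- (a * of_real x))) = 1" for x
    by (simp_all add: a_def)
  define GA where "GA t = exp (- (a * of_real t)) * - (\<phi> t + g t)" for t
  define GB where "GB t = exp (- (- a * of_real t)) * - (\<phi> t - g t)" for t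
  have G: "GA absolutely_integrable_on ?S" "GB absolutely_integrable_on ?S"
  proof -
    have 1: "(\<lambda>t. - (\<phi> t + g t)) absolutely_integrable_on ?S"
      using set_integral_add(1)[OF \<phi> g]
      unfolding set_integrable_def scaleR_minus_right by (rule Bochner_Integration.integrable_minus)
    have 2: "(\<lambda>t. - (\<phi> t - g t)) absolutely_integrable_on ?S"
      using set_integral_diff(1)[OF \<phi> g]
      unfolding set_integrable_def scaleR_minus_right by (rule Bochner_Integration.integrable_minus)
    show "GA absolutely_integrable_on ?S"
      unfolding GA_def[abs_def] using 1 by (rule absolutely_integrable_exp_mult)
    show "GB absolutely_integrable_on ?S"
      unfolding GB_def[abs_def] using 2 by (rule absolutely_integrable_exp_mult)
  qed
  have nGA: "cmod (GA t) \<le> cmod (\<phi> t) + cmod (g t)" for t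
    unfolding GA_def norm_mult norm_exp norm_minus_cancel mult_1_left by (rule norm_triangle_ineq)
  have nGB: "cmod (GB t) \<le> cmod (\<phi> t) + cmod (g t)" for t
    unfolding GB_def norm_mult mult_minus_left minus_minus norm_exp norm_minus_cancel mult_1_left by (rule norm_triangle_ineq4)
  have sub: "GA absolutely_integrable_on {-1..x}" "GB absolutely_integrable_on {-1..x}" if "x \<in> ?S" for x
    using that by (auto intro: absolutely_integrable_on_subinterval[OF G(1)] absolutely_integrable_on_subinterval[OF G(2)])
  define RA where "RA x = integral {-1..x} GA" for x
  define RB where "RB x = integral {-1..x} GB" for x
  have PA: "primitive_on ?S RA GA" and PB: "primitive_on ?S RB GB"
    unfolding RA_def RB_def using sub by (auto intro!: primitive_on_integral_from S)
  have i: "(\<lambda>x. cmod (\<phi> x)) integrable_on ?S" "(\<lambda>x. cmod (g x)) integrable_on ?S"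
    using \<phi> g by (auto simp: absolutely_integrable_on_def)
  have bound: "cmod (integral {-1..x} G') \<le> M"
    if x: "x \<in> ?S" and G': "G' absolutely_integrable_on {-1..x}" "\<And>t. cmod (G' t) \<le> cmod (\<phi> t) + cmod (g t)"
    for x and G' :: "real \<Rightarrow> complex"
  proof -
    have i': "(\<lambda>t. cmod (\<phi> t) + cmod (g t)) integrable_on {-1..x}"
      using x by (intro integrable_on_subinterval[OF Henstock_Kurzweil_Integration.integrable_add[OF i]]) auto
    have "cmod (integral {-1..x} G') \<le> integral {-1..x} (\<lambda>t. cmod (\<phi> t) + cmod (g t))"
      using G' i' by (intro integral_norm_bound_integral) (auto simp: absolutely_integrable_on_def)
    also have "\<dots> \<le> integral ?S (\<lambda>t. cmod (\<phi> t) + cmod (g t))"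
      using x by (intro integral_subset_le i' Henstock_Kurzweil_Integration.integrable_add i) auto
    also have "\<dots> = M"
      unfolding M_def using i by (rule Henstock_Kurzweil_Integration.integral_add)
    finally show ?thesis .
  qed
  have bA: "cmod (RA x) \<le> M" if "x \<in> ?S" for x
    unfolding RA_def by (rule bound[OF that sub(1)[OF that] nGA])
  have bB: "cmod (RB x) \<le> M" if "x \<in> ?S" for x
    unfolding RB_def by (rule bound[OF that sub(2)[OF that] nGB])
  show thesis
  proof (rule that[of "- RA 0" "- RB 0"])
    show "cmod (- RA 0) \<le> M" "cmod (- RB 0) \<le> M" using bA[of 0] bB[of 0] by simp_all
    fix c :: complex
    \<comment> \<open>The Riemann invariants \<open>v + p\<close> and \<open>v - p\<close>, with values \<open>c\<close> and \<open>- c\<close> at \<open>-1\<close>.\<close>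
    define al where "al x = exp (a * of_real x) * (c * exp a + RA x)" for x
    define be where "be x = exp (- a * of_real x) * (- c * exp (- a) + RB x)" for x
    have Pal: "primitive_on ?S al (\<lambda>x. a * al x + - (\<phi> x + g x))"
      unfolding al_def by (rule primitive_on_variation_of_constants[OF S]) (use PA in \<open>simp add: GA_def[abs_def]\<close>)
    have Pbe: "primitive_on ?S be (\<lambda>x. - a * be x + - (\<phi> x - g x))"
      unfolding be_def by (rule primitive_on_variation_of_constants[OF S]) (use PB in \<open>simp add: GB_def[abs_def]\<close>)
    define v where "v x = (1 / 2) * (al x + be x)" for x
    define p where "p x = (1 / 2) * (al x - be x)" for x
    have Pv: "primitive_on ?S v (\<lambda>x. a * p x - \<phi> x)"
      unfolding v_def p_def
      by (rule primitive_on_cong[OF primitive_on_cmult[OF primitive_on_add[OF Pal Pbe], of "1 / 2"] S(1)])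
         (simp_all add: field_simps)
    have Pp: "primitive_on ?S p (\<lambda>x. a * v x - g x)"
      unfolding v_def p_def
      by (rule primitive_on_cong[OF primitive_on_cmult[OF primitive_on_diff[OF Pal Pbe], of "1 / 2"] S(1)])
         (simp_all add: field_simps)
    have R0: "RA (-1) = 0" "RB (-1) = 0" by (simp_all add: RA_def RB_def)
    have v1: "v (-1) = 0"
      by (simp add: v_def al_def be_def R0 exp_minus)
    have eul: "exp a = of_real (cos s) + \<i> * of_real (sin s)" "exp (- a) = of_real (cos s) - \<i> * of_real (sin s)"
      using exp_Euler[of "of_real s"] exp_Euler[of "of_real (- s)"]
      by (simp_all add: a_def cos_of_real sin_of_real)
    have v0: "v 0 = \<i> * c * of_real (sin s) - (- RA 0 + - RB 0) / 2"
      and p0: "p 0 = c * of_real (cos s) - (- RA 0 - - RB 0) / 2"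
      by (simp_all add: v_def p_def al_def be_def eul field_simps)
    have ab: "cmod (al x) \<le> cmod c + M" "cmod (be x) \<le> cmod c + M" if "x \<in> ?S" for x
    proof -
      have "cmod (al x) = cmod (c * exp a + RA x)"
        unfolding al_def by (simp only: norm_mult norm_exp mult_1_left)
      also have "\<dots> \<le> cmod (c * exp a) + cmod (RA x)" by (rule norm_triangle_ineq)
      also have "cmod (c * exp a) = cmod c" using norm_exp(1)[of 1] by (simp only: norm_mult of_real_1 mult_1_right)
      finally show "cmod (al x) \<le> cmod c + M" using bA[OF that] by linarith
      have "cmod (be x) = cmod (- c * exp (- a) + RB x)"
        unfolding be_def by (simp only: norm_mult mult_minus_left norm_exp mult_1_left)
      also have "\<dots> \<le> cmod (- c * exp (- a)) + cmod (RB x)" by (rule norm_triangle_ineq)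
      also have "cmod (- c * exp (- a)) = cmod c"
        using norm_exp(2)[of 1] by (simp only: norm_mult of_real_1 mult_1_right norm_minus_cancel)
      finally show "cmod (be x) \<le> cmod c + M" using bB[OF that] by linarith
    qed
    have vp: "cmod (v x) \<le> cmod c + M" "cmod (p x) \<le> cmod c + M" if "x \<in> ?S" for x
      using ab[OF that] norm_triangle_ineq[of "al x" "be x"] norm_triangle_ineq4[of "al x" "be x"]
      by (simp_all add: v_def p_def norm_divide)
    show "\<exists>v p. primitive_on {-1..0} v (\<lambda>x. \<i> * of_real s * p x - \<phi> x) \<and>
       primitive_on {-1..0} p (\<lambda>x. \<i> * of_real s * v x - g x) \<and> v (-1) = 0 \<and>
       v 0 = \<i> * c * of_real (sin s) - (- RA 0 + - RB 0) / 2 \<and> p 0 = c * of_real (cos s) - (- RA 0 - - RB 0) / 2 \<and>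
       (\<forall>x\<in>{-1..0}. cmod (v x) \<le> cmod c + M \<and> cmod (p x) \<le> cmod c + M)"
      using Pv Pp v1 v0 p0 vp unfolding a_def by (intro exI[of _ v] exI[of _ p]) blast
  qed
qed

lemma closure_wave: "closure (interval_of TYPE(wave)) = {-1..0}"
  by (simp add: interval_of_wave_def)

text \<open>Cauchy--Schwarz against the constant \<open>1\<close> on an interval of length one.\<close>

lemma integral_cmod_le_L2_norm:
  fixes f :: "wave L2"
  shows "integral {-1..0} (\<lambda>x. cmod (rep_L2 f x)) \<le> norm f"
proof -
  let ?M = "lebesgue_on {-1<..<0 :: real}"
  have f: "square_integrable {-1<..<0} (rep_L2 f)"
    using square_integrable_rep_L2[of f] by (simp add: interval_of_wave_def)
  then have m: "(\<lambda>x. cmod (rep_L2 f x)) \<in> borel_measurable ?M" "integrable ?M (\<lambda>x. (cmod (rep_L2 f x))\<^sup>2)"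
    by (auto simp: square_integrable_def)
  have one: "integrable ?M (\<lambda>x. 1\<^sup>2 :: real)" "(\<integral>x. 1\<^sup>2 \<partial>?M) = (1 :: real)"
    by (simp_all add: measure_restrict_space integrable_restrict_space)
  note CS = Cauchy_Schwarz_integral[OF m(1) _ m(2) one(1)]
  have "integral {-1..0} (\<lambda>x. cmod (rep_L2 f x)) = integral {-1<..<0} (\<lambda>x. cmod (rep_L2 f x))"
    by (simp add: integral_open_interval_real)
  also have "\<dots> = (\<integral>x. cmod (rep_L2 f x) * 1 \<partial>?M)"
    using CS(1) by (subst lebesgue_integral_eq_integral) simp_all
  finally have "(integral {-1..0} (\<lambda>x. cmod (rep_L2 f x)))\<^sup>2 \<le> (norm f)\<^sup>2"
    using CS(2) one(2) norm_rep_L2[of f] by (simp add: interval_of_wave_def)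
  then show ?thesis by (rule power2_le_imp_le) simp
qed

lemma wave_L2_bounded:
  fixes F :: "real \<Rightarrow> complex"
  assumes F: "continuous_on {-1..0} F" and K: "\<And>x. x \<in> {-1..0} \<Longrightarrow> cmod (F x) \<le> K"
  shows "square_integrable (interval_of TYPE(wave)) F" "norm (abs_L2 F :: wave L2) \<le> K"
proof -
  let ?M = "lebesgue_on {-1<..<0 :: real}"
  have K0: "0 \<le> K" by (rule order_trans[OF norm_ge_zero K[of 0]]) simp
  have c: "continuous_on {-1<..<0} F" by (rule continuous_on_subset[OF F]) auto
  have m: "F \<in> borel_measurable ?M"
    by (rule continuous_imp_measurable_on_sets_lebesgue[OF c]) simp
  have one: "integrable ?M (\<lambda>x. K\<^sup>2)" "(\<integral>x. K\<^sup>2 \<partial>?M) = K\<^sup>2"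
    by (simp_all add: measure_restrict_space integrable_restrict_space)
  have le: "(cmod (F x))\<^sup>2 \<le> K\<^sup>2" if "x \<in> space ?M" for x
    using that K[of x] by (intro power_mono) auto
  have i: "integrable ?M (\<lambda>x. (cmod (F x))\<^sup>2)"
  proof (rule Bochner_Integration.integrable_bound[OF one(1)])
    show "(\<lambda>x. (cmod (F x))\<^sup>2) \<in> borel_measurable ?M" using m by measurable
    show "AE x in ?M. norm ((cmod (F x))\<^sup>2) \<le> norm (K\<^sup>2)" using le by (intro AE_I2) simp
  qed
  then show sq: "square_integrable (interval_of TYPE(wave)) F"
    using m by (simp add: square_integrable_def interval_of_wave_def)
  have "(norm (abs_L2 F :: wave L2))\<^sup>2 = (\<integral>x. (cmod (F x))\<^sup>2 \<partial>?M)"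
    using norm_abs_L2[OF sq] by (simp add: interval_of_wave_def)
  also have "\<dots> \<le> (\<integral>x. K\<^sup>2 \<partial>?M)" by (intro integral_mono i one le)
  also have "\<dots> = K\<^sup>2" by (rule one)
  finally show "norm (abs_L2 F :: wave L2) \<le> K" using K0 by (rule power2_le_imp_le)
qed

section \<open>The heat equation on the half line\<close>

lemma closure_heat: "closure (interval_of TYPE(heat)) = {0..}"
  by (simp add: interval_of_heat_def)

text \<open>The operator \<open>w'' - k\<^sup>2 w\<close> factors into two first-order operators. This is the factor
  that is stable to the right; the energy estimate bounds its solution.\<close>

lemma heat_decaying_solution:
  fixes h :: "real \<Rightarrow> complex"
  assumes \<kappa>: "Re k > 0"
    and h: "\<And>T. h absolutely_integrable_on {0..T}"
      "\<And>T. (\<lambda>x. (cmod (h x))\<^sup>2) integrable_on {0..T}" "\<And>T. integral {0..T} (\<lambda>x. (cmod (h x))\<^sup>2) \<le> B"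
  obtains Z where "primitive_on {0..} Z (\<lambda>x. - k * Z x - h x)" "Z 0 = 0"
    "\<And>T. 0 \<le> T \<Longrightarrow> (Re k)\<^sup>2 * integral {0..T} (\<lambda>x. (cmod (Z x))\<^sup>2) \<le> B"
proof -
  have S: "is_interval {0::real..}" "closed {0::real..}" by (simp_all add: is_interval_ci)
  define G where "G t = exp (- (- k * of_real t)) * - h t" for t
  have G: "G absolutely_integrable_on {0..T}" for T
  proof -
    have "(\<lambda>t. - h t) absolutely_integrable_on {0..T}"
      using h(1) unfolding set_integrable_def scaleR_minus_right by (rule Bochner_Integration.integrable_minus)
    then show ?thesis unfolding G_def[abs_def] by (rule absolutely_integrable_exp_mult)
  qed
  define R where "R x = integral {0..x} G" for x
  have R: "primitive_on {0..} R G"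
    unfolding R_def by (intro primitive_on_integral_from S G) auto
  define Z where "Z x = exp (- k * of_real x) * (0 + R x)" for x
  have PZ: "primitive_on {0..} Z (\<lambda>x. - k * Z x + - h x)"
    unfolding Z_def by (rule primitive_on_variation_of_constants[OF S]) (use R in \<open>simp add: G_def[abs_def]\<close>)
  show thesis
  proof
    show "primitive_on {0..} Z (\<lambda>x. - k * Z x - h x)"
      using PZ by simp
    show Z0: "Z 0 = 0" by (simp add: Z_def R_def)
    fix T :: real assume T: "0 \<le> T"
    have "primitive_on {0..T} Z (\<lambda>x. - k * Z x + - h x)"
      by (rule primitive_on_subset[OF PZ]) auto
    from energy_estimate(1)[OF T this \<kappa>, of B] h Z0
    have "Re k * integral {0..T} (\<lambda>x. (cmod (Z x))\<^sup>2) \<le> B / Re k" by simp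
    then show "(Re k)\<^sup>2 * integral {0..T} (\<lambda>x. (cmod (Z x))\<^sup>2) \<le> B"
      using \<kappa> by (simp add: power2_eq_square pos_le_divide_eq mult_ac)
  qed
qed

text \<open>The other factor is stable to the left: the solution is minus the integral of \<open>exp (- k (t - x)) * Z
  t\<close> over \<open>t \<ge> x\<close>. By the Cauchy--Schwarz inequality the integral converges and is bounded, so
  the energy estimate from the right end point applies with a bound that is uniform in \<open>T\<close>.\<close>

lemma heat_backward_solution:
  fixes Z :: "real \<Rightarrow> complex"
  assumes \<kappa>: "Re k > 0" and Z: "continuous_on {0..} Z"
    and B: "\<And>T. 0 \<le> T \<Longrightarrow> integral {0..T} (\<lambda>x. (cmod (Z x))\<^sup>2) \<le> B"
  obtains W where "primitive_on {0..} W (\<lambda>x. k * W x + Z x)"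
    "\<And>x. 0 \<le> x \<Longrightarrow> (cmod (W x))\<^sup>2 \<le> B / (2 * Re k)"
    "\<And>T. 0 \<le> T \<Longrightarrow> (Re k)\<^sup>2 * integral {0..T} (\<lambda>x. (cmod (W x))\<^sup>2) \<le> 2 * B"
proof -
  have S: "is_interval {0::real..}" "closed {0::real..}" by (simp_all add: is_interval_ci)
  have cZ: "continuous_on {x..y} Z" if "0 \<le> x" for x y
    using that by (intro continuous_on_subset[OF Z]) auto
  define G where "G t = exp (- (k * of_real t)) * Z t" for t
  have cG: "continuous_on {x..y} G" if "0 \<le> x" for x y
    unfolding G_def by (intro continuous_intros cZ that)
  define E where "E x = integral {0..x} G" for x
  have PE: "primitive_on {0..} E G"
    unfolding E_def by (intro primitive_on_integral_from S absolutely_integrable_continuous_real cG) auto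
  define D where "D x = exp (- (2 * Re k * x)) * (B / (2 * Re k))" for x
  have B0: "0 \<le> B" using B[of 0] by simp
  have tail: "(cmod (E y - E x))\<^sup>2 \<le> D x" if xy: "0 \<le> x" "x \<le> y" for x y
  proof -
    have c: "continuous_on {x..y} (\<lambda>t. exp (- (Re k * t)))" "continuous_on {x..y} (\<lambda>t. cmod (Z t))"
      by (intro continuous_intros cZ xy)+
    have "cmod (E y - E x) = cmod (integral {x..y} G)"
      using primitive_onD(2)[OF PE, of x y] xy by simp
    also have "\<dots> \<le> integral {x..y} (\<lambda>t. exp (- (Re k * t)) * cmod (Z t))"
    proof (rule integral_norm_bound_integral)
      show "G integrable_on {x..y}" "(\<lambda>t. exp (- (Re k * t)) * cmod (Z t)) integrable_on {x..y}"
        by (intro integrable_continuous_interval cG xy continuous_intros cZ)+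
    qed (simp add: G_def norm_mult)
    finally have "(cmod (E y - E x))\<^sup>2 \<le> (integral {x..y} (\<lambda>t. exp (- (Re k * t)) * cmod (Z t)))\<^sup>2"
      by (intro power_mono) simp_all
    also have "\<dots> \<le> integral {x..y} (\<lambda>t. (exp (- (Re k * t)))\<^sup>2) * integral {x..y} (\<lambda>t. (cmod (Z t))\<^sup>2)"
      by (rule Cauchy_Schwarz_interval[OF c])
    also have "\<dots> \<le> (exp (- (2 * Re k * x)) / (2 * Re k)) * B"
    proof (rule mult_mono)
      show "integral {x..y} (\<lambda>t. (exp (- (Re k * t)))\<^sup>2) \<le> exp (- (2 * Re k * x)) / (2 * Re k)"
        unfolding integral_unique[OF has_integral_exp_decay[OF \<kappa> xy(2)]]
        using \<kappa> by (intro divide_right_mono) simp_all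
      have "integral {x..y} (\<lambda>t. (cmod (Z t))\<^sup>2) \<le> integral {0..y} (\<lambda>t. (cmod (Z t))\<^sup>2)"
        using xy by (intro integral_subset_le integrable_continuous_interval continuous_intros cZ) auto
      also have "\<dots> \<le> B" using B xy by simp
      finally show "integral {x..y} (\<lambda>t. (cmod (Z t))\<^sup>2) \<le> B" .
      show "0 \<le> exp (- (2 * Re k * x)) / (2 * Re k)" using \<kappa> by simp
      show "0 \<le> integral {x..y} (\<lambda>t. (cmod (Z t))\<^sup>2)"
        using xy by (intro Henstock_Kurzweil_Integration.integral_nonneg integrable_continuous_interval continuous_intros cZ) auto
    qed
    finally show ?thesis by (simp add: D_def)
  qed
  have Dlim: "(\<lambda>n. D (real n)) \<longlonglongrightarrow> 0"
  proof -
    have "(\<lambda>n. exp (- (2 * Re k)) ^ n * (B / (2 * Re k))) \<longlonglongrightarrow> 0 * (B / (2 * Re k))"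
      using \<kappa> by (intro tendsto_intros LIMSEQ_power_zero) simp
    moreover have "exp (- (2 * Re k)) ^ n * (B / (2 * Re k)) = D (real n)" for n
      unfolding D_def exp_of_nat_mult[symmetric] by (simp add: mult_ac)
    ultimately show ?thesis by simp
  qed
  \<comment> \<open>The limit \<open>L\<close> plays the part of the improper integral of \<open>G\<close> over the half line.\<close>
  have "Cauchy (\<lambda>n. E (real n))"
  proof (rule metric_CauchyI)
    fix e :: real assume e: "0 < e"
    then have "\<forall>\<^sub>F n in sequentially. D (real n) < (e / 2)\<^sup>2"
      by (intro order_tendstoD(2)[OF Dlim]) simp
    then obtain n0 where n0: "D (real n0) < (e / 2)\<^sup>2"
      unfolding eventually_sequentially by (meson order_refl)
    have *: "cmod (E (real n) - E (real n0)) < e / 2" if "n \<ge> n0" for n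
    proof -
      have "(cmod (E (real n) - E (real n0)))\<^sup>2 < (e / 2)\<^sup>2"
        using tail[of "real n0" "real n"] that n0 by simp
      then show ?thesis by (rule power_less_imp_less_base) (use e in simp)
    qed
    have "dist (E (real m)) (E (real n)) < e" if "m \<ge> n0" "n \<ge> n0" for m n
    proof (rule dist_triangle_half_l)
      show "dist (E (real m)) (E (real n0)) < e / 2" "dist (E (real n)) (E (real n0)) < e / 2"
        using *[OF that(1)] *[OF that(2)] by (simp_all only: dist_norm)
    qed
    then show "\<exists>M. \<forall>m\<ge>M. \<forall>n\<ge>M. dist (E (real m)) (E (real n)) < e" by blast
  qed
  then have "convergent (\<lambda>n. E (real n))" by (simp only: Cauchy_convergent_iff)
  then obtain L where L: "(\<lambda>n. E (real n)) \<longlonglongrightarrow> L"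
    unfolding convergent_def ..
  have tailL: "(cmod (L - E x))\<^sup>2 \<le> D x" if "0 \<le> x" for x
  proof (rule LIMSEQ_le_const2)
    show "(\<lambda>n. (cmod (E (real n) - E x))\<^sup>2) \<longlonglongrightarrow> (cmod (L - E x))\<^sup>2"
      by (intro tendsto_intros L)
    obtain n0 where "x \<le> real n0" using real_arch_simple by blast
    then have "x \<le> real n" if "n0 \<le> n" for n
      using that by (meson of_nat_le_iff order_trans)
    then show "\<exists>N. \<forall>n\<ge>N. (cmod (E (real n) - E x))\<^sup>2 \<le> D x"
      using tail[OF that] by blast
  qed
  define W where "W x = exp (k * of_real x) * (- L + E x)" for x
  have PW: "primitive_on {0..} W (\<lambda>x. k * W x + Z x)"
    unfolding W_def by (rule primitive_on_variation_of_constants[OF S]) (use PE in \<open>simp add: G_def[abs_def]\<close>)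
  have bW: "(cmod (W x))\<^sup>2 \<le> B / (2 * Re k)" if x: "0 \<le> x" for x
  proof -
    have "cmod (- L + E x) = cmod (L - E x)" by (simp add: norm_minus_commute)
    then have "(cmod (W x))\<^sup>2 = (exp (Re k * x))\<^sup>2 * (cmod (L - E x))\<^sup>2"
      by (simp add: W_def norm_mult power_mult_distrib)
    also have "\<dots> \<le> (exp (Re k * x))\<^sup>2 * D x"
      by (intro mult_left_mono tailL x) simp
    also have "\<dots> = (exp (Re k * x) * exp (Re k * x) * exp (- (2 * Re k * x))) * (B / (2 * Re k))"
      by (simp only: D_def power2_eq_square mult.assoc)
    also have "\<dots> = B / (2 * Re k)"
      by (simp only: exp_add[symmetric]) simp
    finally show ?thesis .
  qed
  show thesis
  proof (rule that[OF PW bW])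
    fix T :: real assume T: "0 \<le> T"
    have P: "primitive_on {0..T} W (\<lambda>x. k * W x + Z x)"
      by (rule primitive_on_subset[OF PW]) auto
    have "Re k * integral {0..T} (\<lambda>x. (cmod (W x))\<^sup>2) \<le> (cmod (W T))\<^sup>2 + B / Re k"
    proof (rule energy_estimate(2)[OF T P \<kappa> _ B[OF T] refl])
      show "(\<lambda>x. (cmod (Z x))\<^sup>2) integrable_on {0..T}"
        by (intro integrable_continuous_interval continuous_intros cZ order_refl)
    qed
    also have "\<dots> \<le> B / (2 * Re k) + B / Re k" using bW[OF T] by simp
    also have "\<dots> \<le> 2 * B / Re k" using \<kappa> B0 by (simp add: field_simps)
    finally show "(Re k)\<^sup>2 * integral {0..T} (\<lambda>x. (cmod (W x))\<^sup>2) \<le> 2 * B"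
      using \<kappa> by (simp add: power2_eq_square pos_le_divide_eq mult_ac)
  qed
qed

lemma square_integrable_half_lineI:
  fixes F :: "real \<Rightarrow> complex"
  assumes F: "continuous_on {0..} F"
    and B: "\<And>T. 0 \<le> T \<Longrightarrow> integral {0..T} (\<lambda>x. (cmod (F x))\<^sup>2) \<le> B"
  shows "square_integrable {0<..} F" "(LINT x|lebesgue_on {0<..}. (cmod (F x))\<^sup>2) \<le> B"
proof -
  let ?M = "lebesgue_on {0<..}"
  let ?g = "\<lambda>x. (cmod (F x))\<^sup>2"
  let ?f = "\<lambda>n x. indicator {..real n} x * ?g x"
  have meas: "F \<in> borel_measurable ?M"
    by (rule continuous_imp_measurable_on_sets_lebesgue[OF continuous_on_subset[OF F]]) auto
  have i: "integrable ?M (?f n)" "integral\<^sup>L ?M (?f n) = integral {0..real n} ?g" for n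
  proof -
    have ai: "?g absolutely_integrable_on {0..real n}"
      by (intro absolutely_integrable_continuous_real continuous_intros continuous_on_subset[OF F]) auto
    then have ai': "?g absolutely_integrable_on {0<..real n}"
      by (rule set_integrable_subset) auto
    have eq: "(\<lambda>x. indicator {0<..} x *\<^sub>R ?f n x) = (\<lambda>x. indicator {0<..real n} x *\<^sub>R ?g x)"
      by (auto simp: indicator_def fun_eq_iff)
    show "integrable ?M (?f n)"
      using ai' by (subst integrable_restrict_space) (simp_all only: eq set_integrable_def, simp)
    have "integral\<^sup>L ?M (?f n) = integral {0<..real n} ?g"
      using set_lebesgue_integral_eq_integral(2)[OF ai']
      by (subst integral_restrict_space) (simp_all only: eq set_lebesgue_integral_def, simp)
    also have "\<dots> = integral {0..real n} ?g"
      by (rule integral_spike_set) (auto intro: negligible_subset[of "{0}"])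
    finally show "integral\<^sup>L ?M (?f n) = integral {0..real n} ?g" .
  qed
  have bounded: "integral\<^sup>L ?M (?f n) \<le> B" for n unfolding i(2) by (rule B) simp
  have mono: "incseq (\<lambda>n. integral\<^sup>L ?M (?f n))"
    by (intro incseq_SucI integral_mono i(1)) (auto simp: indicator_def)
  have bd: "\<forall>n. integral\<^sup>L ?M (?f n) \<le> B" by (intro allI bounded)
  obtain L where L: "(\<lambda>n. integral\<^sup>L ?M (?f n)) \<longlonglongrightarrow> L"
    by (rule incseq_convergent[OF mono bd])
  have lim: "(\<lambda>n. ?f n x) \<longlonglongrightarrow> ?g x" for x
  proof (rule tendsto_eventually)
    obtain n0 where "x \<le> real n0" using real_arch_simple by blast
    then show "\<forall>\<^sub>F n in sequentially. ?f n x = ?g x"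
      unfolding eventually_sequentially by (intro exI[of _ n0]) (auto simp: indicator_def)
  qed
  have gm: "?g \<in> borel_measurable ?M" using meas by measurable
  have incf: "AE x in ?M. incseq (\<lambda>n. ?f n x)"
    by (intro AE_I2 incseq_SucI) (auto simp: indicator_def)
  have limf: "AE x in ?M. (\<lambda>n. ?f n x) \<longlonglongrightarrow> ?g x"
    by (intro AE_I2 lim)
  have ig: "integrable ?M ?g"
    by (rule integrable_monotone_convergence[OF i(1) incf limf L gm])
  have eqL: "integral\<^sup>L ?M ?g = L"
    by (rule integral_monotone_convergence[OF i(1) incf limf L gm])
  show "square_integrable {0<..} F" using meas ig by (simp add: square_integrable_def)
  show "integral\<^sup>L ?M ?g \<le> B"
    unfolding eqL by (rule LIMSEQ_le_const2[OF L]) (intro exI allI impI bounded)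
qed

lemma square_integrable_half_lineD:
  fixes h :: "real \<Rightarrow> complex"
  assumes h: "square_integrable {0<..} h"
  shows "(\<lambda>x. (cmod (h x))\<^sup>2) integrable_on {0..T}"
    "integral {0..T} (\<lambda>x. (cmod (h x))\<^sup>2) \<le> (LINT x|lebesgue_on {0<..}. (cmod (h x))\<^sup>2)"
proof -
  let ?g = "\<lambda>x. (cmod (h x))\<^sup>2"
  have hi: "(?g has_integral (LINT x|lebesgue_on {0<..}. ?g x)) {0<..}"
    using h by (intro has_integral_integral_lebesgue_on) (auto simp: square_integrable_def)
  have "?g absolutely_integrable_on {0<..}"
    using hi by (intro nonnegative_absolutely_integrable_1) auto
  then have "?g absolutely_integrable_on {0<..T}"
    by (rule set_integrable_subset) auto
  then have i: "?g integrable_on {0<..T}" by (simp add: absolutely_integrable_on_def)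
  have n: "negligible {x \<in> {0<..T} - {0..T}. ?g x \<noteq> 0}" "negligible {x \<in> {0..T} - {0<..T}. ?g x \<noteq> 0}"
    by (auto intro: negligible_subset[of "{0}"])
  show "?g integrable_on {0..T}"
    using i n by (rule integrable_spike_set)
  have "integral {0..T} ?g = integral {0<..T} ?g"
    using n by (intro integral_spike_set) auto
  also have "\<dots> \<le> integral {0<..} ?g"
    using i hi by (intro integral_subset_le) auto
  also have "\<dots> = (LINT x|lebesgue_on {0<..}. ?g x)"
    using hi by (rule integral_unique)
  finally show "integral {0..T} ?g \<le> (LINT x|lebesgue_on {0<..}. ?g x)" .
qed

lemma square_integrable_decaying_exp:
  assumes \<kappa>: "Re k > 0"
  shows "square_integrable {0<..} (\<lambda>x. b * exp (- (k * of_real x)))"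
    "(LINT x|lebesgue_on {0<..}. (cmod (b * exp (- (k * of_real x))))\<^sup>2) \<le> (cmod b)\<^sup>2 / (2 * Re k)"
proof -
  have c: "continuous_on {0..} (\<lambda>x. b * exp (- (k * of_real x)))" by (intro continuous_intros)
  have B: "integral {0..T} (\<lambda>x. (cmod (b * exp (- (k * of_real x))))\<^sup>2) \<le> (cmod b)\<^sup>2 / (2 * Re k)" if "0 \<le> T" for T
  proof -
    have "integral {0..T} (\<lambda>x. (cmod (b * exp (- (k * of_real x))))\<^sup>2)
        = (cmod b)\<^sup>2 * integral {0..T} (\<lambda>x. (exp (- (Re k * x)))\<^sup>2)"
      by (simp add: norm_mult power_mult_distrib)
    also have "\<dots> \<le> (cmod b)\<^sup>2 * (1 / (2 * Re k))"
      unfolding integral_unique[OF has_integral_exp_decay[OF \<kappa> that]]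
      using \<kappa> by (intro mult_left_mono divide_right_mono) simp_all
    finally show ?thesis by simp
  qed
  show "square_integrable {0<..} (\<lambda>x. b * exp (- (k * of_real x)))"
    "(LINT x|lebesgue_on {0<..}. (cmod (b * exp (- (k * of_real x))))\<^sup>2) \<le> (cmod b)\<^sup>2 / (2 * Re k)"
    using square_integrable_half_lineI[OF c B] by auto
qed

lemma growing_exp_not_square_integrable:
  assumes \<kappa>: "Re k > 0" and y: "square_integrable {0<..} y" "\<And>x. 0 \<le> x \<Longrightarrow> y x = y0 * exp (k * of_real x)"
  shows "y0 = 0"
proof (rule ccontr)
  assume "y0 \<noteq> 0"
  then have y0: "0 < (cmod y0)\<^sup>2" by simp
  let ?C = "LINT x|lebesgue_on {0<..}. (cmod (y x))\<^sup>2"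
  have "T * (cmod y0)\<^sup>2 \<le> ?C" if T: "0 \<le> T" for T
  proof -
    have "T * (cmod y0)\<^sup>2 = integral {0..T} (\<lambda>x. (cmod y0)\<^sup>2)" using T by simp
    also have "\<dots> \<le> integral {0..T} (\<lambda>x. (cmod (y x))\<^sup>2)"
    proof (rule integral_le)
      show "(cmod y0)\<^sup>2 \<le> (cmod (y x))\<^sup>2" if "x \<in> {0..T}" for x
      proof -
        have "1 \<le> exp (Re k * x)" using that \<kappa> by simp
        then have "cmod y0 * 1 \<le> cmod y0 * exp (Re k * x)" by (intro mult_left_mono) simp_all
        then show ?thesis using that y(2)[of x] by (intro power_mono) (simp_all add: norm_mult)
      qed
    qed (auto intro: square_integrable_half_lineD[OF y(1)])
    also have "\<dots> \<le> ?C" by (rule square_integrable_half_lineD[OF y(1)])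
    finally show ?thesis .
  qed
  \<comment> \<open>A length \<open>T\<close> for which \<open>T (cmod y0)\<^sup>2\<close> exceeds \<open>?C\<close>.\<close>
  from this[of "(\<bar>?C\<bar> + 1) / (cmod y0)\<^sup>2"] y0 show False by simp
qed

text \<open>The initial value zero of the inner first-order equation gives the relation \<open>Q 0 = k * W 0\<close>,
  whereas the free solution \<open>exp (- k x)\<close> has logarithmic derivative \<open>- k\<close> at
  \<open>0\<close>.\<close>

lemma heat_particular_solution:
  fixes h :: "heat L2"
  assumes \<kappa>: "Re k > 0"
  obtains W Q where "primitive_on {0..} W Q" "primitive_on {0..} Q (\<lambda>x. k * k * W x - rep_L2 h x)"
    "Q 0 = k * W 0" "square_integrable {0<..} W" "square_integrable {0<..} Q"
    "(cmod (W 0))\<^sup>2 \<le> (norm h)\<^sup>2 / (2 * (Re k) ^ 3)"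
    "(LINT x|lebesgue_on {0<..}. (cmod (W x))\<^sup>2) \<le> 2 * (norm h)\<^sup>2 / (Re k) ^ 4"
proof -
  have S: "is_interval {0::real..}" "closed {0::real..}" by (simp_all add: is_interval_ci)
  have hs: "square_integrable {0<..} (rep_L2 h)"
    using square_integrable_rep_L2[of h] by (simp add: interval_of_heat_def)
  have hN: "(LINT x|lebesgue_on {0<..}. (cmod (rep_L2 h x))\<^sup>2) = (norm h)\<^sup>2"
    using norm_rep_L2[of h] by (simp add: interval_of_heat_def)
  have ha: "rep_L2 h absolutely_integrable_on {0..T}" for T
  proof (cases "0 \<le> T")
    case True
    show ?thesis
      by (rule square_integrable_locally_integrable[OF hs]) (simp_all add: is_interval_oi True)
  qed (simp add: set_integrable_def)
  obtain Z where Z: "primitive_on {0..} Z (\<lambda>x. - k * Z x - rep_L2 h x)" "Z 0 = 0"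
    "\<And>T. 0 \<le> T \<Longrightarrow> (Re k)\<^sup>2 * integral {0..T} (\<lambda>x. (cmod (Z x))\<^sup>2) \<le> (norm h)\<^sup>2"
    using heat_decaying_solution[OF \<kappa> ha square_integrable_half_lineD[OF hs, unfolded hN]] by blast
  have cZ: "continuous_on {0..} Z" using primitive_on_continuous[OF S Z(1)] .
  define B where "B = (norm h)\<^sup>2 / (Re k)\<^sup>2"
  have ZB: "integral {0..T} (\<lambda>x. (cmod (Z x))\<^sup>2) \<le> B" if "0 \<le> T" for T
    using Z(3)[OF that] \<kappa> by (simp add: B_def pos_le_divide_eq mult.commute)
  obtain W where W: "primitive_on {0..} W (\<lambda>x. k * W x + Z x)"
    "\<And>x. 0 \<le> x \<Longrightarrow> (cmod (W x))\<^sup>2 \<le> B / (2 * Re k)"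
    "\<And>T. 0 \<le> T \<Longrightarrow> (Re k)\<^sup>2 * integral {0..T} (\<lambda>x. (cmod (W x))\<^sup>2) \<le> 2 * B"
    using heat_backward_solution[OF \<kappa> cZ ZB] by blast
  have cW: "continuous_on {0..} W" using primitive_on_continuous[OF S W(1)] .
  have WB: "integral {0..T} (\<lambda>x. (cmod (W x))\<^sup>2) \<le> 2 * B / (Re k)\<^sup>2" if "0 \<le> T" for T
    using W(3)[OF that] \<kappa> by (simp add: pos_le_divide_eq mult.commute)
  note sW = square_integrable_half_lineI[OF cW WB]
  note sZ = square_integrable_half_lineI[OF cZ ZB]
  show thesis
  proof
    show "primitive_on {0..} W (\<lambda>x. k * W x + Z x)" by (rule W(1))
    show "primitive_on {0..} (\<lambda>x. k * W x + Z x) (\<lambda>x. k * k * W x - rep_L2 h x)"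
      by (rule primitive_on_cong[OF primitive_on_add[OF primitive_on_cmult[OF W(1), of k] Z(1)] S(1)])
         (simp_all add: algebra_simps)
    show "k * W 0 + Z 0 = k * W 0" using Z(2) by simp
    show "square_integrable {0<..} W" by (rule sW(1))
    show "square_integrable {0<..} (\<lambda>x. k * W x + Z x)"
      by (intro square_integrable_add square_integrable_scale sW(1) sZ(1))
    show "(cmod (W 0))\<^sup>2 \<le> (norm h)\<^sup>2 / (2 * (Re k) ^ 3)"
      using W(2)[of 0] by (simp add: B_def power2_eq_square power3_eq_cube mult_ac)
    show "(LINT x|lebesgue_on {0<..}. (cmod (W x))\<^sup>2) \<le> 2 * (norm h)\<^sup>2 / (Re k) ^ 4"
      using sW(2) by (simp add: B_def power2_eq_square power4_eq_xxxx mult_ac)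
  qed
qed

lemma square_integrable_value_at:
  fixes f :: "heat L2"
  assumes f: "f \<in> H1"
  shows "square_integrable {0<..} (value_at f)"
proof -
  let ?M = "lebesgue_on {0 :: real<..}"
  have sq: "square_integrable {0<..} (rep_L2 f)"
    using square_integrable_rep_L2[of f] by (simp add: interval_of_heat_def)
  have ae: "AE x in ?M. rep_L2 f x = value_at f x"
    using H1_value_at(2)[OF f] unfolding interval_of_heat_def .
  have "continuous_on {0<..} (value_at f)"
    by (rule continuous_on_subset[OF value_at_continuous[OF f]]) (auto simp: closure_heat)
  then have m: "value_at f \<in> borel_measurable ?M"
    by (rule continuous_imp_measurable_on_sets_lebesgue) simp
  have "integrable ?M (\<lambda>x. (cmod (value_at f x))\<^sup>2)"
  proof (rule integrable_cong_AE_imp)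
    show "integrable ?M (\<lambda>x. (cmod (rep_L2 f x))\<^sup>2)" using sq by (simp add: square_integrable_def)
    show "(\<lambda>x. (cmod (value_at f x))\<^sup>2) \<in> borel_measurable ?M" using m by measurable
    show "AE x in ?M. (cmod (rep_L2 f x))\<^sup>2 = (cmod (value_at f x))\<^sup>2" using ae by eventually_elim simp
  qed
  then show ?thesis using m by (simp add: square_integrable_def)
qed

section \<open>Matching at the interface\<close>

text \<open>The argument of \<open>\<i> s\<close> is \<open>\<pi> / 2\<close> or \<open>- \<pi> / 2\<close>, and the
  principal square root halves it.\<close>

lemma
  fixes s :: real
  assumes "s \<noteq> 0"
  defines "k \<equiv> csqrt (\<i> * of_real s)"
  shows csqrt_imaginary_Re: "Re k = sqrt (\<bar>s\<bar> / 2)"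
    and csqrt_imaginary_Im: "Im k = Re k \<or> Im k = - Re k"
    and csqrt_imaginary_square: "k * k = \<i> * of_real s"
    and csqrt_imaginary_pos: "0 < Re k"
    and csqrt_imaginary_norm: "cmod k \<le> 2 * Re k"
proof -
  show R: "Re k = sqrt (\<bar>s\<bar> / 2)" by (simp add: k_def norm_mult)
  show I: "Im k = Re k \<or> Im k = - Re k"
    using assms(1) by (auto simp: k_def norm_mult sgn_if)
  show "k * k = \<i> * of_real s" unfolding k_def by (simp add: power2_eq_square[symmetric])
  show P: "0 < Re k" unfolding R using assms(1) by simp
  show "cmod k \<le> 2 * Re k"
    using cmod_le[of k] I P by auto
qed

text \<open>This is the determinant of the matching conditions at the interface. It stays away from zero for large
  \<open>\<kappa>\<close> because at most one of \<open>cos s\<close> and \<open>sin s\<close> is small, and because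
  the two parts of \<open>\<i> k\<close> have equal modulus, so that the real part cannot cancel without the imaginary
  part being large.\<close>

lemma interface_determinant_bound:
  fixes s \<kappa> :: real and k :: complex
  assumes k: "Re k = \<kappa>" "Im k = \<kappa> \<or> Im k = - \<kappa>" and \<kappa>: "\<kappa> > 0"
  shows "min 1 \<kappa> / 2 \<le> cmod (of_real (cos s) + \<i> * k * of_real (sin s))"
proof -
  let ?D = "of_real (cos s) + \<i> * k * of_real (sin s)" and ?y = "\<kappa> * sin s"
  have Im: "Im ?D = ?y" using k by simp
  have Re: "Re ?D = cos s - ?y \<or> Re ?D = cos s + ?y" using k by auto
  have sq: "(cmod ?D)\<^sup>2 = (Re ?D)\<^sup>2 + ?y\<^sup>2" unfolding cmod_power2 Im ..
  \<comment> \<open>\<open>Re ?D = cos s \<plusminus> ?y\<close> and \<open>Im ?D = ?y\<close>: the minimum over all real \<open>?y\<close> is \<open>(cos s)\<^sup>2 / 2\<close>.\<close>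
  have "(cos s)\<^sup>2 / 2 \<le> (cmod ?D)\<^sup>2"
  proof -
    have "(cos s)\<^sup>2 / 2 \<le> (cos s - t)\<^sup>2 + t\<^sup>2" for t
      using zero_le_power2[of "2 * t - cos s"] by (simp add: power2_eq_square algebra_simps)
    note t = this[of ?y] this[of "- ?y"]
    show ?thesis using Re unfolding sq
    proof
      assume "Re ?D = cos s - ?y"
      then show "(cos s)\<^sup>2 / 2 \<le> (Re ?D)\<^sup>2 + ?y\<^sup>2" using t(1) by (simp only:)
    next
      assume "Re ?D = cos s + ?y"
      then show "(cos s)\<^sup>2 / 2 \<le> (Re ?D)\<^sup>2 + ?y\<^sup>2" using t(2) by (simp only: diff_minus_eq_add power2_minus)
    qed
  qed
  moreover have "?y\<^sup>2 \<le> (cmod ?D)\<^sup>2" unfolding sq by simp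
  ultimately have 1: "(cos s)\<^sup>2 / 2 + ?y\<^sup>2 \<le> 2 * (cmod ?D)\<^sup>2" by linarith
  let ?m = "min 1 \<kappa>"
  have m: "0 \<le> ?m" "?m \<le> 1" "?m \<le> \<kappa>" using \<kappa> by auto
  have "?m\<^sup>2 \<le> 1\<^sup>2" "?m\<^sup>2 \<le> \<kappa>\<^sup>2" using m by (intro power_mono; simp)+
  then have "?m\<^sup>2 * (cos s)\<^sup>2 \<le> (cos s)\<^sup>2" "?m\<^sup>2 * (sin s)\<^sup>2 \<le> ?y\<^sup>2"
    using mult_right_mono[of "?m\<^sup>2" "1\<^sup>2" "(cos s)\<^sup>2"] mult_right_mono[of "?m\<^sup>2" "\<kappa>\<^sup>2" "(sin s)\<^sup>2"]
    by (simp_all only: power_mult_distrib power_one mult_1_left zero_le_power2)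
  then have "?m\<^sup>2 * (cos s)\<^sup>2 + ?m\<^sup>2 * (sin s)\<^sup>2 \<le> (cos s)\<^sup>2 + ?y\<^sup>2" by (rule add_mono)
  then have "?m\<^sup>2 \<le> (cos s)\<^sup>2 + ?y\<^sup>2" by (simp only: distrib_left[symmetric] sin_cos_squared_add2 mult_1_right)
  moreover have "0 \<le> ?y\<^sup>2" by simp
  ultimately have "?m\<^sup>2 / 2 \<le> 2 * (cmod ?D)\<^sup>2" using 1 by linarith
  then have "(?m / 2)\<^sup>2 \<le> (cmod ?D)\<^sup>2" by (simp add: power_divide)
  then show ?thesis by (rule power2_le_imp_le) simp
qed

text \<open>Here \<open>q\<^sup>2\<close> is the real part of the square root of \<open>\<i> s\<close>,
  \<open>c\<close> is the modulus of the interface parameter, \<open>d\<close> that of the determinant, and the two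
  summands on the left bound the wave part and the heat part. For \<open>q \<ge> 1\<close> the power
  \<open>q\<^sup>2\<close> dominates, for \<open>q < 1\<close> the power \<open>1 / q ^ 4\<close>; in both cases the
  constants add up to \<open>69\<close>.\<close>

lemma resolvent_bound_arithmetic:
  fixes q N c d :: real
  assumes q: "0 < q" and N: "0 \<le> N" and d: "min 1 (q\<^sup>2) / 2 \<le> d"
    and c: "c * d \<le> N * (4 / q + 2 + 4 * q\<^sup>2)" "0 \<le> c"
  shows "2 * (c + 2 * N) + ((c + 2 * N + N / q ^ 3) / q + 2 * N / q ^ 4) \<le> 69 * (q\<^sup>2 + 1 / q ^ 4) * N"
proof (cases "1 \<le> q")
  case True
  have q2: "1 \<le> q\<^sup>2" "q \<le> q\<^sup>2" using True power_increasing[of 1 2 q] by (simp_all add: one_le_power)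
  have inv: "1 / q \<le> 1" "1 / q ^ 4 \<le> 1" using True by (simp_all add: one_le_power)
  have "c * (1 / 2) \<le> c * d" using d q2 c(2) by (intro mult_left_mono) simp_all
  also have "\<dots> \<le> N * (10 * q\<^sup>2)"
    using inv q2 by (intro order_trans[OF c(1)] mult_left_mono N) simp
  finally have c': "c \<le> 20 * N * q\<^sup>2" by simp
  have e: "(c + 2 * N + N / q ^ 3) / q + 2 * N / q ^ 4 = (c + 2 * N) * (1 / q) + 3 * N * (1 / q ^ 4)"
    using q by (simp add: field_simps power_numeral_reduce)
  have "(c + 2 * N) * (1 / q) \<le> (c + 2 * N) * 1" "3 * N * (1 / q ^ 4) \<le> 3 * N * 1"
    using inv N c(2) by (intro mult_left_mono; simp)+
  then have "2 * (c + 2 * N) + ((c + 2 * N + N / q ^ 3) / q + 2 * N / q ^ 4) \<le> 3 * c + 9 * N"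
    unfolding e by simp
  also have "\<dots> \<le> 60 * N * q\<^sup>2 + 9 * N * q\<^sup>2"
    using c' mult_left_mono[OF q2(1), of "9 * N"] N by simp
  also have "\<dots> = 69 * q\<^sup>2 * N" by simp
  also have "\<dots> \<le> 69 * (q\<^sup>2 + 1 / q ^ 4) * N"
    using N q by (intro mult_right_mono mult_left_mono) simp_all
  finally show ?thesis .
next
  case False
  define r where "r = 1 / q"
  have r: "1 \<le> r" "q = 1 / r" using False q by (simp_all add: r_def)
  have rp: "r \<le> r ^ 4" "1 \<le> r ^ 4" "r ^ 3 \<le> r ^ 4" "r\<^sup>2 \<le> r ^ 4" "1 \<le> r\<^sup>2" "1 \<le> r ^ 3"
    using power_increasing[of 1 4 r] power_increasing[of 0 4 r] power_increasing[of 3 4 r]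
      power_increasing[of 2 4 r] r(1) by (simp_all add: one_le_power)
  have qr: "q\<^sup>2 = 1 / r\<^sup>2" "1 / q = r" "1 / q ^ 4 = r ^ 4" "1 / q ^ 3 = r ^ 3"
    unfolding r(2) by (simp_all add: power_divide)
  have "q\<^sup>2 \<le> 1" using False q by (simp add: power_le_one)
  then have m: "min 1 (q\<^sup>2) = q\<^sup>2" by simp
  have "c * (q\<^sup>2 / 2) \<le> c * d" using d[unfolded m] c(2) by (intro mult_left_mono)
  also have "\<dots> \<le> N * (10 * r)"
  proof (rule order_trans[OF c(1)], rule mult_left_mono[OF _ N])
    have "4 / q = 4 * r" using qr(2) by simp
    then show "4 / q + 2 + 4 * q\<^sup>2 \<le> 10 * r" using \<open>q\<^sup>2 \<le> 1\<close> r(1) by linarith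
  qed
  finally have "c * (q\<^sup>2 / 2) * (2 * r\<^sup>2) \<le> N * (10 * r) * (2 * r\<^sup>2)"
    by (rule mult_right_mono) simp
  moreover have "c * (q\<^sup>2 / 2) * (2 * r\<^sup>2) = c" unfolding qr(1) using r(1) by simp
  moreover have "N * (10 * r) * (2 * r\<^sup>2) = 20 * N * r ^ 3"
    by (simp add: power2_eq_square power3_eq_cube)
  ultimately have c': "c \<le> 20 * N * r ^ 3" by (simp only:)
  have e: "(c + 2 * N + N / q ^ 3) / q + 2 * N / q ^ 4 = (c + 2 * N + N * r ^ 3) * r + 2 * N * r ^ 4"
    unfolding qr(3,4)[symmetric] r_def by (simp add: field_simps)
  have c4: "2 * c \<le> 40 * N * r ^ 4"
    using c' mult_left_mono[OF rp(3), of "40 * N"] N by simp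
  have cr: "c * r \<le> 20 * N * r ^ 4"
    using mult_right_mono[OF c', of r] r(1) by (simp add: power_numeral_reduce mult_ac)
  have "2 * (c + 2 * N) + ((c + 2 * N + N / q ^ 3) / q + 2 * N / q ^ 4)
      = 2 * c + c * r + 4 * N + 2 * N * r + 3 * N * r ^ 4"
    unfolding e by (simp add: algebra_simps power_numeral_reduce)
  also have "\<dots> \<le> 40 * N * r ^ 4 + 20 * N * r ^ 4 + 4 * N * r ^ 4 + 2 * N * r ^ 4 + 3 * N * r ^ 4"
    using c4 cr mult_left_mono[OF rp(2), of "4 * N"] mult_left_mono[OF rp(1), of "2 * N"] N by simp
  also have "\<dots> = 69 * r ^ 4 * N" by simp
  also have "\<dots> \<le> 69 * (q\<^sup>2 + 1 / q ^ 4) * N"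
    unfolding qr(3) using N by (intro mult_right_mono mult_left_mono) simp_all
  finally show ?thesis .
qed

text \<open>The solution of the wave system with parameter \<open>c\<close> and the heat solution \<open>b * exp (- k
  x) + W x\<close> are glued at \<open>0\<close>. Eliminating \<open>b\<close> leaves one scalar equation for
  \<open>c\<close>, whose coefficient is the determinant bounded above. Its right-hand side grows like \<open>cmod
  k\<close>, which is the source of the square root of \<open>\<bar>s\<bar>\<close>; the factor \<open>1 /
  \<bar>s\<bar>\<close> comes from the heat part at low frequency.\<close>

lemma resolvent_equation_solvable:
  fixes s :: real
  assumes s: "s \<noteq> 0" and y: "(f, g, h) \<in> state_space"
  shows "\<exists>z\<in>wave_heat_dom. shifted_op (\<i> * of_real s) z = (f, g, h) \<and>
    state_norm z \<le> 69 * (sqrt (\<bar>s\<bar> / 2) + 2 / \<bar>s\<bar>) * state_norm (f, g, h)"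
proof -
  let ?a = "\<i> * complex_of_real s"
  define N where "N = state_norm (f, g, h)"
  define k where "k = csqrt ?a"
  define \<kappa> where "\<kappa> = Re k"
  note k_facts = csqrt_imaginary_Re[OF s] csqrt_imaginary_Im[OF s] csqrt_imaginary_square[OF s]
    csqrt_imaginary_pos[OF s] csqrt_imaginary_norm[OF s]
  have \<kappa>: "\<kappa> = sqrt (\<bar>s\<bar> / 2)" "0 < \<kappa>" and kI: "Im k = \<kappa> \<or> Im k = - \<kappa>"
    and kk: "k * k = ?a" and kn: "cmod k \<le> 2 * \<kappa>" and kpos: "0 < Re k"
    using k_facts unfolding k_def[symmetric] \<kappa>_def by blast+
  define q where "q = sqrt \<kappa>"
  have q: "0 < q" "q\<^sup>2 = \<kappa>" using \<kappa>(2) by (simp_all add: q_def)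
  have fH: "f \<in> H1" and f1: "value_at f (-1) = 0"
    using y by (auto simp: state_space_def)
  define f' where "f' = weak_derivative f"
  have N: "norm f' \<le> N" "norm g \<le> N" "norm h \<le> N" "0 \<le> N"
    unfolding N_def state_norm_def f'_def by (auto intro!: real_le_rsqrt)
  have cS: "is_interval {-1..0::real}" "closed {-1..0::real}" and cH: "is_interval {0::real..}" "closed {0::real..}"
    by (simp_all add: is_interval_cc is_interval_ci)
  have ai: "rep_L2 e absolutely_integrable_on {-1..0}" for e :: "wave L2"
    by (rule square_integrable_locally_integrable[OF square_integrable_rep_L2 open_interval_of is_interval_interval_of])
       (simp_all add: closure_wave)
  define M where "M = integral {-1..0} (\<lambda>x. cmod (rep_L2 f' x)) + integral {-1..0} (\<lambda>x. cmod (rep_L2 g x))"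
  have M: "M \<le> 2 * N"
    using integral_cmod_le_L2_norm[of f'] integral_cmod_le_L2_norm[of g] N by (simp add: M_def)
  obtain A B where AB: "cmod A \<le> M" "cmod B \<le> M"
    and wave: "\<And>c. \<exists>v p. primitive_on {-1..0} v (\<lambda>x. ?a * p x - rep_L2 f' x) \<and>
       primitive_on {-1..0} p (\<lambda>x. ?a * v x - rep_L2 g x) \<and> v (-1) = 0 \<and>
       v 0 = \<i> * c * of_real (sin s) - (A + B) / 2 \<and> p 0 = c * of_real (cos s) - (A - B) / 2 \<and>
       (\<forall>x\<in>{-1..0}. cmod (v x) \<le> cmod c + M \<and> cmod (p x) \<le> cmod c + M)"
    using wave_first_order_system_solution[OF ai ai, of f' g s] unfolding M_def[symmetric] by blast
  obtain W Q where WQ: "primitive_on {0..} W Q" "primitive_on {0..} Q (\<lambda>x. k * k * W x - rep_L2 h x)"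
    "Q 0 = k * W 0" "square_integrable {0<..} W" "square_integrable {0<..} Q"
    "(cmod (W 0))\<^sup>2 \<le> (norm h)\<^sup>2 / (2 * (Re k) ^ 3)"
    "(LINT x|lebesgue_on {0<..}. (cmod (W x))\<^sup>2) \<le> 2 * (norm h)\<^sup>2 / (Re k) ^ 4"
    using heat_particular_solution[OF kpos, of h] by blast
  have hN: "(norm h)\<^sup>2 \<le> N\<^sup>2" using N(3) by (intro power_mono) simp_all
  have W0: "cmod (W 0) \<le> N / q ^ 3"
  proof (rule power2_le_imp_le)
    have "(cmod (W 0))\<^sup>2 \<le> N\<^sup>2 / (2 * \<kappa> ^ 3)"
      using WQ(6) hN \<kappa>(2) unfolding \<kappa>_def[symmetric]
      by (elim order_trans) (intro divide_right_mono; simp)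
    also have "\<dots> \<le> N\<^sup>2 / \<kappa> ^ 3"
      using \<kappa>(2) by (intro divide_left_mono) simp_all
    also have "\<dots> = (N / q ^ 3)\<^sup>2"
      unfolding q(2)[symmetric] by (simp add: power_divide power_mult[symmetric])
    finally show "(cmod (W 0))\<^sup>2 \<le> (N / q ^ 3)\<^sup>2" .
    show "0 \<le> N / q ^ 3" using N q by simp
  qed
  define D where "D = of_real (cos s) + \<i> * k * of_real (sin s)"
  have D: "min 1 \<kappa> / 2 \<le> cmod D"
    unfolding D_def by (rule interface_determinant_bound) (use \<kappa> kI in \<open>simp_all add: \<kappa>_def\<close>)
  have D0: "D \<noteq> 0" using D \<kappa>(2) by auto
  \<comment> \<open>This is the choice of \<open>p (-1)\<close> for which \<open>p 0 + k * v 0 = 2 * k * W 0\<close>.\<close>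
  define c where "c = (2 * k * W 0 + (A - B) / 2 + k * (A + B) / 2) / D"
  obtain v p where v: "primitive_on {-1..0} v (\<lambda>x. ?a * p x - rep_L2 f' x)"
    and p: "primitive_on {-1..0} p (\<lambda>x. ?a * v x - rep_L2 g x)" and v1: "v (-1) = 0"
    and v0: "v 0 = \<i> * c * of_real (sin s) - (A + B) / 2" and p0: "p 0 = c * of_real (cos s) - (A - B) / 2"
    and vp: "\<And>x. x \<in> {-1..0} \<Longrightarrow> cmod (v x) \<le> cmod c + M" "\<And>x. x \<in> {-1..0} \<Longrightarrow> cmod (p x) \<le> cmod c + M"
    using wave[of c] by blast
  have cD: "c * D = 2 * k * W 0 + (A - B) / 2 + k * (A + B) / 2"
    using D0 by (simp add: c_def)
  have match: "p 0 + k * v 0 = 2 * k * W 0"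
  proof -
    have "p 0 + k * v 0 = c * D - (A - B) / 2 - k * (A + B) / 2"
      unfolding p0 v0 D_def by (simp add: algebra_simps)
    then show ?thesis unfolding cD by simp
  qed
  \<comment> \<open>The trace condition \<open>w 0 = v 0\<close>; the choice of \<open>c\<close> then yields the flux condition.\<close>
  define b where "b = v 0 - W 0"
  define w where "w x = b * exp (- (k * of_real x)) + W x" for x
  define w' where "w' x = - k * (b * exp (- (k * of_real x))) + Q x" for x
  have E: "primitive_on {0..} (\<lambda>x. a * exp (- (k * of_real x))) (\<lambda>x. - k * (a * exp (- (k * of_real x))))" for a
    by (rule primitive_on_cong[OF primitive_on_cmult[OF primitive_on_exp[OF cH(1), of "- k"], of a] cH(1)]) simp_all
  have Pw: "primitive_on {0..} w w'"
    unfolding w_def w'_def by (intro primitive_on_add E WQ)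
  have Pw': "primitive_on {0..} w' (\<lambda>x. ?a * w x - rep_L2 h x)"
    by (rule primitive_on_cong[OF primitive_on_add[OF primitive_on_cmult[OF E, of "- k" b] WQ(2)] cH(1)])
       (simp_all add: w'_def w_def kk[symmetric] algebra_simps)
  define u where "u x = integral {-1..x} p" for x
  have cp: "continuous_on {-1..0} p" and cv: "continuous_on {-1..0} v"
    using p v by (auto intro: primitive_on_continuous cS)
  have u: "primitive_on {-1..0} u p"
    unfolding u_def
    by (intro primitive_on_integral_from cS absolutely_integrable_continuous_real continuous_on_subset[OF cp]) auto
  have u1: "u (-1) = 0" by (simp add: u_def)
  have cu: "continuous_on {-1..0} u" using u by (auto intro: primitive_on_continuous cS)
  obtain Ku where "\<forall>y\<in>u ` {-1..0}. cmod y \<le> Ku"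
    using compact_imp_bounded[OF compact_continuous_image[OF cu compact_Icc]] unfolding bounded_iff by blast
  then have Ku: "cmod (u x) \<le> Ku" if "x \<in> {-1..0}" for x using that by blast
  have sq_u: "square_integrable (interval_of TYPE(wave)) u"
    by (rule wave_L2_bounded(1)[OF cu Ku])
  have sq_v: "square_integrable (interval_of TYPE(wave)) v"
    by (rule wave_L2_bounded(1)[OF cv vp(1)])
  have sq_p: "square_integrable (interval_of TYPE(wave)) p"
    by (rule wave_L2_bounded(1)[OF cp vp(2)])
  have sq_e: "square_integrable {0<..} (\<lambda>x. a * exp (- (k * of_real x)))" for a
    by (rule square_integrable_decaying_exp[OF kpos])
  have sq_w: "square_integrable (interval_of TYPE(heat)) w"
    unfolding w_def interval_of_heat_def by (intro square_integrable_add sq_e WQ)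
  have sq_w': "square_integrable (interval_of TYPE(heat)) w'"
    unfolding w'_def interval_of_heat_def by (intro square_integrable_add square_integrable_scale sq_e WQ)
  define uL vL pL where "uL = (abs_L2 u :: wave L2)" and "vL = (abs_L2 v :: wave L2)" and "pL = (abs_L2 p :: wave L2)"
  define wL qL where "wL = (abs_L2 w :: heat L2)" and "qL = (abs_L2 w' :: heat L2)"
  note rep = rep_abs_L2[OF sq_u, folded uL_def] rep_abs_L2[OF sq_v, folded vL_def]
    rep_abs_L2[OF sq_p, folded pL_def] rep_abs_L2[OF sq_w, folded wL_def] rep_abs_L2[OF sq_w', folded qL_def]
  note rv = rep_L2_scaleC_diff[OF rep(3), where c = "?a" and g = f']
    and rp = rep_L2_scaleC_diff[OF rep(2), where c = "?a" and g = g]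
    and rw = rep_L2_scaleC_diff[OF rep(4), where c = "?a" and g = h]
  note su = H1_if_primitive[OF u[folded closure_wave] rep(1) rep(3), unfolded closure_wave]
  note sv = H1_if_primitive[OF v[folded closure_wave] rep(2) rv, unfolded closure_wave]
  note sp = H1_if_primitive[OF p[folded closure_wave] rep(3) rp, unfolded closure_wave]
  note sw = H1_if_primitive[OF Pw[folded closure_heat] rep(4) rep(5), unfolded closure_heat]
  note sw' = H1_if_primitive[OF Pw'[folded closure_heat] rep(5) rw, unfolded closure_heat]
  have w0: "w 0 = v 0" by (simp add: w_def b_def)
  have w'0: "w' 0 = p 0"
    using match by (simp add: w'_def b_def WQ(3) algebra_simps)
  have dom: "(uL, vL, wL) \<in> wave_heat_dom"
    using su sv sp sw sw' u1 v1 w0 w'0 by (simp add: wave_heat_dom_def H2_def)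
  \<comment> \<open>Both sides lie in \<open>H1\<close>, vanish at \<open>-1\<close> and have the same derivative.\<close>
  have "?a *\<^sub>C uL - vL = f"
  proof (rule H1_eqI[where ?x0.0 = "-1"])
    have i: "?a *\<^sub>C uL \<in> H1" by (intro H1_scaleC su)
    show "?a *\<^sub>C uL - vL \<in> H1" by (intro H1_diff i sv)
    show "f \<in> H1" by fact
    show "weak_derivative (?a *\<^sub>C uL - vL) = weak_derivative f"
      using weak_derivative_diff[OF i sv(1)] weak_derivative_scaleC[OF su(1)] su(2) sv(2) by (simp add: f'_def)
    show "-1 \<in> closure (interval_of TYPE(wave))" by (simp add: closure_wave)
    then show "value_at (?a *\<^sub>C uL - vL) (-1) = value_at f (-1)"
      using value_at_diff[OF i sv(1), of "-1"] value_at_scaleC[OF su(1), of "-1" "?a"] su(3)[of "-1"] sv(3)[of "-1"]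
      by (simp add: u1 v1 f1)
  qed
  then have op: "shifted_op ?a (uL, vL, wL) = (f, g, h)"
    using su(2) sp(2) sw(2) sw'(2) by (simp add: shifted_op_def scale_state_def wave_heat_op_def)
  have nv: "norm vL \<le> cmod c + 2 * N" and np: "norm pL \<le> cmod c + 2 * N"
    using wave_L2_bounded(2)[OF cv vp(1)] wave_L2_bounded(2)[OF cp vp(2)] M by (simp_all add: vL_def pL_def)
  have vb: "cmod b \<le> cmod c + 2 * N + N / q ^ 3"
    using norm_triangle_ineq4[of "v 0" "W 0"] vp(1)[of 0] M W0 by (simp add: b_def)
  have nw: "norm wL \<le> (cmod c + 2 * N + N / q ^ 3) / q + 2 * N / q ^ 4"
  proof -
    let ?e = "abs_L2 (\<lambda>x. b * exp (- (k * of_real x))) :: heat L2" and ?W = "abs_L2 W :: heat L2"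
    have "norm ?e \<le> cmod b / q"
    proof (rule power2_le_imp_le)
      have "(norm ?e)\<^sup>2 \<le> (cmod b)\<^sup>2 / (2 * \<kappa>)"
        using square_integrable_decaying_exp[OF kpos, of b] norm_abs_L2[where 'i = heat, of "\<lambda>x. b * exp (- (k * of_real x))"]
        by (simp add: interval_of_heat_def \<kappa>_def)
      also have "\<dots> \<le> (cmod b)\<^sup>2 / \<kappa>" using \<kappa>(2) by (intro divide_left_mono) simp_all
      also have "\<dots> = (cmod b / q)\<^sup>2" by (simp add: power_divide q(2))
      finally show "(norm ?e)\<^sup>2 \<le> (cmod b / q)\<^sup>2" .
    qed (use q in simp)
    moreover have "cmod b / q \<le> (cmod c + 2 * N + N / q ^ 3) / q"
      using vb q by (intro divide_right_mono) simp_all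
    moreover have "norm ?W \<le> 2 * N / q ^ 4"
    proof (rule power2_le_imp_le)
      have "(norm ?W)\<^sup>2 \<le> 2 * (norm h)\<^sup>2 / \<kappa> ^ 4"
        using WQ(4,7) norm_abs_L2[where 'i = heat, of W] by (simp add: interval_of_heat_def \<kappa>_def)
      also have "\<dots> \<le> 4 * N\<^sup>2 / \<kappa> ^ 4"
      proof (rule divide_right_mono)
        show "2 * (norm h)\<^sup>2 \<le> 4 * N\<^sup>2" using hN zero_le_power2[of N] by linarith
      qed simp
      also have "\<dots> = (2 * N / q ^ 4)\<^sup>2"
        unfolding q(2)[symmetric] by (simp add: power_divide power_mult_distrib power_mult[symmetric])
      finally show "(norm ?W)\<^sup>2 \<le> (2 * N / q ^ 4)\<^sup>2" .
    qed (use N q in simp)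
    moreover have "wL = ?e + ?W"
      unfolding wL_def w_def
      by (rule abs_L2_add) (simp_all add: interval_of_heat_def sq_e WQ(4))
    ultimately show ?thesis using norm_triangle_ineq[of ?e ?W] by simp
  qed
  have cbound: "cmod c * cmod D \<le> N * (4 / q + 2 + 4 * q\<^sup>2)"
  proof -
    have "cmod c * cmod D = cmod (2 * k * W 0 + (A - B) / 2 + k * (A + B) / 2)"
      by (simp add: norm_mult[symmetric] cD)
    also have "\<dots> \<le> cmod (2 * k * W 0) + cmod ((A - B) / 2) + cmod (k * (A + B) / 2)"
      by (intro order_trans[OF norm_triangle_ineq] add_mono norm_triangle_ineq order_refl)
    also have "\<dots> \<le> 4 * N / q + 2 * N + 4 * N * \<kappa>"
    proof (intro add_mono)
      have "cmod (2 * k * W 0) \<le> 2 * (2 * \<kappa>) * (N / q ^ 3)"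
        unfolding norm_mult using kn W0 \<kappa>(2) by (intro mult_mono) simp_all
      also have "\<dots> = 4 * N / q"
        unfolding q(2)[symmetric] using q(1) by (simp add: power2_eq_square power3_eq_cube)
      finally show "cmod (2 * k * W 0) \<le> 4 * N / q" .
      show "cmod ((A - B) / 2) \<le> 2 * N"
        using norm_triangle_ineq4[of A B] AB M by (simp add: norm_divide)
      have "cmod (A + B) \<le> 4 * N" using norm_triangle_ineq[of A B] AB M by simp
      then have "cmod k * cmod (A + B) \<le> (2 * \<kappa>) * (4 * N)"
        using kn \<kappa>(2) by (intro mult_mono) simp_all
      then show "cmod (k * (A + B) / 2) \<le> 4 * N * \<kappa>"
        by (simp add: norm_mult norm_divide mult.commute[of \<kappa>])
    qed
    also have "\<dots> = N * (4 / q + 2 + 4 * q\<^sup>2)" by (simp add: q(2) algebra_simps)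
    finally show ?thesis .
  qed
  have "state_norm (uL, vL, wL) \<le> norm pL + norm vL + norm wL"
  proof -
    have "state_norm (uL, vL, wL) = sqrt ((norm pL)\<^sup>2 + (norm vL)\<^sup>2 + (norm wL)\<^sup>2)"
      by (simp add: state_norm_def su(2))
    also have "\<dots> \<le> norm pL + norm vL + norm wL"
      by (rule real_le_lsqrt) (simp_all add: power2_eq_square algebra_simps)
    finally show ?thesis .
  qed
  also have "\<dots> \<le> 2 * (cmod c + 2 * N) + ((cmod c + 2 * N + N / q ^ 3) / q + 2 * N / q ^ 4)"
    using nv np nw by simp
  also have "\<dots> \<le> 69 * (q\<^sup>2 + 1 / q ^ 4) * N"
    by (rule resolvent_bound_arithmetic[OF q(1) N(4) D[folded q(2)] cbound]) simp
  also have "q\<^sup>2 + 1 / q ^ 4 = sqrt (\<bar>s\<bar> / 2) + 2 / \<bar>s\<bar>"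
  proof -
    have "q ^ 4 = \<kappa>\<^sup>2" unfolding q(2)[symmetric] by (simp add: power_mult[symmetric])
    also have "\<dots> = \<bar>s\<bar> / 2" by (simp add: \<kappa>(1))
    finally have "q\<^sup>2 + 1 / q ^ 4 = \<kappa> + 1 / (\<bar>s\<bar> / 2)" by (simp only: q(2))
    then show ?thesis by (simp add: \<kappa>(1))
  qed
  finally show ?thesis using dom op unfolding N_def by blast
qed

text \<open>For zero data the invariants are pure exponentials, and \<open>w' + k w\<close> is a multiple of
  \<open>exp (k x)\<close>. Square integrability forces this multiple to be zero, so \<open>w' = - k w\<close>, and
  the matching conditions say that the determinant times \<open>c\<close> vanishes.\<close>

lemma shifted_op_kernel_trivial:
  fixes s :: real
  assumes s: "s \<noteq> 0" and z: "(u, v, w) \<in> wave_heat_dom" and ker: "shifted_op (\<i> * of_real s) (u, v, w) = 0"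
  shows "(u, v, w) = 0"
proof -
  define a where "a = \<i> * complex_of_real s"
  define k where "k = csqrt (\<i> * of_real s)"
  have a0: "a \<noteq> 0" using s by (simp add: a_def)
  have kk: "k * k = a" and kpos: "0 < Re k" and kI: "Im k = Re k \<or> Im k = - Re k"
    using csqrt_imaginary_Im[OF s] csqrt_imaginary_square[OF s] csqrt_imaginary_pos[OF s]
    unfolding k_def[symmetric] a_def by blast+
  have cS: "is_interval {-1..0::real}" "closed {-1..0::real}" and cH: "is_interval {0::real..}" "closed {0::real..}"
    by (simp_all add: is_interval_cc is_interval_ci)
  define p where "p = weak_derivative u"
  define r where "r = weak_derivative w"
  have H: "u \<in> H1" "p \<in> H1" "v \<in> H1" "w \<in> H1" "r \<in> H1"
    and bc: "value_at v (-1) = 0" "value_at p 0 = value_at r 0" "value_at v 0 = value_at w 0"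
    using z by (auto simp: wave_heat_dom_def H2_def p_def r_def)
  have eq: "a *\<^sub>C u - v = 0" "a *\<^sub>C v - weak_derivative p = 0" "a *\<^sub>C w - weak_derivative r = 0"
    using ker by (simp_all add: shifted_op_def scale_state_def wave_heat_op_def a_def p_def r_def zero_prod_def)
  then have eq: "v = a *\<^sub>C u" "weak_derivative p = a *\<^sub>C v" "weak_derivative r = a *\<^sub>C w"
    by simp_all
  have v': "weak_derivative v = a *\<^sub>C p" unfolding eq(1) p_def by (rule weak_derivative_scaleC[OF H(1)])
  have scaled: "AE x in lebesgue_on (interval_of TYPE('i)). rep_L2 (c *\<^sub>C e) x = c * value_at e x"
    if "e \<in> H1" for c and e :: "'i::connected_interval_index L2"
    using rep_L2_scaleC[of c e] H1_value_at(2)[OF that] by eventually_elim simp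
  have PV: "primitive_on {-1..0} (value_at v) (\<lambda>x. a * value_at p x)"
    using H1_primitive_AE[OF H(3), of "\<lambda>x. a * value_at p x"] scaled[OF H(2), of a] by (simp add: v' closure_wave)
  have PP: "primitive_on {-1..0} (value_at p) (\<lambda>x. a * value_at v x)"
    using H1_primitive_AE[OF H(2), of "\<lambda>x. a * value_at v x"] scaled[OF H(3), of a] by (simp add: eq closure_wave)
  have PW: "primitive_on {0..} (value_at w) (value_at r)"
    using H1_primitive_AE[OF H(4), of "value_at r"] H1_value_at(2)[OF H(5)] by (simp add: r_def closure_heat)
  have PR: "primitive_on {0..} (value_at r) (\<lambda>x. a * value_at w x)"
    using H1_primitive_AE[OF H(5), of "\<lambda>x. a * value_at w x"] scaled[OF H(4), of a] by (simp add: eq closure_heat)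
  have "primitive_on {-1..0} (\<lambda>x. value_at v x + value_at p x) (\<lambda>x. a * (value_at v x + value_at p x))"
    by (rule primitive_on_cong[OF primitive_on_add[OF PV PP] cS(1)]) (simp_all add: algebra_simps)
  then obtain c1 where c1: "\<And>x. x \<in> {-1..0} \<Longrightarrow> value_at v x + value_at p x = c1 * exp (a * of_real x)"
    using primitive_on_homogeneous[OF cS] by blast
  have "primitive_on {-1..0} (\<lambda>x. value_at v x - value_at p x) (\<lambda>x. - a * (value_at v x - value_at p x))"
    by (rule primitive_on_cong[OF primitive_on_diff[OF PV PP] cS(1)]) (simp_all add: algebra_simps)
  then obtain c2 where c2: "\<And>x. x \<in> {-1..0} \<Longrightarrow> value_at v x - value_at p x = c2 * exp (- a * of_real x)"
    using primitive_on_homogeneous[OF cS] by blast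
  have "primitive_on {0..} (\<lambda>x. value_at r x + k * value_at w x) (\<lambda>x. k * (value_at r x + k * value_at w x))"
    by (rule primitive_on_cong[OF primitive_on_add[OF PR primitive_on_cmult[OF PW, of k]] cH(1)])
       (simp_all add: kk[symmetric] algebra_simps)
  then obtain y0 where y0: "\<And>x. x \<in> {0..} \<Longrightarrow> value_at r x + k * value_at w x = y0 * exp (k * of_real x)"
    using primitive_on_homogeneous[OF cH] by blast
  have "y0 = 0"
  proof (rule growing_exp_not_square_integrable[OF kpos])
    show "square_integrable {0<..} (\<lambda>x. value_at r x + k * value_at w x)"
      by (intro square_integrable_add square_integrable_scale square_integrable_value_at H)
    show "value_at r x + k * value_at w x = y0 * exp (k * of_real x)" if "0 \<le> x" for x
      using y0[of x] that by simp
  qed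
  then have rw: "value_at r x = - k * value_at w x" if "x \<in> {0..}" for x
    using y0[OF that] by (simp add: add_eq_0_iff)
  have "primitive_on {0..} (value_at w) (\<lambda>x. - k * value_at w x)"
    by (rule primitive_on_cong[OF PW cH(1) refl rw])
  then obtain b where b: "\<And>x. x \<in> {0..} \<Longrightarrow> value_at w x = b * exp (- k * of_real x)"
    using primitive_on_homogeneous[OF cH] by blast
  \<comment> \<open>The value of \<open>p\<close> at \<open>-1\<close>, where \<open>v\<close> vanishes.\<close>
  define c where "c = c1 * exp (- a)"
  have eul: "exp a = of_real (cos s) + \<i> * of_real (sin s)" "exp (- a) = of_real (cos s) - \<i> * of_real (sin s)"
    using exp_Euler[of "of_real s"] exp_Euler[of "of_real (- s)"]
    by (simp_all add: a_def cos_of_real sin_of_real)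
  have ee: "exp (- a) * exp a = 1" by (simp add: exp_add[symmetric])
  have C1: "c1 = c * exp a" by (simp add: c_def mult.assoc ee)
  have C2: "c2 = - c * exp (- a)"
  proof -
    have "value_at v (-1) + value_at p (-1) = c" "value_at v (-1) - value_at p (-1) = c2 * exp a"
      using c1[of "-1"] c2[of "-1"] by (simp_all add: c_def)
    then have H: "c2 * exp a = - c" using bc(1) by simp
    have "c2 = (c2 * exp a) * exp (- a)"
      by (simp only: mult.assoc exp_add[symmetric] add.right_inverse exp_zero mult_1_right)
    then show ?thesis by (simp only: H)
  qed
  have sum0: "value_at v 0 + value_at p 0 = c1" "value_at v 0 - value_at p 0 = c2"
    using c1[of 0] c2[of 0] by simp_all
  have "2 * (value_at p 0 + k * value_at v 0) = (c1 - c2) + k * (c1 + c2)"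
    unfolding sum0[symmetric] by (simp add: algebra_simps)
  also have "\<dots> = 2 * (c * (of_real (cos s) + \<i> * k * of_real (sin s)))"
    unfolding C1 C2 eul by (simp add: algebra_simps)
  finally have "value_at p 0 + k * value_at v 0 = c * (of_real (cos s) + \<i> * k * of_real (sin s))"
    by (simp only: mult_cancel_left numeral_neq_zero simp_thms)
  then have "c * (of_real (cos s) + \<i> * k * of_real (sin s)) = value_at p 0 + k * value_at v 0"
    by (rule sym)
  also have "\<dots> = 0" using bc(2,3) rw[of 0] by simp
  finally have "c * (of_real (cos s) + \<i> * k * of_real (sin s)) = 0" .
  moreover have "of_real (cos s) + \<i> * k * of_real (sin s) \<noteq> 0"
    using interface_determinant_bound[OF refl kI kpos, of s] kpos by auto
  ultimately have "c = 0" by simp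
  then have "c1 = 0" "c2 = 0" using C1 C2 by simp_all
  then have vp: "value_at v x = 0" if "x \<in> {-1..0}" for x
    using c1[OF that] c2[OF that] by (simp add: add_eq_0_iff)
  have v0: "v = 0" by (rule H1_eq_zeroI[OF H(3)]) (simp add: vp closure_wave)
  have b0: "b = 0" using b[of 0] bc(3) vp[of 0] by simp
  have wz: "value_at w x = 0" if "x \<in> {0..}" for x unfolding b[OF that] b0 by simp
  have w0: "w = 0" by (rule H1_eq_zeroI[OF H(4)]) (rule wz, simp add: closure_heat)
  have "a *\<^sub>C u = 0" unfolding eq(1)[symmetric] by (rule v0)
  then have u0: "u = 0" using a0 by (rule scaleC_eq_zero_imp)
  show ?thesis using u0 v0 w0 by (simp add: zero_prod_def)
qed

section \<open>The resolvent on the imaginary axis\<close>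

lemma shifted_op_diff:
  assumes z: "z \<in> wave_heat_dom" "z' \<in> wave_heat_dom"
  shows "z - z' \<in> wave_heat_dom" "shifted_op \<mu> (z - z') = shifted_op \<mu> z - shifted_op \<mu> z'"
proof -
  obtain u v w u' v' w' where eq: "z = (u, v, w)" "z' = (u', v', w')"
    by (cases z, cases z') auto
  have H: "u \<in> H1" "weak_derivative u \<in> H1" "v \<in> H1" "w \<in> H1" "weak_derivative w \<in> H1"
     "u' \<in> H1" "weak_derivative u' \<in> H1" "v' \<in> H1" "w' \<in> H1" "weak_derivative w' \<in> H1"
    using z by (auto simp: eq wave_heat_dom_def H2_def)
  have cl: "-1 \<in> closure (interval_of TYPE(wave))" "0 \<in> closure (interval_of TYPE(wave))" "0 \<in> closure (interval_of TYPE(heat))"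
    by (simp_all add: closure_wave closure_heat)
  note simps = weak_derivative_diff[OF H(1,6)] weak_derivative_diff[OF H(2,7)] weak_derivative_diff[OF H(4,9)]
    weak_derivative_diff[OF H(5,10)]
  show "z - z' \<in> wave_heat_dom"
    using z value_at_diff[OF H(1,6) cl(1)] value_at_diff[OF H(3,8) cl(1)] value_at_diff[OF H(3,8) cl(2)]
      value_at_diff[OF H(2,7) cl(2)] value_at_diff[OF H(4,9) cl(3)] value_at_diff[OF H(5,10) cl(3)]
    by (simp add: eq wave_heat_dom_def H2_def simps H1_diff H)
  show "shifted_op \<mu> (z - z') = shifted_op \<mu> z - shifted_op \<mu> z'"
    by (simp add: eq shifted_op_def scale_state_def wave_heat_op_def simps scaleC_diff)
qed

lemma shifted_op_in_state_space:
  assumes "z \<in> wave_heat_dom" shows "shifted_op \<mu> z \<in> state_space"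
proof -
  obtain u v w where eq: "z = (u, v, w)" by (cases z) auto
  have H: "u \<in> H1" "v \<in> H1" "value_at u (-1) = 0" "value_at v (-1) = 0"
    using assms by (auto simp: eq wave_heat_dom_def H2_def)
  have cl: "-1 \<in> closure (interval_of TYPE(wave))" by (simp add: closure_wave)
  have "\<mu> *\<^sub>C u - v \<in> H1" by (intro H1_diff H1_scaleC H)
  moreover have "value_at (\<mu> *\<^sub>C u - v) (-1) = 0"
    using value_at_diff[OF H1_scaleC[OF H(1)] H(2) cl, of \<mu>] value_at_scaleC[OF H(1) cl, of \<mu>] H by simp
  ultimately show ?thesis
    by (simp add: eq state_space_def shifted_op_def scale_state_def wave_heat_op_def)
qed

lemma zero_in_state_space: "(0, 0, 0) \<in> state_space"
proof -
  note z = H1_if_primitive[OF primitive_on_const rep_L2_zero[where 'i = wave] rep_L2_zero[where 'i = wave]]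
  from z(1) z(3)[of "-1"] show ?thesis by (simp add: state_space_def closure_wave)
qed

lemma state_norm_nonneg: "0 \<le> state_norm y"
  by (cases y) (simp add: state_norm_def)

text \<open>By injectivity the resolvent of \<open>y\<close> is the solution constructed above and inherits its
  bound.\<close>

lemma imaginary_resolvent:
  fixes s :: real
  assumes s: "s \<noteq> 0"
  defines "C \<equiv> 69 * (sqrt (\<bar>s\<bar> / 2) + 2 / \<bar>s\<bar>)"
  shows imaginary_in_resolvent_set: "\<i> * of_real s \<in> resolvent_set"
    and imaginary_resolvent_bound: "\<bar>state_onorm (resolvent (\<i> * of_real s))\<bar> \<le> C"
proof -
  let ?\<mu> = "\<i> * complex_of_real s"
  have inj: "inj_on (shifted_op ?\<mu>) wave_heat_dom"
  proof (rule inj_onI)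
    fix z z' assume z: "z \<in> wave_heat_dom" "z' \<in> wave_heat_dom" "shifted_op ?\<mu> z = shifted_op ?\<mu> z'"
    obtain u v w where d: "z - z' = (u, v, w)" by (cases "z - z'") auto
    have "shifted_op ?\<mu> (z - z') = 0" using shifted_op_diff(2)[OF z(1,2)] z(3) by simp
    then have "z - z' = 0"
      using shifted_op_kernel_trivial[OF s, of u v w] shifted_op_diff(1)[OF z(1,2)] unfolding d by blast
    then show "z = z'" by simp
  qed
  have sol: "\<exists>z\<in>wave_heat_dom. shifted_op ?\<mu> z = y \<and> state_norm z \<le> C * state_norm y"
    if "y \<in> state_space" for y
  proof -
    obtain f g h where "y = (f, g, h)" by (cases y) auto
    then show ?thesis using resolvent_equation_solvable[OF s, of f g h] that unfolding C_def by blast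
  qed
  have bij: "bij_betw (shifted_op ?\<mu>) wave_heat_dom state_space"
    unfolding bij_betw_def
  proof (intro conjI inj equalityI subsetI)
    fix y assume "y \<in> shifted_op ?\<mu> ` wave_heat_dom"
    then show "y \<in> state_space" using shifted_op_in_state_space by blast
  next
    fix y assume "y \<in> state_space"
    then show "y \<in> shifted_op ?\<mu> ` wave_heat_dom" using sol[of y] by blast
  qed
  have bound: "state_norm (resolvent ?\<mu> y) \<le> C * state_norm y" if y: "y \<in> state_space" for y
  proof -
    obtain z where z: "z \<in> wave_heat_dom" "shifted_op ?\<mu> z = y" "state_norm z \<le> C * state_norm y"
      using sol[OF y] by blast
    have "resolvent ?\<mu> y = z"
      unfolding resolvent_def z(2)[symmetric] by (rule inv_into_f_f[OF inj z(1)])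
    then show ?thesis using z(3) by simp
  qed
  show "?\<mu> \<in> resolvent_set"
    unfolding resolvent_set_def using bij bound by blast
  have C0: "0 \<le> C" by (simp add: C_def)
  let ?q = "\<lambda>y. state_norm (resolvent ?\<mu> y) / state_norm y"
  have q: "?q y \<le> C" if "y \<in> state_space" for y
  proof (cases "state_norm y = 0")
    case False
    then have "0 < state_norm y" using state_norm_nonneg[of y] by simp
    then show ?thesis using bound[OF that] by (simp add: pos_divide_le_eq)
  qed (simp add: C0)
  have up: "state_onorm (resolvent ?\<mu>) \<le> C"
    unfolding state_onorm_def using zero_in_state_space q by (intro cSUP_least) auto
  have "?q (0, 0, 0) \<le> state_onorm (resolvent ?\<mu>)"
    unfolding state_onorm_def
    by (rule cSUP_upper[OF zero_in_state_space bdd_aboveI2[OF q]])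
  moreover have "0 \<le> ?q (0, 0, 0)" by (intro divide_nonneg_nonneg state_norm_nonneg)
  ultimately show "\<bar>state_onorm (resolvent ?\<mu>)\<bar> \<le> C" using up by linarith
qed

theorem theorem3p1:
  shows "(\<forall>s::real. s \<noteq> 0 \<longrightarrow> \<i> * of_real s \<in> resolvent_set) \<and>
    (\<lambda>s::real. state_onorm (resolvent (\<i> * of_real s))) \<in> O[at_infinity](\<lambda>s. \<bar>s\<bar> powr (1/2)) \<and>
    (\<lambda>s::real. state_onorm (resolvent (\<i> * of_real s))) \<in> O[at 0](\<lambda>s. \<bar>s\<bar> powr (-1))"
proof (intro conjI allI impI)
  show "\<i> * of_real s \<in> resolvent_set" if "s \<noteq> 0" for s :: real
    using that by (rule imaginary_in_resolvent_set)
  \<comment> \<open>In either regime both \<open>sqrt (\<bar>s\<bar> / 2)\<close> and half of \<open>2 / \<bar>s\<bar>\<close> are at most the larger power, and \<open>207 = 3 * 69\<close>.\<close>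
  have large: "norm (state_onorm (resolvent (\<i> * of_real s))) \<le> 207 * norm (\<bar>s\<bar> powr (1/2))"
    if s: "1 \<le> \<bar>s\<bar>" for s :: real
  proof -
    have "sqrt (\<bar>s\<bar> / 2) \<le> sqrt \<bar>s\<bar>" "1 \<le> sqrt \<bar>s\<bar>" "2 / \<bar>s\<bar> \<le> 2"
      using s by (simp_all add: pos_divide_le_eq)
    moreover have "69 * (a + b) \<le> 207 * c" if "a \<le> c" "1 \<le> c" "b \<le> 2" for a b c :: real
      using that by simp
    ultimately have "69 * (sqrt (\<bar>s\<bar> / 2) + 2 / \<bar>s\<bar>) \<le> 207 * sqrt \<bar>s\<bar>" by blast
    moreover have "s \<noteq> 0" using s by auto
    ultimately show ?thesis
      using imaginary_resolvent_bound[of s] s by (simp add: powr_half_sqrt)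
  qed
  show "(\<lambda>s::real. state_onorm (resolvent (\<i> * of_real s))) \<in> O[at_infinity](\<lambda>s. \<bar>s\<bar> powr (1/2))"
    by (rule bigoI[where c = 207]) (unfold eventually_at_infinity, use large in \<open>auto intro!: exI[of _ 1]\<close>)
  have small: "norm (state_onorm (resolvent (\<i> * of_real s))) \<le> 207 * norm (\<bar>s\<bar> powr (-1))"
    if s: "s \<noteq> 0" "\<bar>s\<bar> \<le> 1" for s :: real
  proof -
    have "sqrt (\<bar>s\<bar> / 2) \<le> 1" "1 \<le> 1 / \<bar>s\<bar>"
      using s by (simp_all add: pos_le_divide_eq)
    moreover have "69 * (a + 2 * d) \<le> 207 * d" if "a \<le> 1" "1 \<le> d" for a d :: real
      using that by simp
    ultimately have "69 * (sqrt (\<bar>s\<bar> / 2) + 2 * (1 / \<bar>s\<bar>)) \<le> 207 * (1 / \<bar>s\<bar>)" by blast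
    then show ?thesis
      using imaginary_resolvent_bound[OF s(1)] s by (simp add: powr_minus_divide)
  qed
  show "(\<lambda>s::real. state_onorm (resolvent (\<i> * of_real s))) \<in> O[at 0](\<lambda>s. \<bar>s\<bar> powr (-1))"
    by (rule bigoI[where c = 207]) (unfold eventually_at, use small in \<open>auto intro!: exI[of _ 1]\<close>)
qed

end
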